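(* Let $\alpha\in(0,2]$ and $s>0$. 1. For any $f\in L^\alpha(K,\mu)$ and every $i\in\{0,1,2\}$, $f\circ\sigma_i\in L^\alpha(K,\mu)$ and $W_{K,\alpha}(f\circ\sigma_i)$ has the same distribution as $W_{K,\alpha}(f)$. 2. For every $i\in\{0,1,2\}$, the fields $\left(X_{s,\alpha}(f\circ\sigma_i)\right)_{f\in H^{-s}(K)}$ and $\left(X_{s,\alpha}(f)\right)_{f\in H^{-s}(K)}$ have the same finite-dimensional distributions. 3. Moreover, if $s>\max\left(\frac{(\alpha-1)d_h}{\alpha d_w},0\right)$, then for every $i\in\{0,1,2\}$ the fields $\left(\widetilde X_{s,\alpha}(\sigma_i(x))\right)_{x\in K}$ and $\left(\widetilde X_{s,\alpha}(x)\right)_{x\in K}$ have the same finite-dimensional distributions.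
   Context: Sierpiński gasket: let $q_0=0,q_1=1,q_2=e^{i\pi/3}\in\mathbb C$ and $F_i(z)=\frac12(z-q_i)+q_i$, $i\in\{0,1,2\}$; $K\subset\mathbb C$ is the unique nonempty compact set with $K=\bigcup_{i=0}^2F_i(K)$, with the unique Borel probability measure $\mu$ such that $\mu(F_{i_1}\circ\cdots\circ F_{i_n}(K))=3^{-n}$ for all $i_1,\dots,i_n$. Put $d_h=\frac{\ln3}{\ln2}$, $d_w=\frac{\ln5}{\ln2}$. $\sigma_0,\sigma_1,\sigma_2$ are the reflections about the three lines dividing the triangle with vertices $q_0,q_1,q_2$ into two equal parts (its axes of symmetry). Neumann Laplacian: let $V_0=\{q_0,q_1,q_2\}$; for $\boldsymbol i\in\{0,1,2\}^n$ let $W_{\boldsymbol i}=F_{i_1}\circ\cdots\circ F_{i_n}(V_0)$, $V_n=\bigcup_{\boldsymbol i}W_{\boldsymbol i}$, $V_*=\bigcup_nV_n$, and $\mathcal E_n(f,f)=\frac12(\frac53)^n\sum_{\boldsymbol i\in\{0,1,2\}^n}\sum_{x,y\in W_{\boldsymbol i}}(f(x)-f(y))^2$. Functions $f$ on $V_*$ with $\mathcal E(f,f)=\lim_n\mathcal E_n(f,f)<\infty$ extend uniquely to continuous functions on $K$; with $\mathcal F$ the set of these extensions, $(\mathcal E,\mathcal F)$ is a local regular Dirichlet form on $L^2(K,\mu)$. $\Delta$ is its generator (Neumann Laplacian) and $p_t(x,y)$ its jointly continuous heat kernel with respect to $\mu$. Let $L^2_0(K,\mu)=\{f\in L^2(K,\mu):\int_Kf\,d\mu=0\}$,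 let $0<\lambda_1\le\lambda_2\le\cdots$ be the eigenvalues of $-\Delta$ on $L_0^2(K,\mu)$ and $(\Phi_j)_{j\ge1}$ an orthonormal basis of $L^2_0(K,\mu)$ with $\Delta\Phi_j=-\lambda_j\Phi_j$. For $s\ge0$ and $f\in L^2_0(K,\mu)$, $(-\Delta)^{-s}f=\sum_{j\ge1}\lambda_j^{-s}\left(\int_K\Phi_jf\,d\mu\right)\Phi_j$. Sobolev space: $H^{-s}(K)$ is the completion of $L^2_0(K,\mu)$ with respect to the norm $\|f\|_{H^{-s}(K)}=\|(-\Delta)^{-s}f\|_{L^2(K,\mu)}$; $(-\Delta)^{-s}$ extends by continuity to $H^{-s}(K)$ with values in $L^2_0(K,\mu)$, and $f\mapsto f\circ\sigma_i$ is understood on $H^{-s}(K)$ as the continuous extension of the map on $L_0^2(K,\mu)$. Fractional Riesz kernel: for $s>0$, $G_s(x,y)=\frac1{\Gamma(s)}\int_0^{+\infty}t^{s-1}(p_t(x,y)-1)\,dt$ for $x\ne y$ (and also for $x=y$ when $s>d_h/d_w$). Stable measure: $W_{K,\alpha}$ is a real-valued symmetric $\alpha$-stable random measure on $K$ with control measure $\mu$: $\sigma$-additive (almost surely), independently scattered, with $\mathbb E(e^{iuW_{K,\alpha}(A)})=e^{-|u|^\alpha\mu(A)}$. For $f\in L^\alpha(K,\mu)$ the stochastic integral $W_{K,\alpha}(f)=\int_Kf\,dW_{K,\alpha}$ satisfies $\mathbb E(e^{iuW_{K,\alpha}(f)})=e^{-|u|^\alpha\int_K|f|^\alpha d\mu}$.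 Fields: $X_{s,\alpha}(f)=W_{K,\alpha}((-\Delta)^{-s}f)$ for $f\in H^{-s}(K)$; and, for $s>\max\left(\frac{(\alpha-1)d_h}{\alpha d_w},0\right)$, $\widetilde X_{s,\alpha}(x)=\int_KG_s(x,z)\,W_{K,\alpha}(dz)$, $x\in K$. *)

theory Defs
  imports "HOL-Probability.Probability"
begin

section \<open>The gasket, its symmetries and its self-similar measure\<close>

definition gasket_vertex :: "nat \<Rightarrow> complex" where
  "gasket_vertex i = (if i = 0 then 0 else if i = 1 then 1 else exp (\<i> * of_real (pi / 3)))"

definition gasket_map :: "nat \<Rightarrow> complex \<Rightarrow> complex" where
  "gasket_map i z = (z - gasket_vertex i) / 2 + gasket_vertex i"

definition gasket_words :: "nat \<Rightarrow> nat list set" where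
  "gasket_words n = {w. length w = n \<and> set w \<subseteq> {0, 1, 2}}"

primrec word_map :: "nat list \<Rightarrow> complex \<Rightarrow> complex" where
  "word_map [] = id"
| "word_map (i # w) = gasket_map i \<circ> word_map w"

definition sierpinski_gasket :: "complex set \<Rightarrow> bool" where
  "sierpinski_gasket K \<longleftrightarrow>
     compact K \<and> K \<noteq> {} \<and> K = (\<Union>i\<in>{0, 1, 2}. gasket_map i ` K)"

text \<open>The space of the measure is \<open>K\<close> itself. Functions on \<open>K\<close> are modelled by functions on the
  whole plane whose values outside \<open>K\<close> are never used.\<close>

definition gasket_measure :: "complex set \<Rightarrow> complex measure \<Rightarrow> bool" where
  "gasket_measure K \<mu> \<longleftrightarrow>
     prob_space \<mu> \<and> space \<mu> = K \<and> sets \<mu> = sets (restrict_space borel K) \<and>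
     (\<forall>n. \<forall>w\<in>gasket_words n. measure \<mu> (word_map w ` K) = (1 / 3) ^ n)"

definition line_reflection :: "complex \<Rightarrow> complex \<Rightarrow> complex \<Rightarrow> complex" where
  "line_reflection a b z = a + (b - a) * cnj ((z - a) / (b - a))"

text \<open>The axes of symmetry of the triangle are its medians.\<close>

definition gasket_sym :: "nat \<Rightarrow> complex \<Rightarrow> complex" where
  "gasket_sym i = line_reflection (gasket_vertex i)
     (midpoint (gasket_vertex ((i + 1) mod 3)) (gasket_vertex ((i + 2) mod 3)))"

lemma gasket_sym_vertex:
  "gasket_sym i (gasket_vertex i) = gasket_vertex i"
  by (simp add: gasket_sym_def line_reflection_def)

lemma gasket_sym_swaps:
  "gasket_sym 0 (gasket_vertex 1) = gasket_vertex 2" "gasket_sym 0 (gasket_vertex 2) = gasket_vertex 1"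
  "gasket_sym 1 (gasket_vertex 2) = gasket_vertex 0" "gasket_sym 1 (gasket_vertex 0) = gasket_vertex 2"
  "gasket_sym 2 (gasket_vertex 0) = gasket_vertex 1" "gasket_sym 2 (gasket_vertex 1) = gasket_vertex 0"
proof -
  have v: "gasket_vertex 0 = 0" "gasket_vertex (Suc 0) = 1" "gasket_vertex 2 = Complex (1/2) (sqrt 3 / 2)"
    by (auto simp: gasket_vertex_def complex_eq_iff Re_exp Im_exp cos_60 sin_60)
  show
    "gasket_sym 0 (gasket_vertex 1) = gasket_vertex 2" "gasket_sym 0 (gasket_vertex 2) = gasket_vertex 1"
    "gasket_sym 1 (gasket_vertex 2) = gasket_vertex 0" "gasket_sym 1 (gasket_vertex 0) = gasket_vertex 2"
    "gasket_sym 2 (gasket_vertex 0) = gasket_vertex 1" "gasket_sym 2 (gasket_vertex 1) = gasket_vertex 0"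
    by (simp_all add: gasket_sym_def line_reflection_def midpoint_def v complex_eq_iff numeral_2_eq_2[symmetric]
        Re_divide Im_divide power2_eq_square field_simps)
qed

definition dim_h :: real where "dim_h = ln 3 / ln 2"

definition dim_w :: real where "dim_w = ln 5 / ln 2"


section \<open>Lebesgue spaces\<close>

text \<open>Elements are functions rather than classes modulo null sets.\<close>

definition L_space :: "'a measure \<Rightarrow> real \<Rightarrow> ('a \<Rightarrow> real) set" where
  "L_space \<mu> \<alpha> = {f \<in> borel_measurable \<mu>. integrable \<mu> (\<lambda>x. \<bar>f x\<bar> powr \<alpha>)}"

definition L2_inner :: "'a measure \<Rightarrow> ('a \<Rightarrow> real) \<Rightarrow> ('a \<Rightarrow> real) \<Rightarrow> real" where
  "L2_inner \<mu> f g = (\<integral>x. f x * g x \<partial>\<mu>)"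

definition L2_norm :: "'a measure \<Rightarrow> ('a \<Rightarrow> real) \<Rightarrow> real" where
  "L2_norm \<mu> f = sqrt (L2_inner \<mu> f f)"

definition L2_zero :: "'a measure \<Rightarrow> ('a \<Rightarrow> real) set" where
  "L2_zero \<mu> = {f \<in> L_space \<mu> 2. (\<integral>x. f x \<partial>\<mu>) = 0}"


section \<open>The Dirichlet form, the Neumann Laplacian and its heat kernel\<close>

definition gasket_energy_level ::
    "nat \<Rightarrow> (complex \<Rightarrow> real) \<Rightarrow> (complex \<Rightarrow> real) \<Rightarrow> real" where
  "gasket_energy_level n f g = 1 / 2 * (5 / 3) ^ n *
     (\<Sum>w\<in>gasket_words n.
        \<Sum>x\<in>word_map w ` gasket_vertex ` {0, 1, 2}.
        \<Sum>y\<in>word_map w ` gasket_vertex ` {0, 1, 2}. (f x - f y) * (g x - g y))"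

definition gasket_energy :: "(complex \<Rightarrow> real) \<Rightarrow> (complex \<Rightarrow> real) \<Rightarrow> real" where
  "gasket_energy f g = lim (\<lambda>n. gasket_energy_level n f g)"

text \<open>The energies of \<open>f\<close> at the successive levels increase, so their limit is finite
  if and only if they converge in the reals.\<close>

definition gasket_form_domain :: "complex set \<Rightarrow> (complex \<Rightarrow> real) set" where
  "gasket_form_domain K =
     {f. continuous_on K f \<and> convergent (\<lambda>n. gasket_energy_level n f f)}"

text \<open>\<open>neumann_laplacian K \<mu> f g\<close> means that (the class of) \<open>f\<close> belongs to the domain of the
  generator of the form and is mapped to (the class of) \<open>g\<close>.\<close>

definition neumann_laplacian ::
    "complex set \<Rightarrow> complex measure \<Rightarrow> (complex \<Rightarrow> real) \<Rightarrow> (complex \<Rightarrow> real) \<Rightarrow> bool" where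
  "neumann_laplacian K \<mu> f g \<longleftrightarrow>
     f \<in> L_space \<mu> 2 \<and> g \<in> L_space \<mu> 2 \<and>
     (\<exists>u\<in>gasket_form_domain K. (AE x in \<mu>. f x = u x) \<and>
        (\<forall>v\<in>gasket_form_domain K. gasket_energy u v = - L2_inner \<mu> g v))"

text \<open>Strongly continuous semigroups of symmetric contractions of \<open>L\<^sup>2\<close>, with prescribed
  generator (given by its graph).\<close>

definition L2_semigroup_with_generator ::
    "'a measure \<Rightarrow> (real \<Rightarrow> ('a \<Rightarrow> real) \<Rightarrow> 'a \<Rightarrow> real) \<Rightarrow>
       (('a \<Rightarrow> real) \<Rightarrow> ('a \<Rightarrow> real) \<Rightarrow> bool) \<Rightarrow> bool" where
  "L2_semigroup_with_generator \<mu> T A \<longleftrightarrow>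
     (\<forall>t>0. \<forall>f\<in>L_space \<mu> 2. T t f \<in> L_space \<mu> 2 \<and> L2_norm \<mu> (T t f) \<le> L2_norm \<mu> f) \<and>
     (\<forall>t>0. \<forall>f\<in>L_space \<mu> 2. \<forall>g\<in>L_space \<mu> 2. \<forall>c.
        AE x in \<mu>. T t (\<lambda>y. c * f y + g y) x = c * T t f x + T t g x) \<and>
     (\<forall>t>0. \<forall>f\<in>L_space \<mu> 2. \<forall>g\<in>L_space \<mu> 2.
        L2_inner \<mu> (T t f) g = L2_inner \<mu> f (T t g)) \<and>
     (\<forall>r>0. \<forall>t>0. \<forall>f\<in>L_space \<mu> 2. AE x in \<mu>. T r (T t f) x = T (r + t) f x) \<and>
     (\<forall>f\<in>L_space \<mu> 2. ((\<lambda>t. L2_norm \<mu> (\<lambda>x. T t f x - f x)) \<longlongrightarrow> 0) (at_right 0)) \<and>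
     (\<forall>f\<in>L_space \<mu> 2. \<forall>g\<in>L_space \<mu> 2. A f g \<longleftrightarrow>
        ((\<lambda>t. L2_norm \<mu> (\<lambda>x. (T t f x - f x) / t - g x)) \<longlongrightarrow> 0) (at_right 0))"

definition gasket_heat_kernel ::
    "complex set \<Rightarrow> complex measure \<Rightarrow> (real \<Rightarrow> complex \<Rightarrow> complex \<Rightarrow> real) \<Rightarrow> bool" where
  "gasket_heat_kernel K \<mu> p \<longleftrightarrow>
     continuous_on ({0<..} \<times> K \<times> K) (\<lambda>(t, x, y). p t x y) \<and>
     L2_semigroup_with_generator \<mu> (\<lambda>t f x. \<integral>y. p t x y * f y \<partial>\<mu>) (neumann_laplacian K \<mu>)"

text \<open>Indices start at \<open>0\<close>: \<open>eigval j\<close> and \<open>\<Phi> j\<close> stand for \<open>\<lambda>\<^sub>j\<^sub>+\<^sub>1\<close> and \<open>\<Phi>\<^sub>j\<^sub>+\<^sub>1\<close>.\<close>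

definition laplacian_eigenbasis ::
    "complex set \<Rightarrow> complex measure \<Rightarrow> (nat \<Rightarrow> real) \<Rightarrow> (nat \<Rightarrow> complex \<Rightarrow> real) \<Rightarrow> bool" where
  "laplacian_eigenbasis K \<mu> eigval \<Phi> \<longleftrightarrow>
     0 < eigval 0 \<and> mono eigval \<and>
     (\<forall>j. \<Phi> j \<in> L2_zero \<mu> \<and> neumann_laplacian K \<mu> (\<Phi> j) (\<lambda>x. - eigval j * \<Phi> j x)) \<and>
     (\<forall>j k. L2_inner \<mu> (\<Phi> j) (\<Phi> k) = (if j = k then 1 else 0)) \<and>
     (\<forall>f\<in>L2_zero \<mu>.
        (\<lambda>n. L2_norm \<mu> (\<lambda>x. f x - (\<Sum>j<n. L2_inner \<mu> (\<Phi> j) f * \<Phi> j x))) \<longlonglongrightarrow> 0)"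


section \<open>Fractional powers and Sobolev spaces\<close>

definition laplacian_neg_power ::
    "complex measure \<Rightarrow> (nat \<Rightarrow> real) \<Rightarrow> (nat \<Rightarrow> complex \<Rightarrow> real) \<Rightarrow> real \<Rightarrow>
       (complex \<Rightarrow> real) \<Rightarrow> complex \<Rightarrow> real" where
  "laplacian_neg_power \<mu> eigval \<Phi> s f = (SOME g. g \<in> L2_zero \<mu> \<and>
     (\<lambda>n. L2_norm \<mu> (\<lambda>x. g x - (\<Sum>j<n. eigval j powr (- s) * L2_inner \<mu> (\<Phi> j) f * \<Phi> j x)))
        \<longlonglongrightarrow> 0)"

text \<open>\<open>sobolev_completion \<mu> eigval \<Phi> s \<iota>\<close> means that the Banach space \<open>'h\<close>, with canonical map \<open>\<iota>\<close>,
  is the completion \<open>H\<^sup>-\<^sup>s\<close> of \<open>L2_zero \<mu>\<close>; the values of \<open>\<iota>\<close> outside \<open>L2_zero \<mu>\<close> are never used.\<close>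

definition sobolev_completion ::
    "complex measure \<Rightarrow> (nat \<Rightarrow> real) \<Rightarrow> (nat \<Rightarrow> complex \<Rightarrow> real) \<Rightarrow> real \<Rightarrow>
       ((complex \<Rightarrow> real) \<Rightarrow> 'h::banach) \<Rightarrow> bool" where
  "sobolev_completion \<mu> eigval \<Phi> s \<iota> \<longleftrightarrow>
     (\<forall>f\<in>L2_zero \<mu>. \<forall>g\<in>L2_zero \<mu>. \<iota> (\<lambda>x. f x + g x) = \<iota> f + \<iota> g) \<and>
     (\<forall>f\<in>L2_zero \<mu>. \<forall>c. \<iota> (\<lambda>x. c * f x) = c *\<^sub>R \<iota> f) \<and>
     (\<forall>f\<in>L2_zero \<mu>. norm (\<iota> f) = L2_norm \<mu> (laplacian_neg_power \<mu> eigval \<Phi> s f)) \<and>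
     closure (\<iota> ` L2_zero \<mu>) = UNIV"

text \<open>The extension by continuity of \<open>laplacian_neg_power\<close> to the completion, computed along any
  approximating sequence (the limit is unique up to null sets).\<close>

definition sobolev_neg_power ::
    "complex measure \<Rightarrow> (nat \<Rightarrow> real) \<Rightarrow> (nat \<Rightarrow> complex \<Rightarrow> real) \<Rightarrow> real \<Rightarrow>
       ((complex \<Rightarrow> real) \<Rightarrow> 'h::banach) \<Rightarrow> 'h \<Rightarrow> complex \<Rightarrow> real" where
  "sobolev_neg_power \<mu> eigval \<Phi> s \<iota> h = (SOME g. g \<in> L2_zero \<mu> \<and>
     (\<exists>u. (\<forall>n. u n \<in> L2_zero \<mu>) \<and> (\<lambda>n. \<iota> (u n)) \<longlonglongrightarrow> h \<and>
        (\<lambda>n. L2_norm \<mu> (\<lambda>x. laplacian_neg_power \<mu> eigval \<Phi> s (u n) x - g x)) \<longlonglongrightarrow> 0))"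

definition sobolev_compose ::
    "complex measure \<Rightarrow> ((complex \<Rightarrow> real) \<Rightarrow> 'h::banach) \<Rightarrow> (complex \<Rightarrow> complex) \<Rightarrow> 'h \<Rightarrow> 'h" where
  "sobolev_compose \<mu> \<iota> \<sigma> =
     (THE \<tau>. continuous_on UNIV \<tau> \<and> (\<forall>f\<in>L2_zero \<mu>. \<tau> (\<iota> f) = \<iota> (f \<circ> \<sigma>)))"

text \<open>Where the integral below does not exist, which for \<open>s \<le> dim_h / dim_w\<close> happens on the diagonal,
  it is \<open>0\<close> by the library's convention.\<close>

definition riesz_kernel ::
    "(real \<Rightarrow> complex \<Rightarrow> complex \<Rightarrow> real) \<Rightarrow> real \<Rightarrow> complex \<Rightarrow> complex \<Rightarrow> real" where
  "riesz_kernel p s x y = 1 / Gamma s * (LBINT t:{0<..}. t powr (s - 1) * (p t x y - 1))"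


section \<open>Stable random measures and the associated fields\<close>

definition stable_random_measure ::
    "'w measure \<Rightarrow> 'a measure \<Rightarrow> real \<Rightarrow> ('a set \<Rightarrow> 'w \<Rightarrow> real) \<Rightarrow> bool" where
  "stable_random_measure P \<mu> \<alpha> W \<longleftrightarrow>
     prob_space P \<and>
     (\<forall>A\<in>sets \<mu>. W A \<in> borel_measurable P \<and>
        (\<forall>u. char (distr P borel (W A)) u =
             complex_of_real (exp (- (\<bar>u\<bar> powr \<alpha> * measure \<mu> A))))) \<and>
     (\<forall>A :: nat \<Rightarrow> 'a set. range A \<subseteq> sets \<mu> \<longrightarrow> disjoint_family A \<longrightarrow>
        (AE \<omega> in P. (\<lambda>n. W (A n) \<omega>) sums W (\<Union>n. A n) \<omega>) \<and>
        prob_space.indep_vars P (\<lambda>_. borel) (\<lambda>n. W (A n)) UNIV)"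

definition simple_stable_integral ::
    "'a measure \<Rightarrow> ('a set \<Rightarrow> 'w \<Rightarrow> real) \<Rightarrow> ('a \<Rightarrow> real) \<Rightarrow> 'w \<Rightarrow> real" where
  "simple_stable_integral \<mu> W f \<omega> = (\<Sum>c\<in>f ` space \<mu>. c * W (f -` {c} \<inter> space \<mu>) \<omega>)"

text \<open>The stochastic integral of \<open>f \<in> L\<^sup>\<alpha>\<close> is the limit in probability of the integrals of simple
  functions converging to \<open>f\<close> in \<open>L\<^sup>\<alpha>\<close>. As for the Bochner integral of the library, it is
  \<open>0\<close> by convention when \<open>f\<close> is not integrable.\<close>

definition stable_integral ::
    "'w measure \<Rightarrow> 'a measure \<Rightarrow> real \<Rightarrow> ('a set \<Rightarrow> 'w \<Rightarrow> real) \<Rightarrow> ('a \<Rightarrow> real) \<Rightarrow> 'w \<Rightarrow> real" where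
  "stable_integral P \<mu> \<alpha> W f =
     (if f \<in> L_space \<mu> \<alpha> then
        (SOME Y. Y \<in> borel_measurable P \<and>
          (\<exists>u. (\<forall>n. simple_function \<mu> (u n)) \<and>
             (\<lambda>n. \<integral>x. \<bar>u n x - f x\<bar> powr \<alpha> \<partial>\<mu>) \<longlonglongrightarrow> 0 \<and>
             (\<forall>e>0. (\<lambda>n. measure P {\<omega> \<in> space P.
                \<bar>simple_stable_integral \<mu> W (u n) \<omega> - Y \<omega>\<bar> > e}) \<longlonglongrightarrow> 0)))
      else (\<lambda>_. 0))"

definition fractional_stable_field ::
    "'w measure \<Rightarrow> complex measure \<Rightarrow> (nat \<Rightarrow> real) \<Rightarrow> (nat \<Rightarrow> complex \<Rightarrow> real) \<Rightarrow> real \<Rightarrow> real \<Rightarrow>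
       (complex set \<Rightarrow> 'w \<Rightarrow> real) \<Rightarrow> ((complex \<Rightarrow> real) \<Rightarrow> 'h::banach) \<Rightarrow> 'h \<Rightarrow> 'w \<Rightarrow> real" where
  "fractional_stable_field P \<mu> eigval \<Phi> s \<alpha> W \<iota> h =
     stable_integral P \<mu> \<alpha> W (sobolev_neg_power \<mu> eigval \<Phi> s \<iota> h)"

definition pointwise_stable_field ::
    "'w measure \<Rightarrow> complex measure \<Rightarrow> (real \<Rightarrow> complex \<Rightarrow> complex \<Rightarrow> real) \<Rightarrow> real \<Rightarrow> real \<Rightarrow>
       (complex set \<Rightarrow> 'w \<Rightarrow> real) \<Rightarrow> complex \<Rightarrow> 'w \<Rightarrow> real" where
  "pointwise_stable_field P \<mu> p s \<alpha> W x = stable_integral P \<mu> \<alpha> W (\<lambda>z. riesz_kernel p s x z)"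

definition same_fdd :: "'w measure \<Rightarrow> 'i set \<Rightarrow> ('i \<Rightarrow> 'w \<Rightarrow> real) \<Rightarrow> ('i \<Rightarrow> 'w \<Rightarrow> real) \<Rightarrow> bool" where
  "same_fdd P I X Y \<longleftrightarrow>
     (\<forall>i\<in>I. X i \<in> borel_measurable P \<and> Y i \<in> borel_measurable P) \<and>
     (\<forall>J\<subseteq>I. finite J \<longrightarrow>
        distr P (\<Pi>\<^sub>M i\<in>J. borel) (\<lambda>\<omega>. \<lambda>i\<in>J. X i \<omega>) =
        distr P (\<Pi>\<^sub>M i\<in>J. borel) (\<lambda>\<omega>. \<lambda>i\<in>J. Y i \<omega>))"

end

theory Submission
  imports Defs
begin

text \<open>The reflection \<open>\<sigma>\<close> permutes the cells of each level, hence preserves \<open>\<mu>\<close> and the energy, and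
  commutes with the Laplacian. So it commutes with the heat semigroup, which the eigenbasis determines;
  since \<open>\<mu>\<close> has full support, \<open>p\<^sub>t (x, \<sigma> y) = p\<^sub>t (\<sigma> x, y)\<close>, and the same holds for
  the Riesz kernel. Comparing coefficients in the eigenbasis, \<open>\<sigma>\<close> also commutes with the negative powers
  of the Laplacian and their extensions to the completion. All three claims thereby reduce to the
  invariance of the joint law of stochastic integrals under a measure preserving involution. For simple
  integrands this holds because \<open>W\<close> is independently scattered with a law depending only on \<open>\<mu>\<close>; the
  general case follows by convergence in probability.\<close>

section \<open>Symmetries of the gasket and of its measure\<close>

text \<open>The measure is prescribed only on cells, which are not closed under intersection since
  neighbouring ones share a vertex. Masses of closed sets are therefore recovered as limits of
  counts of the cells that meet them. Negative powers and stochastic integrals are chosen objects,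
  fixed only up to null sets, and \<open>W\<close> is additive only almost surely. Identities
  between them are first obtained almost everywhere, and two choices are compared through the
  predicates that they satisfy. Nondegenerate stable variables with \<alpha> < 2 have no second
  moment, so convergence in probability is measured by the expectation of
  \<open>min 1 (X\<^sup>2)\<close>, which is estimated through characteristic functions.\<close>

lemma line_reflection_involution:
  "a \<noteq> b \<Longrightarrow> line_reflection a b (line_reflection a b z) = z"
  by (simp add: line_reflection_def)

lemma dist_line_reflection:
  assumes "a \<noteq> b"
  shows "dist (line_reflection a b z) (line_reflection a b w) = dist z w"
proof -
  have "line_reflection a b z - line_reflection a b w = (b - a) * cnj ((z - w) / (b - a))"
    by (simp add: line_reflection_def divide_simps) (simp add: algebra_simps)
  then show ?thesis
    using assms by (simp add: dist_norm norm_mult norm_divide flip: complex_cnj_diff)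
qed

text \<open>Reflections are affine over the reals, so they conjugate the homothety of ratio 1/2
  about \<open>q\<close> into the one about the image of \<open>q\<close>.\<close>

lemma line_reflection_homothety:
  "line_reflection a b ((z - q) / 2 + q) =
     (line_reflection a b z - line_reflection a b q) / 2 + line_reflection a b q"
proof -
  have "(z - q) / 2 + q - a = ((z - a) + (q - a)) / 2"
    by (simp add: field_simps)
  then have "((z - q) / 2 + q - a) / (b - a) = ((z - a) + (q - a)) / (b - a) / 2"
    by (simp only: divide_divide_eq_left mult.commute)
  then have eq: "((z - q) / 2 + q - a) / (b - a) = ((z - a) / (b - a) + (q - a) / (b - a)) / 2"
    by (simp only: add_divide_distrib)
  have "a + (b - a) * cnj ((u + v) / 2) =
      (a + (b - a) * cnj u - (a + (b - a) * cnj v)) / 2 + (a + (b - a) * cnj v)" for u v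
  proof -
    have "a + c * ((x + y) / 2) = (a + c * x - (a + c * y)) / 2 + (a + c * y)" for c x y :: complex
      by (simp add: algebra_simps add_divide_distrib diff_divide_distrib)
    then show ?thesis by simp
  qed
  then show ?thesis
    unfolding line_reflection_def eq by blast
qed

lemma gasket_vertex_values:
  "gasket_vertex 0 = 0" "gasket_vertex (Suc 0) = 1" "gasket_vertex 2 = Complex (1/2) (sqrt 3 / 2)"
  by (auto simp: gasket_vertex_def complex_eq_iff Re_exp Im_exp cos_60 sin_60)

text \<open>Makes the axis a genuine line, so that \<open>line_reflection\<close> does not divide by
  zero.\<close>

lemma gasket_sym_axis:
  assumes "i \<in> {0, 1, 2}"
  shows "gasket_vertex i \<noteq> midpoint (gasket_vertex ((i + 1) mod 3)) (gasket_vertex ((i + 2) mod 3))"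
  using assms
  by (auto simp: midpoint_def gasket_vertex_values complex_eq_iff numeral_2_eq_2[symmetric] numeral_3_eq_3[symmetric])

lemma gasket_sym_involution: "i \<in> {0, 1, 2} \<Longrightarrow> gasket_sym i (gasket_sym i z) = z"
  unfolding gasket_sym_def by (rule line_reflection_involution[OF gasket_sym_axis])

lemma dist_gasket_sym: "i \<in> {0, 1, 2} \<Longrightarrow> dist (gasket_sym i z) (gasket_sym i w) = dist z w"
  unfolding gasket_sym_def by (rule dist_line_reflection[OF gasket_sym_axis])

text \<open>The three indices sum to \<open>0\<close> modulo 3, so the reflection fixing vertex \<open>i\<close> maps the index \<open>j\<close>
  to \<open>- i - j = 2 i + 2 j\<close>.\<close>

definition reflect_index :: "nat \<Rightarrow> nat \<Rightarrow> nat" where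
  "reflect_index i j = (2 * i + 2 * j) mod 3"

lemma reflect_index_in: "reflect_index i j \<in> {0, 1, 2}"
  unfolding reflect_index_def by auto

lemma reflect_index_involution:
  "i \<in> {0, 1, 2} \<Longrightarrow> j \<in> {0, 1, 2} \<Longrightarrow> reflect_index i (reflect_index i j) = j"
  unfolding reflect_index_def by auto

lemma reflect_index_values:
  "reflect_index 0 0 = 0" "reflect_index 0 1 = 2" "reflect_index 0 2 = 1"
  "reflect_index 1 0 = 2" "reflect_index 1 1 = 1" "reflect_index 1 2 = 0"
  "reflect_index 2 0 = 1" "reflect_index 2 1 = 0" "reflect_index 2 2 = 2"
  by (simp_all add: reflect_index_def numeral_2_eq_2)

lemma gasket_sym_vertex_index:
  assumes "i \<in> {0, 1, 2}" "j \<in> {0, 1, 2}"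
  shows "gasket_sym i (gasket_vertex j) = gasket_vertex (reflect_index i j)"
  using assms by (elim insertE emptyE) (simp_all only: reflect_index_values gasket_sym_swaps gasket_sym_vertex)

lemma gasket_sym_map:
  assumes "i \<in> {0, 1, 2}" "j \<in> {0, 1, 2}"
  shows "gasket_sym i (gasket_map j z) = gasket_map (reflect_index i j) (gasket_sym i z)"
proof -
  have "gasket_sym i (gasket_map j z) =
      (gasket_sym i z - gasket_sym i (gasket_vertex j)) / 2 + gasket_sym i (gasket_vertex j)"
    unfolding gasket_sym_def gasket_map_def by (rule line_reflection_homothety)
  then show ?thesis
    by (simp add: gasket_sym_vertex_index[OF assms] gasket_map_def)
qed

text \<open>Pushing the reflection through the maps one letter at a time relabels the letters. This
  is why cells go to cells of the same level.\<close>

lemma gasket_sym_word_map: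
  assumes "i \<in> {0, 1, 2}" "set w \<subseteq> {0, 1, 2}"
  shows "gasket_sym i (word_map w z) = word_map (map (reflect_index i) w) (gasket_sym i z)"
  using assms(2)
proof (induction w)
  case (Cons j w)
  then show ?case using gasket_sym_map[OF assms(1), of j] by simp
qed simp

lemma map_reflect_index_involution:
  assumes "i \<in> {0, 1, 2}" "set w \<subseteq> {0, 1, 2}"
  shows "map (reflect_index i) (map (reflect_index i) w) = w"
  using assms reflect_index_involution[OF assms(1)] by (auto intro!: map_idI)

lemma map_reflect_index_in: "w \<in> gasket_words n \<Longrightarrow> map (reflect_index i) w \<in> gasket_words n"
  unfolding gasket_words_def using reflect_index_in[of i] by (simp add: image_subset_iff)

lemma gasket_words_set: "w \<in> gasket_words n \<Longrightarrow> set w \<subseteq> {0, 1, 2}"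
  by (simp add: gasket_words_def)

lemma bij_betw_map_reflect_index:
  assumes "i \<in> {0, 1, 2}"
  shows "bij_betw (map (reflect_index i)) (gasket_words n) (gasket_words n)"
proof (rule bij_betw_byWitness[where f' = "map (reflect_index i)"])
  show inv: "\<forall>w\<in>gasket_words n. map (reflect_index i) (map (reflect_index i) w) = w"
    using map_reflect_index_involution[OF assms] gasket_words_set by blast
  show "\<forall>w\<in>gasket_words n. map (reflect_index i) (map (reflect_index i) w) = w"
    by (rule inv)
qed (use map_reflect_index_in in blast)+

lemma finite_gasket_words: "finite (gasket_words n)"
  and card_gasket_words: "card (gasket_words n) = 3 ^ n"
proof -
  have eq: "gasket_words n = {w. set w \<subseteq> {0, 1, 2} \<and> length w = n}"
    by (auto simp: gasket_words_def)
  show "finite (gasket_words n)"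
    unfolding eq by (rule finite_lists_length_eq) simp
  have "card (gasket_words n) = card {0, 1, 2::nat} ^ n"
    unfolding eq by (rule card_lists_length_eq) simp
  then show "card (gasket_words n) = 3 ^ n"
    by (simp add: numeral_3_eq_3)
qed

section \<open>Contraction along words and uniqueness of the gasket\<close>

lemma dist_word_map: "dist (word_map w x) (word_map w y) = (1 / 2) ^ length w * dist x y"
proof (induction w)
  case (Cons i w)
  have "dist (gasket_map i a) (gasket_map i b) = 1 / 2 * dist a b" for a b
  proof -
    have "gasket_map i a - gasket_map i b = (a - b) / 2"
      by (simp add: gasket_map_def field_simps)
    then show ?thesis by (simp only: dist_norm norm_divide) simp
  qed
  with Cons show ?case by simp
qed simp

lemma dist_gasket_map: "dist (gasket_map i x) (gasket_map i y) = dist x y / 2"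
  using dist_word_map[of "[i]" x y] by simp

lemma continuous_on_word_map: "continuous_on A (word_map w)"
proof (rule lipschitz_on_continuous_on)
  show "((1 / 2) ^ length w)-lipschitz_on A (word_map w)"
    by (rule lipschitz_onI) (simp_all add: dist_word_map)
qed

lemma continuous_on_gasket_sym: "i \<in> {0, 1, 2} \<Longrightarrow> continuous_on A (gasket_sym i)"
  by (rule lipschitz_on_continuous_on[of 1]) (rule lipschitz_onI, simp_all only: dist_gasket_sym)

text \<open>A point of \<open>K\<close> farthest from \<open>L\<close> is the image of a point of
  \<open>K\<close> under a map that halves distances and sends \<open>L\<close> into itself. So the
  largest distance is at most half of itself, hence zero.\<close>

lemma gasket_subset:
  assumes "sierpinski_gasket K" "sierpinski_gasket L"
  shows "K \<subseteq> L"
proof -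
  have K: "compact K" "K \<noteq> {}" "K = (\<Union>i\<in>{0, 1, 2}. gasket_map i ` K)"
    and L: "compact L" "L \<noteq> {}" "L = (\<Union>i\<in>{0, 1, 2}. gasket_map i ` L)"
    using assms unfolding sierpinski_gasket_def by blast+
  have "\<exists>x\<in>K. \<forall>y\<in>K. infdist y L \<le> infdist x L"
    by (rule continuous_attains_sup[OF K(1,2)]) (intro continuous_intros)
  then obtain x where x: "x \<in> K" "\<And>y. y \<in> K \<Longrightarrow> infdist y L \<le> infdist x L" by blast
  obtain i y where iy: "i \<in> {0, 1, 2}" "y \<in> K" "x = gasket_map i y"
    using x(1) K(3) by blast
  obtain z where z: "z \<in> L" "infdist y L = dist y z"
    using infdist_attains_inf[OF compact_imp_closed[OF L(1)] L(2)] by blast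
  have "gasket_map i z \<in> L"
    using z(1) iy(1) L(3) by blast
  then have "infdist x L \<le> dist x (gasket_map i z)"
    by (rule infdist_le)
  also have "\<dots> = infdist y L / 2"
    by (simp add: iy dist_gasket_map z)
  also have "\<dots> \<le> infdist x L / 2"
    using x(2)[OF iy(2)] by simp
  finally have "infdist x L \<le> 0" by simp
  then have "infdist y L = 0" if "y \<in> K" for y
    using x(2)[OF that] infdist_nonneg[of y L] by simp
  then show ?thesis
    using in_closed_iff_infdist_zero[OF compact_imp_closed[OF L(1)] L(2)] by blast
qed

lemma gasket_unique: "sierpinski_gasket K \<Longrightarrow> sierpinski_gasket L \<Longrightarrow> K = L"
  by (intro antisym gasket_subset)

text \<open>The reflected set solves the same fixed point equation with the three maps permuted, so
  uniqueness applies.\<close>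

lemma gasket_sym_gasket:
  assumes K: "sierpinski_gasket K" and i: "i \<in> {0, 1, 2}"
  shows "gasket_sym i ` K = K"
proof (rule gasket_unique[OF _ K])
  have eq: "K = (\<Union>j\<in>{0, 1, 2}. gasket_map j ` K)"
    using K unfolding sierpinski_gasket_def by blast
  have surj: "reflect_index i ` {0, 1, 2} = {0, 1, 2}"
    using i by (auto simp: reflect_index_def)
  have "gasket_sym i ` K = (\<Union>j\<in>{0, 1, 2}. gasket_sym i ` gasket_map j ` K)"
    by (subst eq) (simp only: image_UN)
  also have "\<dots> = (\<Union>j\<in>{0, 1, 2}. gasket_map (reflect_index i j) ` gasket_sym i ` K)"
    by (intro SUP_cong refl) (simp only: image_image gasket_sym_map[OF i])
  also have "\<dots> = (\<Union>j\<in>reflect_index i ` {0, 1, 2}. gasket_map j ` gasket_sym i ` K)"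
    by (simp only: image_image)
  finally have "gasket_sym i ` K = (\<Union>j\<in>{0, 1, 2}. gasket_map j ` gasket_sym i ` K)"
    by (simp only: surj)
  then show "sierpinski_gasket (gasket_sym i ` K)"
    using K compact_continuous_image[OF continuous_on_gasket_sym[OF i]]
    unfolding sierpinski_gasket_def by blast
qed

section \<open>Cells and the self-similar measure\<close>

lemma gasket_cells:
  assumes "sierpinski_gasket K"
  shows "K = (\<Union>w\<in>gasket_words n. word_map w ` K)"
proof (induction n)
  case 0
  then show ?case by (simp add: gasket_words_def)
next
  case (Suc n)
  have eq: "K = (\<Union>j\<in>{0, 1, 2}. gasket_map j ` K)"
    using assms unfolding sierpinski_gasket_def by blast
  have words: "gasket_words (Suc n) = (\<Union>j\<in>{0, 1, 2}. (#) j ` gasket_words n)"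
    by (auto simp: gasket_words_def length_Suc_conv)
  have "K = (\<Union>j\<in>{0, 1, 2}. gasket_map j ` (\<Union>w\<in>gasket_words n. word_map w ` K))"
    using eq Suc by simp
  also have "\<dots> = (\<Union>w\<in>gasket_words (Suc n). word_map w ` K)"
    unfolding words by (simp add: image_UN image_comp)
  finally show ?case .
qed

lemma Collect_image: "(\<And>x. x \<in> A \<Longrightarrow> Q (f x) \<longleftrightarrow> P x) \<Longrightarrow> f ` {x \<in> A. P x} = {y \<in> f ` A. Q y}"
  by auto

locale gasket_space =
  fixes K :: "complex set" and \<mu> :: "complex measure"
  assumes gasket: "sierpinski_gasket K" and gasket_measure: "gasket_measure K \<mu>"

sublocale gasket_space \<subseteq> prob_space \<mu>
  using gasket_measure by (simp add: gasket_measure_def)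

context gasket_space
begin

lemma space_eq: "space \<mu> = K"
  and sets_eq: "sets \<mu> = sets (restrict_space borel K)"
  and measure_cell: "w \<in> gasket_words n \<Longrightarrow> measure \<mu> (word_map w ` K) = (1 / 3) ^ n"
  using gasket_measure by (auto simp: gasket_measure_def)

lemma compact_K: "compact K" and K_nonempty: "K \<noteq> {}"
  using gasket by (auto simp: sierpinski_gasket_def)

lemma sets_closed: "closed C \<Longrightarrow> C \<inter> K \<in> sets \<mu>"
  by (auto simp: sets_eq sets_restrict_space)

lemma sets_cell: "w \<in> gasket_words n \<Longrightarrow> word_map w ` K \<in> sets \<mu>"
proof -
  assume "w \<in> gasket_words n"
  then have "word_map w ` K \<inter> K = word_map w ` K"
    using gasket_cells[OF gasket, of n] by blast
  moreover have "closed (word_map w ` K)"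
    by (intro compact_imp_closed compact_continuous_image continuous_on_word_map compact_K)
  ultimately show ?thesis using sets_closed by metis
qed

lemma cell_subset: "w \<in> gasket_words n \<Longrightarrow> word_map w ` K \<subseteq> K"
  using sets.sets_into_space[OF sets_cell] by (simp add: space_eq)

lemma measurable_continuous_on: "continuous_on K f \<Longrightarrow> f \<in> \<mu> \<rightarrow>\<^sub>M borel"
  using borel_measurable_continuous_on_restrict[of K f] measurable_cong_sets[OF sets_eq refl] by blast

text \<open>Cells may overlap, so only subadditivity is available at first. But the bounds for
  \<open>N\<close> and for the remaining words add up to the total mass 1, which forces equality in
  both.\<close>

lemma measure_cells:
  assumes N: "N \<subseteq> gasket_words n"
  shows "measure \<mu> (\<Union>w\<in>N. word_map w ` K) = card N * (1 / 3) ^ n"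
proof -
  have upper: "measure \<mu> (\<Union>w\<in>M. word_map w ` K) \<le> card M * (1 / 3) ^ n"
    if M: "M \<subseteq> gasket_words n" for M
  proof -
    have "measure \<mu> (\<Union>w\<in>M. word_map w ` K) \<le> (\<Sum>w\<in>M. measure \<mu> (word_map w ` K))"
      using M sets_cell finite_subset[OF M finite_gasket_words]
      by (intro finite_measure_subadditive_finite) auto
    also have "\<dots> = (\<Sum>w\<in>M. (1 / 3) ^ n)"
      using M measure_cell by (intro sum.cong) auto
    finally show ?thesis by simp
  qed
  let ?N = "gasket_words n - N"
  have fin: "finite N" using N finite_gasket_words finite_subset by blast
  have sets: "(\<Union>w\<in>M. word_map w ` K) \<in> sets \<mu>" if "M \<subseteq> gasket_words n" for M
    using that sets_cell finite_subset[OF that finite_gasket_words] by (intro sets.finite_UN) auto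
  have "1 = measure \<mu> ((\<Union>w\<in>N. word_map w ` K) \<union> (\<Union>w\<in>?N. word_map w ` K))"
  proof -
    have "(\<Union>w\<in>N. word_map w ` K) \<union> (\<Union>w\<in>?N. word_map w ` K) = (\<Union>w\<in>gasket_words n. word_map w ` K)"
      using N by blast
    then show ?thesis
      using gasket_cells[OF gasket, of n] prob_space by (simp add: space_eq)
  qed
  also have "\<dots> \<le> measure \<mu> (\<Union>w\<in>N. word_map w ` K) + measure \<mu> (\<Union>w\<in>?N. word_map w ` K)"
    using sets N by (intro measure_Un_le) auto
  also have "measure \<mu> (\<Union>w\<in>?N. word_map w ` K) \<le> (3 ^ n - real (card N)) * (1 / 3) ^ n"
    using upper[of ?N] card_mono[OF finite_gasket_words N]
    by (simp add: card_Diff_subset[OF fin N] card_gasket_words of_nat_diff)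
  finally have "card N * (1 / 3) ^ n \<le> measure \<mu> (\<Union>w\<in>N. word_map w ` K)"
    by (simp add: algebra_simps power_divide)
  with upper[OF N] show ?thesis by simp
qed

lemma cells_shrink:
  assumes "e > 0"
  obtains n where "\<And>w x y. w \<in> gasket_words n \<Longrightarrow> x \<in> word_map w ` K \<Longrightarrow> y \<in> word_map w ` K \<Longrightarrow> dist x y < e"
proof -
  \<comment> \<open>Adding 1 to the diameter keeps \<open>D\<close> positive, since \<open>e\<close>
    is divided by it.\<close>
  define D where "D = diameter K + 1"
  have D: "dist x y \<le> D" if "x \<in> K" "y \<in> K" for x y
    using diameter_bounded_bound[OF compact_imp_bounded[OF compact_K] that] by (simp add: D_def)
  have D_pos: "D > 0"
    using diameter_ge_0[OF compact_imp_bounded[OF compact_K]] by (simp add: D_def)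
  obtain n where n: "(1 / 2) ^ n < e / D"
    using real_arch_pow_inv[of "e / D" "1 / 2"] assms D_pos by auto
  show ?thesis
  proof (rule that[of n])
    fix w x y assume w: "w \<in> gasket_words n" and "x \<in> word_map w ` K" "y \<in> word_map w ` K"
    then obtain a b where "a \<in> K" "b \<in> K" "x = word_map w a" "y = word_map w b" by blast
    then have "dist x y \<le> (1 / 2) ^ n * D"
      using w D by (simp add: dist_word_map gasket_words_def)
    also have "\<dots> < e" using n D_pos by (simp add: pos_less_divide_eq)
    finally show "dist x y < e" .
  qed
qed

text \<open>Every point of \<open>K\<close> lies in arbitrarily small cells, each of positive
  mass.\<close>

lemma full_support:
  assumes "open U" "x \<in> U" "x \<in> K"
  shows "measure \<mu> (U \<inter> K) > 0"
proof -
  obtain e where e: "e > 0" "ball x e \<subseteq> U"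
    using assms open_contains_ball by blast
  obtain n where n: "\<And>w x y. w \<in> gasket_words n \<Longrightarrow> x \<in> word_map w ` K \<Longrightarrow> y \<in> word_map w ` K \<Longrightarrow> dist x y < e"
    using cells_shrink[OF e(1)] by blast
  obtain w where w: "w \<in> gasket_words n" "x \<in> word_map w ` K"
    using assms(3) gasket_cells[OF gasket, of n] by blast
  have "word_map w ` K \<subseteq> U \<inter> K"
    using n[OF w] e(2) cell_subset[OF w(1)] by (auto simp: subset_iff)
  then have "(1 / 3) ^ n \<le> measure \<mu> (U \<inter> K)"
    using finite_measure_mono[of "word_map w ` K" "U \<inter> K"] assms(1) measure_cell[OF w(1)]
    by (auto simp: sets_eq sets_restrict_space Int_commute)
  then show ?thesis
    by (rule less_le_trans[rotated]) simp
qed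

abbreviation "meeting n C \<equiv> {w \<in> gasket_words n. word_map w ` K \<inter> C \<noteq> {}}"

text \<open>The cells meeting \<open>C\<close> cover \<open>C \<inter> K\<close> and stay within one
  cell diameter of \<open>C\<close>, so their union is squeezed onto \<open>C \<inter> K\<close>.
  Masses of closed sets thus become cell counts, which a permutation of the words can be seen to
  preserve.\<close>

lemma closed_measure_limit:
  assumes "closed C"
  shows "(\<lambda>n. card (meeting n C) * (1 / 3) ^ n) \<longlonglongrightarrow> measure \<mu> (C \<inter> K)"
\<comment> \<open>The distance to the empty set is 0 by default, so the neighbourhoods used below
  would not shrink to it.\<close>
proof (cases "C = {}")
  case True
  then show ?thesis by simp
next
  case False
  define N where "N n = meeting n C" for n
  define A where "A n = (\<Union>w\<in>N n. word_map w ` K)" for n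
  obtain D where D: "\<And>x y. x \<in> K \<Longrightarrow> y \<in> K \<Longrightarrow> dist x y \<le> D"
    using diameter_bounded_bound[OF compact_imp_bounded[OF compact_K]] by blast
  then have D0: "D \<ge> 0"
    using K_nonempty zero_le_dist order_trans by (metis ex_in_conv)
  \<comment> \<open>\<open>D\<close> bounds the diameter of \<open>K\<close>, so the radius bounds
    the diameter of a cell of level \<open>n\<close>.\<close>
  define B where "B n = {x. infdist x C \<le> (1 / 2) ^ n * D} \<inter> K" for n :: nat
  have A: "measure \<mu> (A n) = card (N n) * (1 / 3) ^ n" for n
    unfolding A_def by (rule measure_cells) (auto simp: N_def)
  have closedB: "closed {x. infdist x C \<le> (1 / 2) ^ n * D}" for n
    by (intro closed_Collect_le continuous_intros)
  then have setsB: "B n \<in> sets \<mu>" for n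
    unfolding B_def by (rule sets_closed)
  have setsA: "A n \<in> sets \<mu>" for n
    unfolding A_def N_def using finite_gasket_words sets_cell by (intro sets.finite_UN) auto
  have "C \<inter> K \<subseteq> A n" for n
  proof
    fix x assume "x \<in> C \<inter> K"
    then show "x \<in> A n"
      unfolding A_def N_def using gasket_cells[OF gasket, of n] by blast
  qed
  then have lower: "measure \<mu> (C \<inter> K) \<le> measure \<mu> (A n)" for n
    using setsA by (intro finite_measure_mono) auto
  have "A n \<subseteq> B n" for n
  proof
    fix x assume "x \<in> A n"
    then obtain w a b where w: "w \<in> gasket_words n" and ab: "a \<in> K" "b \<in> K" "x = word_map w a" "word_map w b \<in> C"
      unfolding A_def N_def by blast
    have "infdist x C \<le> dist x (word_map w b)"
      by (rule infdist_le[OF ab(4)])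
    also have "\<dots> \<le> (1 / 2) ^ n * D"
      using w ab D by (simp add: dist_word_map gasket_words_def)
    finally show "x \<in> B n"
      using cell_subset[OF w] ab by (auto simp: B_def)
  qed
  then have upper: "measure \<mu> (A n) \<le> measure \<mu> (B n)" for n
    using setsB by (intro finite_measure_mono) auto
  have dec: "decseq B"
  proof (rule decseq_SucI)
    fix n
    have "(1 / 2) ^ Suc n * D \<le> (1 / 2) ^ n * D"
      using D0 by (intro mult_right_mono) auto
    then show "B (Suc n) \<subseteq> B n" unfolding B_def by (auto intro: order_trans simp del: power_Suc)
  qed
  have "(\<Inter>n. B n) = C \<inter> K"
  proof -
    have "(\<lambda>n. (1 / 2) ^ n) \<longlonglongrightarrow> (0::real)"
      by (rule LIMSEQ_power_zero) simp
    then have "(\<lambda>n. (1 / 2) ^ n * D) \<longlonglongrightarrow> 0"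
      by (rule tendsto_mult_left_zero)
    then have le: "infdist x C \<le> 0" if "\<And>n. infdist x C \<le> (1 / 2) ^ n * D" for x
      using LIMSEQ_le_const[of "\<lambda>n. (1 / 2) ^ n * D" 0 "infdist x C"] that by auto
    have "x \<in> C" if "\<And>n. infdist x C \<le> (1 / 2) ^ n * D" for x
      using antisym[OF le[OF that] infdist_nonneg] in_closed_iff_infdist_zero[OF assms False] by blast
    moreover have "infdist x C \<le> (1 / 2) ^ n * D" if "x \<in> C" for x n
      using that D0 by simp
    ultimately have "x \<in> (\<Inter>n. B n) \<longleftrightarrow> x \<in> C \<inter> K" for x
      unfolding B_def by auto
    then show ?thesis by (rule set_eqI)
  qed
  then have "(\<lambda>n. measure \<mu> (B n)) \<longlonglongrightarrow> measure \<mu> (C \<inter> K)"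
    using finite_Lim_measure_decseq[of B] setsB dec by auto
  then have "(\<lambda>n. measure \<mu> (A n)) \<longlonglongrightarrow> measure \<mu> (C \<inter> K)"
    by (rule tendsto_sandwich[rotated 3]) (use lower upper in auto)
  then show ?thesis by (simp add: A N_def)
qed

end

section \<open>Invariance of the measure under a reflection\<close>

locale gasket_reflection = gasket_space +
  fixes i :: nat
  assumes i: "i \<in> {0, 1, 2}"
begin

abbreviation "\<sigma> \<equiv> gasket_sym i"

lemma sym_sym: "\<sigma> (\<sigma> z) = z"
  by (rule gasket_sym_involution[OF i])

lemma sym_image: "\<sigma> ` K = K"
  by (rule gasket_sym_gasket[OF gasket i])

lemma sym_in: "x \<in> K \<Longrightarrow> \<sigma> x \<in> K"
  using sym_image by blast

lemma measurable_sym: "\<sigma> \<in> \<mu> \<rightarrow>\<^sub>M \<mu>"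
proof -
  have "\<sigma> \<in> \<mu> \<rightarrow>\<^sub>M borel"
    by (rule measurable_continuous_on[OF continuous_on_gasket_sym[OF i]])
  then have "\<sigma> \<in> \<mu> \<rightarrow>\<^sub>M restrict_space borel K"
    using sym_in by (intro measurable_restrict_space2) (auto simp: space_eq)
  then show ?thesis
    using measurable_cong_sets[OF refl sets_eq] by blast
qed

lemma sym_cell_meets:
  assumes "w \<in> gasket_words n"
  shows "word_map (map (reflect_index i) w) ` K \<inter> C \<noteq> {} \<longleftrightarrow> word_map w ` K \<inter> \<sigma> -` C \<noteq> {}"
proof -
  have "word_map (map (reflect_index i) w) ` K = \<sigma> ` word_map w ` K"
    unfolding image_image gasket_sym_word_map[OF i gasket_words_set[OF assms]]
    by (subst sym_image[symmetric]) (simp add: image_image)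
  then have "word_map (map (reflect_index i) w) ` K \<inter> C = \<sigma> ` (word_map w ` K \<inter> \<sigma> -` C)"
    by auto
  then show ?thesis by simp
qed

text \<open>Relabelling words matches the cells that meet the preimage of a closed set with those
  that meet the set, so both masses are limits of the same counts. Closed sets form an
  intersection-stable generator of the Borel sets.\<close>

lemma distr_sym: "distr \<mu> \<mu> \<sigma> = \<mu>"
proof (rule measure_eqI)
  show "sets (distr \<mu> \<mu> \<sigma>) = sets \<mu>" by simp
  fix A assume "A \<in> sets (distr \<mu> \<mu> \<sigma>)"
  then obtain B where B: "B \<in> sets borel" "A = K \<inter> B"
    by (auto simp: sets_eq sets_restrict_space)
  have id: "(\<lambda>x. x) \<in> \<mu> \<rightarrow>\<^sub>M borel" and \<sigma>: "\<sigma> \<in> \<mu> \<rightarrow>\<^sub>M borel"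
    by (intro measurable_continuous_on continuous_on_gasket_sym[OF i] continuous_intros)+
  have closed: "measure \<mu> (\<sigma> -` C \<inter> K) = measure \<mu> (C \<inter> K)" if C: "closed C" for C
  proof (rule LIMSEQ_unique)
    have "closed (\<sigma> -` C)"
      by (rule closed_vimage[OF C continuous_on_gasket_sym[OF i]])
    then show "(\<lambda>n. card (meeting n (\<sigma> -` C)) * (1 / 3) ^ n) \<longlonglongrightarrow> measure \<mu> (\<sigma> -` C \<inter> K)"
      by (rule closed_measure_limit)
    have "card (meeting n (\<sigma> -` C)) = card (meeting n C)" for n
    proof (rule bij_betw_same_card)
      have "bij_betw (map (reflect_index i)) (meeting n (\<sigma> -` C))
          (map (reflect_index i) ` (meeting n (\<sigma> -` C)))"
        using bij_betw_map_reflect_index[OF i, of n] by (rule bij_betw_subset) auto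
      also have "map (reflect_index i) ` (meeting n (\<sigma> -` C)) =
          {w \<in> map (reflect_index i) ` gasket_words n. word_map w ` K \<inter> C \<noteq> {}}"
        using sym_cell_meets by (intro Collect_image) auto
      also have "map (reflect_index i) ` gasket_words n = gasket_words n"
        using bij_betw_map_reflect_index[OF i] by (rule bij_betw_imp_surj_on)
      finally show "bij_betw (map (reflect_index i)) (meeting n (\<sigma> -` C))
          (meeting n C)" .
    qed
    then show "(\<lambda>n. card (meeting n (\<sigma> -` C)) * (1 / 3) ^ n) \<longlonglongrightarrow> measure \<mu> (C \<inter> K)"
      using closed_measure_limit[OF C] by simp
  qed
  \<comment> \<open>Both image measures live on the whole plane, where the closed sets generate; the
    result is brought back to \<open>K\<close> afterwards.\<close>
  have "distr \<mu> borel (\<lambda>x. x) = distr \<mu> borel \<sigma>"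
  proof (rule measure_eqI_generator_eq[where E = "Collect closed" and \<Omega> = UNIV and A = "\<lambda>_. UNIV"])
    show "sets (distr \<mu> borel (\<lambda>x. x)) = sigma_sets UNIV (Collect closed)"
      "sets (distr \<mu> borel \<sigma>) = sigma_sets UNIV (Collect closed)"
      by (simp_all add: borel_eq_closed)
    fix C :: "complex set" assume "C \<in> Collect closed"
    then have "closed C" by simp
    with closed[OF this] show "emeasure (distr \<mu> borel (\<lambda>x. x)) C = emeasure (distr \<mu> borel \<sigma>) C"
      by (simp add: emeasure_distr id \<sigma> emeasure_eq_measure space_eq)
  next
    show "Int_stable (Collect closed :: complex set set)"
      by (intro Int_stableI) (simp add: closed_Int)
    show "emeasure (distr \<mu> borel (\<lambda>x. x)) UNIV \<noteq> \<infinity>" for n :: nat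
      by (simp add: emeasure_distr id)
  qed simp_all
  then have "emeasure (distr \<mu> borel (\<lambda>x. x)) B = emeasure (distr \<mu> borel \<sigma>) B" by simp
  then have eq: "emeasure \<mu> (B \<inter> K) = emeasure \<mu> (\<sigma> -` B \<inter> K)"
    by (simp add: emeasure_distr id \<sigma> B space_eq)
  have "\<sigma> -` A \<inter> K = \<sigma> -` B \<inter> K"
    using B(2) sym_in by auto
  moreover have "A \<in> sets \<mu>" using B by (auto simp: sets_eq sets_restrict_space)
  moreover have "A = B \<inter> K" using B(2) by blast
  ultimately show "emeasure (distr \<mu> \<mu> \<sigma>) A = emeasure \<mu> A"
    using eq by (simp add: emeasure_distr measurable_sym space_eq)
qed

end

section \<open>Almost sure convergence and square integrable functions\<close>

lemma abs_powr_le_square: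
  fixes s \<alpha> :: real
  assumes \<alpha>: "0 < \<alpha>" "\<alpha> \<le> 2"
  shows "\<bar>s\<bar> powr \<alpha> \<le> 1 + s\<^sup>2"
proof (cases "\<bar>s\<bar> \<le> 1")
  case True
  then have "\<bar>s\<bar> powr \<alpha> \<le> 1" using \<alpha> powr_mono2[of \<alpha> "\<bar>s\<bar>" 1] by simp
  then show ?thesis by (simp add: add_increasing2)
next
  case False
  then have "\<bar>s\<bar> powr \<alpha> \<le> \<bar>s\<bar> powr 2" using \<alpha> by (intro powr_mono) auto
  also have "\<dots> = s\<^sup>2" using False by (simp add: powr_numeral)
  finally show ?thesis by simp
qed

context prob_space
begin

text \<open>Markov's inequality at the threshold \<open>(1 / 4) ^ n\<close> turns the bound
  \<open>(1 / 8) ^ n\<close> into the probability \<open>(1 / 2) ^ n\<close>. By Borel-Cantelli the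
  increments are eventually at most \<open>(1 / 2) ^ n\<close>. This serves both the completeness of
  L2 and that of convergence in probability.\<close>

lemma AE_convergent_of_summable_increments:
  fixes X :: "nat \<Rightarrow> 'a \<Rightarrow> real"
  assumes [measurable]: "\<And>n. X n \<in> borel_measurable M"
    and small: "\<And>n. (\<integral>x. min 1 ((X (Suc n) x - X n x)\<^sup>2) \<partial>M) \<le> (1 / 8) ^ n"
  shows "AE x in M. convergent (\<lambda>n. X n x)"
proof -
  have geometric: "summable (\<lambda>n. (1 / 2 :: real) ^ n)"
    by (rule summable_geometric) simp
  define Z where "Z n x = min 1 ((X (Suc n) x - X n x)\<^sup>2)" for n x
  have Z[measurable]: "Z n \<in> borel_measurable M" for n
    unfolding Z_def by measurable
  have Zint: "integrable M (Z n)" for n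
    by (rule integrable_const_bound[of _ 1]) (auto simp: Z_def)
  define A where "A n = {x \<in> space M. Z n x \<ge> (1 / 4) ^ n}" for n
  have A[measurable]: "A n \<in> sets M" for n
    unfolding A_def by measurable
  have "measure M (A n) \<le> (1 / 2) ^ n" for n
  proof -
    have "measure M (A n) \<le> (\<integral>x. Z n x \<partial>M) / (1 / 4) ^ n"
      unfolding A_def
      by (rule integral_Markov_inequality_measure[OF Zint, of "{}"]) (auto simp: Z_def)
    also have "\<dots> \<le> (1 / 8) ^ n / (1 / 4) ^ n"
      using small[of n] by (intro divide_right_mono) (auto simp: Z_def)
    also have "\<dots> = (1 / 2) ^ n"
      by (simp flip: power_divide)
    finally show ?thesis .
  qed
  then have "summable (\<lambda>n. measure M (A n))"
    by (intro summable_comparison_test'[OF geometric]) simp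
  then have "AE x in M. eventually (\<lambda>n. x \<in> space M - A n) sequentially"
    by (intro borel_cantelli_AE1) (auto simp: less_top[symmetric])
  then show ?thesis
  proof eventually_elim
    case (elim x)
    then obtain N where N: "\<And>n. n \<ge> N \<Longrightarrow> x \<in> space M - A n"
      unfolding eventually_sequentially by blast
    have "norm (X (Suc n) x - X n x) \<le> (1 / 2) ^ n" if "n \<ge> N" for n
    proof -
      have "min 1 ((X (Suc n) x - X n x)\<^sup>2) < (1 / 4) ^ n"
        using N[OF that] by (auto simp: A_def Z_def)
      \<comment> \<open>The threshold is at most 1, so the truncation is inactive and the square
        itself is small.\<close>
      moreover have "(1 / 4 :: real) ^ n \<le> 1" by (simp add: power_le_one)
      ultimately have "(X (Suc n) x - X n x)\<^sup>2 \<le> ((1 / 2) ^ n)\<^sup>2"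
        by (simp add: min_def power2_eq_square split: if_splits flip: power_mult_distrib)
      then show ?thesis
        by (simp add: abs_le_square_iff[symmetric])
    qed
    then have "summable (\<lambda>n. X (Suc n) x - X n x)"
      by (rule summable_comparison_test'[OF geometric])
    then have "convergent (\<lambda>n. \<Sum>k<n. X (Suc k) x - X k x)"
      by (simp add: summable_iff_convergent)
    moreover have "X 0 x + (\<Sum>k<n. X (Suc k) x - X k x) = X n x" for n
      using sum_lessThan_telescope[of "\<lambda>n. X n x" n] by simp
    ultimately show ?case
      using convergent_add[OF convergent_const[of "X 0 x"]] by fastforce
  qed
qed

section \<open>Square integrable functions on a probability space\<close>

lemma L2_iff: "f \<in> L_space M 2 \<longleftrightarrow> f \<in> borel_measurable M \<and> integrable M (\<lambda>x. (f x)\<^sup>2)"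
proof -
  have "\<bar>f x\<bar> powr 2 = (f x)\<^sup>2" for x
    by (cases "f x = 0") simp_all
  then show ?thesis by (simp add: L_space_def)
qed

lemma L2_measurable: "f \<in> L_space M 2 \<Longrightarrow> f \<in> borel_measurable M"
  by (simp add: L2_iff)

lemma L2_mult_integrable:
  assumes f: "f \<in> L_space M 2" and g: "g \<in> L_space M 2"
  shows "integrable M (\<lambda>x. f x * g x)"
proof (rule Bochner_Integration.integrable_bound)
  show "integrable M (\<lambda>x. (f x)\<^sup>2 + (g x)\<^sup>2)"
    using f g by (simp add: L2_iff)
  show "(\<lambda>x. f x * g x) \<in> borel_measurable M"
    using f g L2_measurable by measurable
  have "\<bar>a * b\<bar> \<le> a\<^sup>2 + b\<^sup>2" for a b :: real
  proof -
    have "2 * \<bar>a\<bar> * \<bar>b\<bar> \<le> a\<^sup>2 + b\<^sup>2"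
      using sum_squares_bound[of "\<bar>a\<bar>" "\<bar>b\<bar>"] by simp
    moreover have "\<bar>a * b\<bar> \<le> 2 * \<bar>a\<bar> * \<bar>b\<bar>" by (simp add: abs_mult)
    ultimately show ?thesis by linarith
  qed
  then show "AE x in M. norm (f x * g x) \<le> norm ((f x)\<^sup>2 + (g x)\<^sup>2)"
    by (auto intro: order_trans)
qed

lemma L2_lincomb:
  assumes f: "f \<in> L_space M 2" and g: "g \<in> L_space M 2"
  shows "(\<lambda>x. c * f x + g x) \<in> L_space M 2"
proof -
  have "integrable M (\<lambda>x. c\<^sup>2 * (f x)\<^sup>2 + 2 * c * (f x * g x) + (g x)\<^sup>2)"
    using f g L2_mult_integrable[OF f g] by (simp add: L2_iff)
  moreover have "(\<lambda>x. c\<^sup>2 * (f x)\<^sup>2 + 2 * c * (f x * g x) + (g x)\<^sup>2) = (\<lambda>x. (c * f x + g x)\<^sup>2)"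
    by (simp add: power2_eq_square algebra_simps)
  moreover have "(\<lambda>x. c * f x + g x) \<in> borel_measurable M"
    using f g L2_measurable by measurable
  ultimately show ?thesis
    by (simp add: L2_iff)
qed

lemma L2_const: "(\<lambda>x. c) \<in> L_space M 2"
  by (simp add: L2_iff)

lemma L2_cmult: "f \<in> L_space M 2 \<Longrightarrow> (\<lambda>x. c * f x) \<in> L_space M 2"
  using L2_lincomb[of f "\<lambda>_. 0" c] L2_const[of 0] by simp

lemma L2_add: "f \<in> L_space M 2 \<Longrightarrow> g \<in> L_space M 2 \<Longrightarrow> (\<lambda>x. f x + g x) \<in> L_space M 2"
  using L2_lincomb[of f g 1] by simp

lemma L2_diff: "f \<in> L_space M 2 \<Longrightarrow> g \<in> L_space M 2 \<Longrightarrow> (\<lambda>x. f x - g x) \<in> L_space M 2"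
  using L2_lincomb[of g f "-1"] by simp

lemma L2_sum: "(\<And>j. j \<in> J \<Longrightarrow> f j \<in> L_space M 2) \<Longrightarrow> (\<lambda>x. \<Sum>j\<in>J. f j x) \<in> L_space M 2"
  by (induction J rule: infinite_finite_induct) (auto simp: L2_const L2_add)

lemma L2_integrable: "f \<in> L_space M 2 \<Longrightarrow> integrable M f"
  using L2_mult_integrable[OF _ L2_const[of 1], of f] by simp

lemma L2_inner_commute: "L2_inner M f g = L2_inner M g f"
  by (simp add: L2_inner_def mult.commute)

lemma L2_inner_lincomb:
  assumes "f \<in> L_space M 2" "g \<in> L_space M 2" "h \<in> L_space M 2"
  shows "L2_inner M h (\<lambda>x. c * f x + g x) = c * L2_inner M h f + L2_inner M h g"
proof -
  have "L2_inner M h (\<lambda>x. c * f x + g x) = (\<integral>x. c * (h x * f x) + h x * g x \<partial>M)"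
    unfolding L2_inner_def by (simp add: algebra_simps)
  then show ?thesis
    using assms by (simp add: L2_inner_def L2_mult_integrable)
qed

lemma L2_inner_cmult:
  "f \<in> L_space M 2 \<Longrightarrow> h \<in> L_space M 2 \<Longrightarrow> L2_inner M h (\<lambda>x. c * f x) = c * L2_inner M h f"
  using L2_inner_lincomb[of f "\<lambda>_. 0" h c] L2_const[of 0] by (simp add: L2_inner_def)

lemma L2_inner_diff:
  assumes "f \<in> L_space M 2" "g \<in> L_space M 2" "h \<in> L_space M 2"
  shows "L2_inner M h (\<lambda>x. f x - g x) = L2_inner M h f - L2_inner M h g"
  using L2_inner_lincomb[of g f h "-1"] assms by simp

lemma L2_inner_sum:
  assumes "\<And>j. j \<in> J \<Longrightarrow> f j \<in> L_space M 2" "h \<in> L_space M 2"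
  shows "L2_inner M h (\<lambda>x. \<Sum>j\<in>J. f j x) = (\<Sum>j\<in>J. L2_inner M h (f j))"
  unfolding L2_inner_def using assms L2_mult_integrable
  by (simp add: sum_distrib_left Bochner_Integration.integral_sum)

lemma L2_inner_self_nonneg: "L2_inner M f f \<ge> 0"
  by (simp add: L2_inner_def)

lemma L2_norm_nonneg: "L2_norm M f \<ge> 0"
  by (simp add: L2_norm_def L2_inner_self_nonneg)

lemma L2_norm_square: "(L2_norm M f)\<^sup>2 = L2_inner M f f"
  by (simp add: L2_norm_def L2_inner_self_nonneg)

lemma L2_norm_eq_0_iff:
  assumes "f \<in> L_space M 2"
  shows "L2_norm M f = 0 \<longleftrightarrow> (AE x in M. f x = 0)"
  using assms integral_nonneg_eq_0_iff_AE[of M "\<lambda>x. f x * f x"]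
  by (simp add: L2_norm_def L2_inner_def L2_iff flip: power2_eq_square)

lemma L2_inner_cong_AE:
  assumes [measurable]: "f \<in> borel_measurable M" "f' \<in> borel_measurable M"
      "g \<in> borel_measurable M" "g' \<in> borel_measurable M"
    and "AE x in M. f x = f' x" "AE x in M. g x = g' x"
  shows "L2_inner M f g = L2_inner M f' g'"
  unfolding L2_inner_def using assms(5,6) by (intro integral_cong_AE) (measurable, auto)

lemma L2_norm_cong_AE:
  assumes "f \<in> borel_measurable M" "g \<in> borel_measurable M" "AE x in M. f x = g x"
  shows "L2_norm M f = L2_norm M g"
  unfolding L2_norm_def using L2_inner_cong_AE[of f g f g] assms by simp

lemma L2_Cauchy_Schwarz:
  assumes f: "f \<in> L_space M 2" and g: "g \<in> L_space M 2"
  shows "\<bar>L2_inner M f g\<bar> \<le> L2_norm M f * L2_norm M g"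
proof (cases "L2_norm M g = 0")
  case True
  then have "AE x in M. f x * g x = 0"
    using L2_norm_eq_0_iff[OF g] by auto
  then have "L2_inner M f g = 0"
    unfolding L2_inner_def by (rule integral_eq_zero_AE)
  then show ?thesis by (simp add: L2_norm_nonneg)
next
  case False
  define a b c where abc: "a = L2_inner M f f" "b = L2_inner M f g" "c = L2_inner M g g"
  have c: "c > 0"
    using False L2_norm_square[of g] L2_inner_self_nonneg[of g] by (auto simp: abc L2_norm_def less_le)
  \<comment> \<open>The minimiser of the squared norm of \<open>f + t g\<close>.\<close>
  define t where "t = - b / c"
  let ?h = "\<lambda>x. t * g x + f x"
  have h: "?h \<in> L_space M 2" by (rule L2_lincomb[OF g f])
  have "0 \<le> L2_inner M ?h ?h" by (rule L2_inner_self_nonneg)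
  also have "\<dots> = t * L2_inner M g ?h + L2_inner M f ?h"
    using L2_inner_lincomb[OF g f h] L2_inner_commute by metis
  also have "\<dots> = t * (t * c + b) + (t * b + a)"
    using L2_inner_lincomb[OF g f g] L2_inner_lincomb[OF g f f] by (simp add: abc L2_inner_commute)
  also have "\<dots> = a - b\<^sup>2 / c"
    using c by (simp add: t_def field_simps power2_eq_square)
  finally have "b\<^sup>2 \<le> a * c"
    using c by (simp add: field_simps)
  then have "sqrt (b\<^sup>2) \<le> sqrt (a * c)" by (rule real_sqrt_le_mono)
  then show ?thesis by (simp add: abc L2_norm_def real_sqrt_mult)
qed

lemma L2_norm_triangle:
  assumes f: "f \<in> L_space M 2" and g: "g \<in> L_space M 2"
  shows "L2_norm M (\<lambda>x. f x + g x) \<le> L2_norm M f + L2_norm M g"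
proof (rule power2_le_imp_le)
  have h: "(\<lambda>x. f x + g x) \<in> L_space M 2" by (rule L2_add[OF f g])
  have add: "L2_inner M k (\<lambda>x. f x + g x) = L2_inner M k f + L2_inner M k g" if "k \<in> L_space M 2" for k
    using L2_inner_lincomb[OF f g that, of 1] by simp
  have "(L2_norm M (\<lambda>x. f x + g x))\<^sup>2 = L2_inner M f f + 2 * L2_inner M f g + L2_inner M g g"
    unfolding L2_norm_square add[OF h]
    by (subst (1 2) L2_inner_commute) (simp add: add f g L2_inner_commute)
  also have "\<dots> \<le> L2_inner M f f + 2 * (L2_norm M f * L2_norm M g) + L2_inner M g g"
    using L2_Cauchy_Schwarz[OF f g] by simp
  also have "\<dots> = (L2_norm M f + L2_norm M g)\<^sup>2"
    by (simp add: power2_sum L2_norm_square)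
  finally show "(L2_norm M (\<lambda>x. f x + g x))\<^sup>2 \<le> (L2_norm M f + L2_norm M g)\<^sup>2" .
qed (simp add: L2_norm_nonneg)

lemma L2_norm_cmult: "L2_norm M (\<lambda>x. c * f x) = \<bar>c\<bar> * L2_norm M f"
proof -
  have "L2_inner M (\<lambda>x. c * f x) (\<lambda>x. c * f x) = c\<^sup>2 * L2_inner M f f"
    unfolding L2_inner_def by (simp add: power2_eq_square ac_simps flip: integral_mult_right_zero)
  then show ?thesis by (simp add: L2_norm_def real_sqrt_mult)
qed

abbreviation "L2_dist f g \<equiv> L2_norm M (\<lambda>x. f x - g x)"

lemma L2_norm_minus_commute: "L2_dist f g = L2_dist g f"
  using L2_norm_cmult[of "-1" "\<lambda>x. f x - g x"] by simp

lemma L2_norm_diff_triangle: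
  assumes "f \<in> L_space M 2" "g \<in> L_space M 2" "h \<in> L_space M 2"
  shows "L2_dist f h \<le> L2_dist f g + L2_dist g h"
  using L2_norm_triangle[OF L2_diff[OF assms(1,2)] L2_diff[OF assms(2,3)]] by simp

lemma abs_integral_le_L2_norm: "f \<in> L_space M 2 \<Longrightarrow> \<bar>\<integral>x. f x \<partial>M\<bar> \<le> L2_norm M f"
  using L2_Cauchy_Schwarz[OF _ L2_const[of 1], of f] by (simp add: L2_inner_def L2_norm_def prob_space)

lemma L2_eq_AE_of_tendsto:
  assumes f: "f \<in> L_space M 2" and g: "g \<in> L_space M 2" and u: "\<And>n::nat. u n \<in> L_space M 2"
    and lim: "(\<lambda>n. L2_dist (u n) f) \<longlonglongrightarrow> 0" "(\<lambda>n. L2_dist (u n) g) \<longlonglongrightarrow> 0"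
  shows "AE x in M. f x = g x"
proof -
  have "(\<lambda>n. L2_dist (u n) f + L2_dist (u n) g) \<longlonglongrightarrow> 0"
    using tendsto_add[OF lim] by simp
  moreover have "L2_dist f g \<le> L2_dist (u n) f + L2_dist (u n) g" for n
    using L2_norm_diff_triangle[OF f u g, of n] L2_norm_minus_commute[of f "u n"] by simp
  ultimately have "L2_dist f g \<le> 0"
    using LIMSEQ_le_const by blast
  then have "L2_dist f g = 0"
    using L2_norm_nonneg by (rule antisym)
  then show ?thesis
    using L2_norm_eq_0_iff[OF L2_diff[OF f g]] by simp
qed

lemma L2_inner_tendsto:
  assumes h: "h \<in> L_space M 2" and g: "g \<in> L_space M 2" and u: "\<And>n::nat. u n \<in> L_space M 2"
    and lim: "(\<lambda>n. L2_dist (u n) g) \<longlonglongrightarrow> 0"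
  shows "(\<lambda>n. L2_inner M h (u n)) \<longlonglongrightarrow> L2_inner M h g"
proof (subst tendsto_dist_iff, rule tendsto_sandwich[of "\<lambda>_. 0"])
  have "dist (L2_inner M h (u n)) (L2_inner M h g) \<le> L2_norm M h * L2_dist (u n) g" for n
    using L2_Cauchy_Schwarz[OF h L2_diff[OF u[of n] g]] L2_inner_diff[OF u[of n] g h] by (simp add: dist_real_def)
  then show "\<forall>\<^sub>F n in sequentially. dist (L2_inner M h (u n)) (L2_inner M h g) \<le> L2_norm M h * L2_dist (u n) g"
    by simp
  show "(\<lambda>n. L2_norm M h * L2_dist (u n) g) \<longlonglongrightarrow> 0"
    using tendsto_mult_right_zero[OF lim] .
qed simp_all

text \<open>The Riesz-Fischer argument: a fast subsequence converges almost everywhere, and Fatou's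
  lemma transfers the Cauchy bounds of the whole sequence to its limit.\<close>

lemma L2_complete:
  assumes X: "\<And>n. X n \<in> L_space M 2"
    and Cauchy: "\<And>e. e > 0 \<Longrightarrow> \<exists>N. \<forall>m\<ge>N. \<forall>n\<ge>N. L2_dist (X m) (X n) < e"
  shows "\<exists>g\<in>L_space M 2. (\<lambda>n. L2_dist (X n) g) \<longlonglongrightarrow> 0"
proof -
  have [measurable]: "X n \<in> borel_measurable M" for n using X L2_measurable by blast
  have "\<exists>N. \<forall>m\<ge>N. \<forall>n\<ge>N. L2_dist (X m) (X n) < (1 / 8) ^ k" for k :: nat
    by (rule Cauchy) simp
  then obtain N where N: "\<And>k m n. m \<ge> N k \<Longrightarrow> n \<ge> N k \<Longrightarrow> L2_dist (X m) (X n) < (1 / 8) ^ k"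
    by metis
  \<comment> \<open>The thresholds \<open>N k\<close> need not be monotone in \<open>k\<close>. The
    sum makes \<open>r\<close> increase while staying above \<open>N k\<close>, and the summand
    \<open>k\<close> makes it unbounded.\<close>
  define r where "r k = k + (\<Sum>j\<le>k. N j)" for k
  have rN: "r k \<ge> N k" for k
    unfolding r_def by (intro trans_le_add2 member_le_sum) auto
  have r_Suc: "r (Suc k) \<ge> r k" for k
    by (simp add: r_def)
  have r_ge: "r k \<ge> k" for k by (simp add: r_def)
  have "(\<integral>x. min 1 ((X (r (Suc k)) x - X (r k) x)\<^sup>2) \<partial>M) \<le> (1 / 8) ^ k" for k
  proof -
    have d: "(\<lambda>x. X (r (Suc k)) x - X (r k) x) \<in> L_space M 2"
      by (rule L2_diff[OF X X])
    have "(\<integral>x. min 1 ((X (r (Suc k)) x - X (r k) x)\<^sup>2) \<partial>M) \<le> (\<integral>x. (X (r (Suc k)) x - X (r k) x)\<^sup>2 \<partial>M)"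
      using d unfolding L2_iff by (intro integral_mono integrable_min) auto
    also have "\<dots> = (L2_norm M (\<lambda>x. X (r (Suc k)) x - X (r k) x))\<^sup>2"
      by (simp only: L2_norm_square) (simp add: L2_inner_def power2_eq_square)
    also have "\<dots> \<le> ((1 / 8) ^ k)\<^sup>2"
      using N[of k "r (Suc k)" "r k"] rN[of k] r_Suc[of k]
      by (intro power_mono L2_norm_nonneg) (simp add: less_imp_le order_trans)
    also have "\<dots> \<le> (1 / 8) ^ k"
      by (simp add: power2_eq_square mult_left_le power_le_one)
    finally show ?thesis .
  qed
  then have "AE x in M. convergent (\<lambda>k. X (r k) x)"
    by (intro AE_convergent_of_summable_increments[of "\<lambda>k. X (r k)"]) auto
  then have lim: "AE x in M. (\<lambda>k. X (r k) x) \<longlonglongrightarrow> g x" if "g = (\<lambda>x. lim (\<lambda>k. X (r k) x))" for g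
    using that by (auto simp: convergent_LIMSEQ_iff)
  define g where "g x = lim (\<lambda>k. X (r k) x)" for x
  have [measurable]: "g \<in> borel_measurable M"
    unfolding g_def by measurable
  have g_lim: "AE x in M. (\<lambda>k. X (r k) x) \<longlonglongrightarrow> g x"
    by (rule lim) (simp add: g_def fun_eq_iff)
  have bound: "(\<integral>\<^sup>+x. ennreal ((X n x - g x)\<^sup>2) \<partial>M) \<le> ennreal (((1 / 8) ^ m)\<^sup>2)" if "n \<ge> N m" for n m
  proof -
    have "(\<integral>\<^sup>+x. ennreal ((X n x - g x)\<^sup>2) \<partial>M) = (\<integral>\<^sup>+x. liminf (\<lambda>k. ennreal ((X n x - X (r k) x)\<^sup>2)) \<partial>M)"
    proof (rule nn_integral_cong_AE)
      show "AE x in M. ennreal ((X n x - g x)\<^sup>2) = liminf (\<lambda>k. ennreal ((X n x - X (r k) x)\<^sup>2))"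
        using g_lim
      proof eventually_elim
        case (elim x)
        then have "(\<lambda>k. ennreal ((X n x - X (r k) x)\<^sup>2)) \<longlonglongrightarrow> ennreal ((X n x - g x)\<^sup>2)"
          by (intro tendsto_intros)
        then show ?case
          using lim_imp_Liminf sequentially_bot by metis
      qed
    qed
    also have "\<dots> \<le> liminf (\<lambda>k. \<integral>\<^sup>+x. ennreal ((X n x - X (r k) x)\<^sup>2) \<partial>M)"
      by (rule nn_integral_liminf) measurable
    also have "\<dots> \<le> ennreal (((1 / 8) ^ m)\<^sup>2)"
    proof (rule Liminf_le)
      show "\<forall>\<^sub>F k in sequentially. (\<integral>\<^sup>+x. ennreal ((X n x - X (r k) x)\<^sup>2) \<partial>M) \<le> ennreal (((1 / 8) ^ m)\<^sup>2)"
        using eventually_ge_at_top[of "N m"]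
      proof eventually_elim
        case (elim k)
        have d: "(\<lambda>x. X n x - X (r k) x) \<in> L_space M 2" by (rule L2_diff[OF X X])
        then have "(\<integral>\<^sup>+x. ennreal ((X n x - X (r k) x)\<^sup>2) \<partial>M) = ennreal (\<integral>x. (X n x - X (r k) x)\<^sup>2 \<partial>M)"
          unfolding L2_iff by (intro nn_integral_eq_integral) auto
        also have "(\<integral>x. (X n x - X (r k) x)\<^sup>2 \<partial>M) = (L2_norm M (\<lambda>x. X n x - X (r k) x))\<^sup>2"
          by (simp only: L2_norm_square) (simp add: L2_inner_def power2_eq_square)
        also have "ennreal \<dots> \<le> ennreal (((1 / 8) ^ m)\<^sup>2)"
          using N[OF that order_trans[OF elim r_ge]]
          by (intro ennreal_leI power_mono L2_norm_nonneg) simp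
        finally show ?case .
      qed
    qed simp
    finally show ?thesis .
  qed
  have diff_L2: "(\<lambda>x. X n x - g x) \<in> L_space M 2" if "n \<ge> N m" for n m
    unfolding L2_iff using le_less_trans[OF bound[OF that]]
    by (auto intro!: integrableI_bounded)
  \<comment> \<open>So far only the difference with \<open>g\<close> is known to be square
    integrable; \<open>g\<close> is recovered by subtraction.\<close>
  have "(\<lambda>x. X (N 0) x - (X (N 0) x - g x)) \<in> L_space M 2"
    by (rule L2_diff[OF X diff_L2[OF order_refl]])
  then have g: "g \<in> L_space M 2" by simp
  have "L2_dist (X n) g \<le> (1 / 8) ^ m" if "n \<ge> N m" for n m
  proof (rule power2_le_imp_le)
    have "ennreal (\<integral>x. (X n x - g x)\<^sup>2 \<partial>M) \<le> ennreal (((1 / 8) ^ m)\<^sup>2)"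
      using bound[OF that] diff_L2[OF that] unfolding L2_iff by (subst nn_integral_eq_integral[symmetric]) auto
    then have "(\<integral>x. (X n x - g x)\<^sup>2 \<partial>M) \<le> ((1 / 8) ^ m)\<^sup>2"
      by (subst (asm) ennreal_le_iff) auto
    then show "(L2_dist (X n) g)\<^sup>2 \<le> ((1 / 8) ^ m)\<^sup>2"
      by (simp only: L2_norm_square) (simp add: L2_inner_def power2_eq_square)
  qed simp
  moreover have "\<exists>m. (1 / 8 :: real) ^ m < e" if "e > 0" for e
    using real_arch_pow_inv[OF that, of "1 / 8"] by simp
  ultimately have "(\<lambda>n. L2_dist (X n) g) \<longlonglongrightarrow> 0"
    unfolding LIMSEQ_def by (simp add: L2_norm_nonneg) (meson le_less_trans)
  with g show ?thesis by blast
qed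

lemma L2_zero_L2: "f \<in> L2_zero M \<Longrightarrow> f \<in> L_space M 2"
  by (simp add: L2_zero_def)

lemma L2_zero_lincomb:
  assumes "f \<in> L2_zero M" "g \<in> L2_zero M"
  shows "(\<lambda>x. c * f x + g x) \<in> L2_zero M"
  using assms L2_lincomb[of f g c] L2_integrable[of f] L2_integrable[of g] by (simp add: L2_zero_def)

lemma L2_zero_diff:
  assumes "f \<in> L2_zero M" "g \<in> L2_zero M"
  shows "(\<lambda>x. f x - g x) \<in> L2_zero M"
  using L2_zero_lincomb[OF assms(2,1), of "-1"] by simp

lemma L2_zero_sum:
  assumes "\<And>j. j \<in> J \<Longrightarrow> f j \<in> L2_zero M"
  shows "(\<lambda>x. \<Sum>j\<in>J. c j * f j x) \<in> L2_zero M"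
  using assms
proof (induction J rule: infinite_finite_induct)
  case (insert j J)
  then show ?case using L2_zero_lincomb[of "f j" "\<lambda>x. \<Sum>j\<in>J. c j * f j x" "c j"] by simp
qed (simp_all add: L2_zero_def L2_const)

lemma L2_zero_closed:
  assumes u: "\<And>n::nat. u n \<in> L2_zero M" and g: "g \<in> L_space M 2"
    and lim: "(\<lambda>n. L2_dist (u n) g) \<longlonglongrightarrow> 0"
  shows "g \<in> L2_zero M"
proof -
  have uL: "u n \<in> L_space M 2" for n using u by (simp add: L2_zero_def)
  have "\<bar>\<integral>x. g x \<partial>M\<bar> \<le> L2_dist (u n) g" for n
  proof -
    have "(\<integral>x. u n x - g x \<partial>M) = - (\<integral>x. g x \<partial>M)"
      using u[of n] L2_integrable[OF uL[of n]] L2_integrable[OF g] by (simp add: L2_zero_def)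
    then show ?thesis using abs_integral_le_L2_norm[OF L2_diff[OF uL[of n] g]] by simp
  qed
  then have "\<bar>\<integral>x. g x \<partial>M\<bar> \<le> 0"
    by (intro LIMSEQ_le_const[OF lim]) auto
  then show ?thesis using g by (simp add: L2_zero_def)
qed

text \<open>Makes negative powers, which are L2 functions, admissible integrands for the stable
  integral.\<close>

lemma L2_subset_L_space:
  assumes f: "f \<in> L_space M 2" and \<alpha>: "0 < \<alpha>" "\<alpha> \<le> 2"
  shows "f \<in> L_space M \<alpha>"
proof -
  have [measurable]: "f \<in> borel_measurable M" and int: "integrable M (\<lambda>x. (f x)\<^sup>2)"
    using f by (auto simp: L2_iff)
  have le: "\<bar>x\<bar> powr \<alpha> \<le> 1 + x\<^sup>2" for x :: real
    by (rule abs_powr_le_square[OF \<alpha>])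
  have "integrable M (\<lambda>x. \<bar>f x\<bar> powr \<alpha>)"
    by (rule Bochner_Integration.integrable_bound[where f = "\<lambda>x. 1 + (f x)\<^sup>2"]) (use int le in auto)
  then show ?thesis by (simp add: L_space_def)
qed

end

section \<open>Convergence in probability and joint laws\<close>

context prob_space
begin

lemma char_distr_eq:
  fixes X :: "'a \<Rightarrow> real"
  assumes [measurable]: "X \<in> borel_measurable M"
  shows "char (distr M borel X) t = (CLINT \<omega>|M. iexp (t * X \<omega>))"
  unfolding char_def by (rule integral_distr) measurable

text \<open>Tends to 0 exactly when the variables tend to 0 in probability, and is finite even when
  the second moment is not.\<close>

definition trunc_moment :: "('a \<Rightarrow> real) \<Rightarrow> real" where
  "trunc_moment X = (\<integral>\<omega>. min 1 ((X \<omega>)\<^sup>2) \<partial>M)"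

lemma trunc_integrable:
  assumes [measurable]: "X \<in> borel_measurable M"
  shows "integrable M (\<lambda>\<omega>. min 1 ((X \<omega> :: real)\<^sup>2))"
  by (rule integrable_const_bound[of _ 1]) auto

lemma trunc_moment_nonneg: "trunc_moment X \<ge> 0"
  by (simp add: trunc_moment_def)

lemma trunc_moment_cong_AE:
  assumes [measurable]: "X \<in> borel_measurable M" "Y \<in> borel_measurable M"
    and "AE \<omega> in M. X \<omega> = Y \<omega>"
  shows "trunc_moment X = trunc_moment Y"
  unfolding trunc_moment_def using assms(3) by (intro integral_cong_AE) auto

text \<open>The factor 2 comes from
  \<open>(a + b)\<^sup>2 \<le> 2 * a\<^sup>2 + 2 * b\<^sup>2\<close>.\<close>

lemma trunc_moment_triangle:
  assumes [measurable]: "X \<in> borel_measurable M" "Y \<in> borel_measurable M" "Z \<in> borel_measurable M"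
  shows "trunc_moment (\<lambda>\<omega>. X \<omega> - Z \<omega>) \<le>
    2 * trunc_moment (\<lambda>\<omega>. X \<omega> - Y \<omega>) + 2 * trunc_moment (\<lambda>\<omega>. Y \<omega> - Z \<omega>)"
proof -
  have ineq: "min 1 ((a + b)\<^sup>2) \<le> 2 * min 1 (a\<^sup>2) + 2 * min 1 (b\<^sup>2)" for a b :: real
  proof -
    have "(a + b)\<^sup>2 \<le> 2 * a\<^sup>2 + 2 * b\<^sup>2"
      using sum_squares_bound[of a b] by (simp add: power2_sum)
    moreover have "0 \<le> a\<^sup>2" "0 \<le> b\<^sup>2" by simp_all
    ultimately show ?thesis by linarith
  qed
  have "trunc_moment (\<lambda>\<omega>. X \<omega> - Z \<omega>) \<le>
    (\<integral>\<omega>. 2 * min 1 ((X \<omega> - Y \<omega>)\<^sup>2) + 2 * min 1 ((Y \<omega> - Z \<omega>)\<^sup>2) \<partial>M)"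
    unfolding trunc_moment_def
  proof (rule integral_mono)
    show "min 1 ((X \<omega> - Z \<omega>)\<^sup>2) \<le> 2 * min 1 ((X \<omega> - Y \<omega>)\<^sup>2) + 2 * min 1 ((Y \<omega> - Z \<omega>)\<^sup>2)" for \<omega>
      using ineq[of "X \<omega> - Y \<omega>" "Y \<omega> - Z \<omega>"] by simp
  qed (auto intro!: trunc_integrable Bochner_Integration.integrable_add integrable_mult_right)
  also have "\<dots> = 2 * trunc_moment (\<lambda>\<omega>. X \<omega> - Y \<omega>) + 2 * trunc_moment (\<lambda>\<omega>. Y \<omega> - Z \<omega>)"
    unfolding trunc_moment_def by (subst Bochner_Integration.integral_add) (auto intro!: trunc_integrable)
  finally show ?thesis .
qed

lemma prob_gt_le_trunc_moment:
  assumes [measurable]: "X \<in> borel_measurable M" and "e > 0"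
  shows "measure M {\<omega> \<in> space M. \<bar>X \<omega>\<bar> > e} \<le> trunc_moment X / min 1 (e\<^sup>2)"
proof -
  have "measure M {\<omega> \<in> space M. \<bar>X \<omega>\<bar> > e} \<le> measure M {\<omega> \<in> space M. min 1 ((X \<omega>)\<^sup>2) \<ge> min 1 (e\<^sup>2)}"
  proof (rule finite_measure_mono)
    have "min 1 (e\<^sup>2) \<le> min 1 (x\<^sup>2)" if "\<bar>x\<bar> > e" for x :: real
    proof -
      have "e\<^sup>2 \<le> x\<^sup>2" using that assms(2) by (simp add: abs_le_square_iff[symmetric])
      then show ?thesis by (rule min.mono[OF order_refl])
    qed
    then show "{\<omega> \<in> space M. \<bar>X \<omega>\<bar> > e} \<subseteq> {\<omega> \<in> space M. min 1 ((X \<omega>)\<^sup>2) \<ge> min 1 (e\<^sup>2)}" by blast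
  qed measurable
  also have "\<dots> \<le> trunc_moment X / min 1 (e\<^sup>2)"
    unfolding trunc_moment_def using assms(2)
    by (intro integral_Markov_inequality_measure[OF trunc_integrable, of _ "{}"]) auto
  finally show ?thesis .
qed

lemma tendsto_measure_iff_trunc_moment:
  assumes [measurable]: "\<And>n. X n \<in> borel_measurable M"
  shows "(\<forall>e>0. (\<lambda>n. measure M {\<omega> \<in> space M. \<bar>X n \<omega>\<bar> > e}) \<longlonglongrightarrow> 0) \<longleftrightarrow>
    (\<lambda>n::nat. trunc_moment (X n)) \<longlonglongrightarrow> 0"
proof safe
  assume prob: "\<forall>e>0. (\<lambda>n. measure M {\<omega> \<in> space M. \<bar>X n \<omega>\<bar> > e}) \<longlonglongrightarrow> 0"
  show "(\<lambda>n. trunc_moment (X n)) \<longlonglongrightarrow> 0"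
  proof (rule LIMSEQ_I)
    fix r :: real assume r: "r > 0"
    \<comment> \<open>At this level the event \<open>|X n| \<le> e\<close> contributes at most
      \<open>r / 2\<close> to the truncated moment, and its complement at most its
      probability.\<close>
    define e where "e = sqrt (r / 2)"
    have e: "e > 0" "e\<^sup>2 = r / 2" using r by (auto simp: e_def)
    have "(\<lambda>n. measure M {\<omega> \<in> space M. \<bar>X n \<omega>\<bar> > e}) \<longlonglongrightarrow> 0" using prob e(1) by blast
    from LIMSEQ_D[OF this, of "r / 2"] r
    obtain N where N: "\<And>n. n \<ge> N \<Longrightarrow> norm (measure M {\<omega> \<in> space M. \<bar>X n \<omega>\<bar> > e} - 0) < r / 2"
      by auto
    have "trunc_moment (X n) < r" if "n \<ge> N" for n
    proof -
      have "trunc_moment (X n) \<le> (\<integral>\<omega>. r / 2 + indicator {\<omega> \<in> space M. \<bar>X n \<omega>\<bar> > e} \<omega> \<partial>M)"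
        unfolding trunc_moment_def
      proof (rule integral_mono[OF trunc_integrable])
        fix \<omega> assume "\<omega> \<in> space M"
        moreover have "(X n \<omega>)\<^sup>2 \<le> e\<^sup>2" if "\<bar>X n \<omega>\<bar> \<le> e"
          using that e(1) by (simp add: abs_le_square_iff[symmetric])
        ultimately show "min 1 ((X n \<omega>)\<^sup>2) \<le> r / 2 + indicator {\<omega> \<in> space M. \<bar>X n \<omega>\<bar> > e} \<omega>"
          using r by (auto simp: e(2) indicator_def min_def)
      qed (auto intro!: integrable_real_indicator simp: less_top[symmetric])
      also have "\<dots> = r / 2 + measure M {\<omega> \<in> space M. \<bar>X n \<omega>\<bar> > e}"
        by (subst Bochner_Integration.integral_add) (auto simp: prob_space less_top[symmetric])
      also have "\<dots> < r" using N[OF that] by simp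
      finally show ?thesis .
    qed
    then show "\<exists>N. \<forall>n\<ge>N. norm (trunc_moment (X n) - 0) < r"
      using trunc_moment_nonneg by auto
  qed
next
  fix e :: real assume lim: "(\<lambda>n. trunc_moment (X n)) \<longlonglongrightarrow> 0" and e: "e > 0"
  show "(\<lambda>n. measure M {\<omega> \<in> space M. \<bar>X n \<omega>\<bar> > e}) \<longlonglongrightarrow> 0"
  proof (rule tendsto_sandwich[of "\<lambda>_. 0"])
    show "\<forall>\<^sub>F n in sequentially. measure M {\<omega> \<in> space M. \<bar>X n \<omega>\<bar> > e} \<le> trunc_moment (X n) / min 1 (e\<^sup>2)"
      using prob_gt_le_trunc_moment e by simp
    show "(\<lambda>n. trunc_moment (X n) / min 1 (e\<^sup>2)) \<longlonglongrightarrow> 0"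
      using tendsto_divide_zero[OF lim] .
  qed simp_all
qed

text \<open>Averaging \<open>1 - cos (s X)\<close> over a standard normal \<open>s\<close> gives \<open>1 - exp (- X\<^sup>2 / 2)\<close>, which is
  comparable with \<open>min 1 (X\<^sup>2)\<close>.\<close>

lemma trunc_moment_le_scale:
  assumes X[measurable]: "X \<in> borel_measurable M" and \<alpha>: "0 < \<alpha>" "\<alpha> \<le> 2" and c: "c \<ge> 0"
    and char: "\<And>t. char (distr M borel X) t = complex_of_real (exp (- (\<bar>t\<bar> powr \<alpha> * c)))"
  shows "trunc_moment X \<le> 8 * c"
proof -
  interpret N: prob_space std_normal_distribution
    using real_dist_normal_dist by (simp add: real_distribution_def)
  interpret XN: pair_prob_space M std_normal_distribution ..
  have sets_N[measurable_cong]: "sets std_normal_distribution = sets borel" by simp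
  \<comment> \<open>The integrand is the characteristic function of the standard normal law at
    \<open>X\<close>. Fubini exchanges it for the normal average of the characteristic function of
    \<open>X\<close>, which is known.\<close>
  have "complex_of_real (\<integral>\<omega>. exp (- (X \<omega>)\<^sup>2 / 2) \<partial>M) = (CLINT \<omega>|M. char std_normal_distribution (X \<omega>))"
    unfolding char_std_normal_distribution by (rule integral_complex_of_real[symmetric])
  also have "\<dots> = (CLINT \<omega>|M. CLINT s|std_normal_distribution. iexp (X \<omega> * s))"
    by (simp add: char_def)
  also have "\<dots> = (CLINT s|std_normal_distribution. CLINT \<omega>|M. iexp (X \<omega> * s))"
  proof (rule XN.Fubini_integral[symmetric])
    show "integrable (M \<Otimes>\<^sub>M std_normal_distribution) (\<lambda>(\<omega>, s). iexp (X \<omega> * s))"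
      by (rule XN.integrable_const_bound[of _ 1]) (auto simp: norm_exp_i_times[of "_ :: real"] split: prod.splits)
  qed
  also have "\<dots> = (CLINT s|std_normal_distribution. complex_of_real (exp (- (\<bar>s\<bar> powr \<alpha> * c))))"
    using char char_distr_eq[OF X] by (simp add: mult.commute)
  finally have eq: "(\<integral>\<omega>. exp (- (X \<omega>)\<^sup>2 / 2) \<partial>M) = (\<integral>s. exp (- (\<bar>s\<bar> powr \<alpha> * c)) \<partial>std_normal_distribution)"
    by (simp only: integral_complex_of_real of_real_eq_iff)
  note le = abs_powr_le_square[OF \<alpha>]
  \<comment> \<open>\<open>1 + s\<^sup>2\<close> has mean 2 under the standard normal law. Together
    with the factor 4 in the comparison of \<open>min 1 (x\<^sup>2)\<close> below, this produces the
    constant 8.\<close>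
  have "1 - 2 * c = (\<integral>s. 1 - c * (1 + s\<^sup>2) \<partial>std_normal_distribution)"
    using std_normal_distribution_even_moments[of 1] N.prob_space by simp
  also have "\<dots> \<le> (\<integral>s. exp (- (\<bar>s\<bar> powr \<alpha> * c)) \<partial>std_normal_distribution)"
  proof (rule integral_mono)
    show "integrable std_normal_distribution (\<lambda>s. 1 - c * (1 + s\<^sup>2))"
      using std_normal_distribution_even_moments(2)[of 1] by simp
    show "integrable std_normal_distribution (\<lambda>s. exp (- (\<bar>s\<bar> powr \<alpha> * c)))"
      by (rule N.integrable_const_bound[of _ 1]) (auto simp: c)
    fix s :: real
    have "1 - c * (1 + s\<^sup>2) \<le> 1 - \<bar>s\<bar> powr \<alpha> * c"
      using mult_left_mono[OF le c, of s] by (simp add: mult.commute)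
    also have "\<dots> \<le> exp (- (\<bar>s\<bar> powr \<alpha> * c))"
      using exp_ge_add_one_self[of "- (\<bar>s\<bar> powr \<alpha> * c)"] by simp
    finally show "1 - c * (1 + s\<^sup>2) \<le> exp (- (\<bar>s\<bar> powr \<alpha> * c))" .
  qed
  finally have lower: "1 - 2 * c \<le> (\<integral>\<omega>. exp (- (X \<omega>)\<^sup>2 / 2) \<partial>M)"
    by (simp only: eq)
  have ineq: "min 1 (x\<^sup>2) \<le> 4 * (1 - exp (- x\<^sup>2 / 2))" for x :: real
  proof -
    have exp_le: "exp (- (x\<^sup>2 / 2)) \<le> 1 / (1 + x\<^sup>2 / 2)"
      using exp_ge_add_one_self[of "x\<^sup>2 / 2"] by (simp add: exp_minus field_simps add_pos_nonneg)
    have "min 1 y \<le> 4 * (1 - 1 / (1 + y / 2))" if "y \<ge> 0" for y :: real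
    proof -
      have "4 * (1 - 1 / (1 + y / 2)) = 4 * y / (2 + y)" using that by (simp add: field_simps)
      moreover have "min 1 y * (2 + y) \<le> 4 * y"
      proof (cases "y \<le> 1")
        case True
        then have "y * (2 + y) \<le> y * 4" using that by (intro mult_left_mono) auto
        then show ?thesis using True by (simp add: min_def mult.commute)
      qed (simp add: min_def)
      ultimately show ?thesis using that by (simp add: pos_le_divide_eq)
    qed
    from this[of "x\<^sup>2"] exp_le show ?thesis by (simp add: algebra_simps)
  qed
  have int: "integrable M (\<lambda>\<omega>. exp (- (X \<omega>)\<^sup>2 / 2))"
    by (rule integrable_const_bound[of _ 1]) auto
  have "trunc_moment X \<le> (\<integral>\<omega>. 4 * (1 - exp (- (X \<omega>)\<^sup>2 / 2)) \<partial>M)"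
    unfolding trunc_moment_def using int
    by (intro integral_mono trunc_integrable X ineq) auto
  also have "\<dots> = 4 * (1 - (\<integral>\<omega>. exp (- (X \<omega>)\<^sup>2 / 2) \<partial>M))"
    using int by (simp add: prob_space)
  finally show ?thesis using lower by simp
qed

lemma trunc_moment_complete:
  assumes X[measurable]: "\<And>n. X n \<in> borel_measurable M"
    and Cauchy: "\<And>n. trunc_moment (\<lambda>\<omega>. X (Suc n) \<omega> - X n \<omega>) \<le> (1 / 8) ^ n"
  shows "\<exists>Y\<in>borel_measurable M. (\<lambda>n. trunc_moment (\<lambda>\<omega>. X n \<omega> - Y \<omega>)) \<longlonglongrightarrow> 0"
proof (intro bexI)
  define Y where "Y \<omega> = lim (\<lambda>n. X n \<omega>)" for \<omega>
  show Y[measurable]: "Y \<in> borel_measurable M"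
    unfolding Y_def by measurable
  have "AE \<omega> in M. convergent (\<lambda>n. X n \<omega>)"
    using Cauchy unfolding trunc_moment_def by (intro AE_convergent_of_summable_increments) auto
  then have lim: "AE \<omega> in M. (\<lambda>n. min 1 ((X n \<omega> - Y \<omega>)\<^sup>2)) \<longlonglongrightarrow> 0"
  proof eventually_elim
    case (elim \<omega>)
    then have "(\<lambda>n. X n \<omega>) \<longlonglongrightarrow> Y \<omega>" by (simp add: Y_def convergent_LIMSEQ_iff)
    then have "(\<lambda>n. min 1 ((X n \<omega> - Y \<omega>)\<^sup>2)) \<longlonglongrightarrow> min 1 ((Y \<omega> - Y \<omega>)\<^sup>2)"
      by (intro tendsto_intros)
    then show ?case by simp
  qed
  have "(\<lambda>n. \<integral>\<omega>. min 1 ((X n \<omega> - Y \<omega>)\<^sup>2) \<partial>M) \<longlonglongrightarrow> (\<integral>\<omega>. 0 \<partial>M)"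
    by (rule integral_dominated_convergence[where w = "\<lambda>_. 1"]) (use lim in auto)
  then show "(\<lambda>n. trunc_moment (\<lambda>\<omega>. X n \<omega> - Y \<omega>)) \<longlonglongrightarrow> 0"
    by (simp add: trunc_moment_def)
qed

text \<open>Joint distribution functions determine a law on a finite product, because products of
  half-lines form an intersection-stable generator that exhausts the space.\<close>

lemma distr_PiM_eqI:
  fixes X Y :: "'i \<Rightarrow> 'a \<Rightarrow> real"
  assumes J: "finite J"
    and X[measurable]: "\<And>j. j \<in> J \<Longrightarrow> X j \<in> borel_measurable M"
    and Y[measurable]: "\<And>j. j \<in> J \<Longrightarrow> Y j \<in> borel_measurable M"
    and eq: "\<And>a. measure M {\<omega> \<in> space M. \<forall>j\<in>J. X j \<omega> \<le> a j} = measure M {\<omega> \<in> space M. \<forall>j\<in>J. Y j \<omega> \<le> a j}"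
  shows "distr M (\<Pi>\<^sub>M j\<in>J. borel) (\<lambda>\<omega>. \<lambda>j\<in>J. X j \<omega>) = distr M (\<Pi>\<^sub>M j\<in>J. borel) (\<lambda>\<omega>. \<lambda>j\<in>J. Y j \<omega>)"
proof -
  let ?\<Pi> = "\<Pi>\<^sub>M j\<in>J. borel :: real measure"
  define E where "E = {Pi\<^sub>E J F |F. \<forall>j\<in>J. F j \<in> range (\<lambda>a::real. {..a})}"
  have sets: "sets ?\<Pi> = sigma_sets (space ?\<Pi>) E"
  proof -
    have borel: "sets borel = sets (sigma UNIV (range (\<lambda>a::real. {..a})))"
      by (rule arg_cong[OF borel_eq_atMost])
    have "{{f \<in> Pi\<^sub>E J (\<lambda>_. UNIV). \<forall>i\<in>j. f i \<in> A i} |A j. j \<in> {J} \<and> A \<in> Pi j (\<lambda>_. range (\<lambda>a::real. {..a}))} = E"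
    proof -
      have "{f \<in> Pi\<^sub>E J (\<lambda>_. UNIV). \<forall>i\<in>J. f i \<in> A i} = Pi\<^sub>E J A" for A :: "'i \<Rightarrow> real set"
        by (auto simp: PiE_iff extensional_def)
      then show ?thesis by (simp add: E_def Pi_iff)
    qed
    moreover have "\<exists>S\<subseteq>range (\<lambda>a::real. {..a}). countable S \<and> UNIV = \<Union>S"
      \<comment> \<open>A countable cover of the line by half-lines is what lets their products
        generate the product sigma-algebra.\<close>
      by (rule exI[of _ "range (\<lambda>n. {..real n})"]) (use real_arch_simple in auto)
    ultimately have "sets (\<Pi>\<^sub>M j\<in>J. sigma UNIV (range (\<lambda>a::real. {..a}))) = sets (sigma (\<Pi>\<^sub>E j\<in>J. UNIV) E)"
      using sets_PiM_sigma[where \<Omega> = "\<lambda>_. UNIV" and E = "\<lambda>_. range (\<lambda>a::real. {..a})" and I = J and J = "{J}"] J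
      by auto
    moreover have "E \<subseteq> Pow (\<Pi>\<^sub>E j\<in>J. UNIV)"
      unfolding E_def by (auto simp: PiE_iff)
    ultimately show ?thesis
      using sets_PiM_cong[of J J "\<lambda>_. borel :: real measure" "\<lambda>_. sigma UNIV (range (\<lambda>a::real. {..a}))"] borel
      by (simp add: space_PiM)
  qed
  show ?thesis
  proof (rule measure_eqI_generator_eq[where E = E and \<Omega> = "space ?\<Pi>"
        and A = "\<lambda>n. Pi\<^sub>E J (\<lambda>_. {..real n})"])
    show "Int_stable E"
    proof (rule Int_stableI)
      fix a b assume "a \<in> E" "b \<in> E"
      then obtain F G where FG: "a = Pi\<^sub>E J F" "b = Pi\<^sub>E J G" "\<forall>j\<in>J. F j \<in> range (\<lambda>a::real. {..a})"
        "\<forall>j\<in>J. G j \<in> range (\<lambda>a::real. {..a})" unfolding E_def by blast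
      have "\<forall>j\<in>J. F j \<inter> G j \<in> range (\<lambda>a::real. {..a})"
      proof
        fix j assume "j \<in> J"
        then obtain x y where "F j = {..x}" "G j = {..y}" using FG by blast
        then show "F j \<inter> G j \<in> range (\<lambda>a::real. {..a})"
          by (auto intro!: image_eqI[of _ _ "min x y"])
      qed
      then show "a \<inter> b \<in> E"
        unfolding E_def FG(1,2) PiE_Int by blast
    qed
    show "E \<subseteq> Pow (space ?\<Pi>)"
      by (auto simp: E_def space_PiM)
    show "range (\<lambda>n. Pi\<^sub>E J (\<lambda>_. {..real n})) \<subseteq> E"
      by (auto simp: E_def)
    show "(\<Union>n. Pi\<^sub>E J (\<lambda>_. {..real n})) = space ?\<Pi>"
    proof -
      have "\<exists>n. f \<in> Pi\<^sub>E J (\<lambda>_. {..real n})" if f: "f \<in> extensional J" for f :: "'i \<Rightarrow> real"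
      proof -
        obtain n where n: "(\<Sum>j\<in>J. \<bar>f j\<bar>) \<le> real n" using real_arch_simple by blast
        have "f j \<le> real n" if "j \<in> J" for j
          using member_le_sum[of j J "\<lambda>j. \<bar>f j\<bar>"] that J n by fastforce
        then show ?thesis using f by (auto simp: PiE_iff)
      qed
      then show ?thesis by (auto simp: space_PiM PiE_iff)
    qed
    show "sets (distr M ?\<Pi> (\<lambda>\<omega>. \<lambda>j\<in>J. X j \<omega>)) = sigma_sets (space ?\<Pi>) E"
      "sets (distr M ?\<Pi> (\<lambda>\<omega>. \<lambda>j\<in>J. Y j \<omega>)) = sigma_sets (space ?\<Pi>) E"
      by (simp_all add: sets)
    have mX: "(\<lambda>\<omega>. \<lambda>j\<in>J. X j \<omega>) \<in> M \<rightarrow>\<^sub>M ?\<Pi>" and mY: "(\<lambda>\<omega>. \<lambda>j\<in>J. Y j \<omega>) \<in> M \<rightarrow>\<^sub>M ?\<Pi>"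
      using X Y by (auto intro!: measurable_restrict)
    fix A assume "A \<in> E"
    then obtain F where F: "A = Pi\<^sub>E J F" "\<forall>j\<in>J. \<exists>a::real. F j = {..a}"
      unfolding E_def by blast
    then obtain a where a: "\<forall>j\<in>J. F j = {..a j :: real}" by metis
    have A: "A \<in> sets ?\<Pi>"
      unfolding F(1) using a J by (intro sets_PiM_I_finite) auto
    have "(\<lambda>\<omega>. \<lambda>j\<in>J. Z j \<omega>) -` A \<inter> space M = {\<omega> \<in> space M. \<forall>j\<in>J. Z j \<omega> \<le> a j}" for Z :: "'i \<Rightarrow> 'a \<Rightarrow> real"
      unfolding F(1) using a by (auto simp: Pi_iff)
    with A show "emeasure (distr M ?\<Pi> (\<lambda>\<omega>. \<lambda>j\<in>J. X j \<omega>)) A =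
        emeasure (distr M ?\<Pi> (\<lambda>\<omega>. \<lambda>j\<in>J. Y j \<omega>)) A"
      by (simp add: emeasure_distr mX mY emeasure_eq_measure eq)
  next
    fix n
    have mX: "(\<lambda>\<omega>. \<lambda>j\<in>J. X j \<omega>) \<in> M \<rightarrow>\<^sub>M ?\<Pi>"
      using X by (auto intro!: measurable_restrict)
    interpret D: prob_space "distr M ?\<Pi> (\<lambda>\<omega>. \<lambda>j\<in>J. X j \<omega>)"
      by (rule prob_space_distr[OF mX])
    show "emeasure (distr M ?\<Pi> (\<lambda>\<omega>. \<lambda>j\<in>J. X j \<omega>)) (Pi\<^sub>E J (\<lambda>_. {..real n})) \<noteq> \<infinity>"
      using D.emeasure_finite by simp
  qed
qed

text \<open>Along a subsequence all coordinates converge almost surely, so expectations of bounded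
  continuous functions of the limits agree. Continuous approximations of the indicator of an orthant
  then identify the joint distribution functions.\<close>

lemma distr_PiM_eq_limit:
  fixes X Y :: "'i \<Rightarrow> 'a \<Rightarrow> real"
  assumes J: "finite J"
    and X[measurable]: "\<And>j. j \<in> J \<Longrightarrow> X j \<in> borel_measurable M"
    and Y[measurable]: "\<And>j. j \<in> J \<Longrightarrow> Y j \<in> borel_measurable M"
    and U[measurable]: "\<And>j n. j \<in> J \<Longrightarrow> U n j \<in> borel_measurable M"
    and V[measurable]: "\<And>j n. j \<in> J \<Longrightarrow> V n j \<in> borel_measurable M"
    and UX: "\<And>j. j \<in> J \<Longrightarrow> (\<lambda>n::nat. trunc_moment (\<lambda>\<omega>. U n j \<omega> - X j \<omega>)) \<longlonglongrightarrow> 0"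
    and VY: "\<And>j. j \<in> J \<Longrightarrow> (\<lambda>n::nat. trunc_moment (\<lambda>\<omega>. V n j \<omega> - Y j \<omega>)) \<longlonglongrightarrow> 0"
    and eq: "\<And>n. distr M (\<Pi>\<^sub>M j\<in>J. borel) (\<lambda>\<omega>. \<lambda>j\<in>J. U n j \<omega>) = distr M (\<Pi>\<^sub>M j\<in>J. borel) (\<lambda>\<omega>. \<lambda>j\<in>J. V n j \<omega>)"
  shows "distr M (\<Pi>\<^sub>M j\<in>J. borel) (\<lambda>\<omega>. \<lambda>j\<in>J. X j \<omega>) = distr M (\<Pi>\<^sub>M j\<in>J. borel) (\<lambda>\<omega>. \<lambda>j\<in>J. Y j \<omega>)"
proof (rule distr_PiM_eqI[OF J X Y])
  fix a :: "'i \<Rightarrow> real"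
  \<comment> \<open>One quantity dominates the errors of all coordinates of both families, so a
    single subsequence serves them all.\<close>
  define D where "D n \<omega> = (\<Sum>j\<in>J. min 1 ((U n j \<omega> - X j \<omega>)\<^sup>2) + min 1 ((V n j \<omega> - Y j \<omega>)\<^sup>2))" for n \<omega>
  have D_int: "integrable M (D n)" for n
    unfolding D_def by (intro Bochner_Integration.integrable_sum Bochner_Integration.integrable_add trunc_integrable) measurable
  have D_nonneg: "D n \<omega> \<ge> 0" for n \<omega>
    unfolding D_def by (intro sum_nonneg) auto
  have "(\<integral>\<omega>. norm (D n \<omega>) \<partial>M) =
      (\<Sum>j\<in>J. trunc_moment (\<lambda>\<omega>. U n j \<omega> - X j \<omega>) + trunc_moment (\<lambda>\<omega>. V n j \<omega> - Y j \<omega>))" for n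
    using D_nonneg unfolding D_def trunc_moment_def
    by (simp add: trunc_integrable Bochner_Integration.integral_sum Bochner_Integration.integral_add)
  moreover have "(\<lambda>n. \<Sum>j\<in>J. trunc_moment (\<lambda>\<omega>. U n j \<omega> - X j \<omega>) + trunc_moment (\<lambda>\<omega>. V n j \<omega> - Y j \<omega>)) \<longlonglongrightarrow> (\<Sum>j\<in>J. 0 + 0)"
    by (intro tendsto_sum tendsto_add UX VY)
  ultimately have "(\<lambda>n. \<integral>\<omega>. norm (D n \<omega>) \<partial>M) \<longlonglongrightarrow> 0" by simp
  from tendsto_L1_AE_subseq[OF D_int this]
  obtain r where r: "AE \<omega> in M. (\<lambda>n. D (r n) \<omega>) \<longlonglongrightarrow> 0" by blast
  \<comment> \<open>Eventually the truncated square is below 1 and so equals the square.\<close>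
  have sq: "f \<longlonglongrightarrow> l" if "(\<lambda>n. min 1 ((f n - l)\<^sup>2)) \<longlonglongrightarrow> 0" for f :: "nat \<Rightarrow> real" and l
  proof -
    have "\<forall>\<^sub>F n in sequentially. min 1 ((f n - l)\<^sup>2) < 1"
      using that by (rule order_tendstoD) simp
    then have "\<forall>\<^sub>F n in sequentially. min 1 ((f n - l)\<^sup>2) = (f n - l)\<^sup>2"
      by eventually_elim (simp add: min_def split: if_splits)
    then have "(\<lambda>n. (f n - l)\<^sup>2) \<longlonglongrightarrow> 0"
      by (rule Lim_transform_eventually[OF that])
    then have "(\<lambda>n. sqrt ((f n - l)\<^sup>2)) \<longlonglongrightarrow> sqrt 0" by (rule tendsto_real_sqrt)
    then have "(\<lambda>n. f n - l) \<longlonglongrightarrow> 0" by (simp add: tendsto_rabs_zero_iff)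
    then show ?thesis by (simp add: LIM_zero_iff)
  qed
  have lim: "AE \<omega> in M. \<forall>j\<in>J. (\<lambda>n. U (r n) j \<omega>) \<longlonglongrightarrow> X j \<omega> \<and> (\<lambda>n. V (r n) j \<omega>) \<longlonglongrightarrow> Y j \<omega>"
    using r
  proof eventually_elim
    case (elim \<omega>)
    show ?case
    proof
      fix j assume j: "j \<in> J"
      have nonneg: "0 \<le> min 1 (x\<^sup>2)" for x :: real by simp
      have le: "min 1 ((U n j \<omega> - X j \<omega>)\<^sup>2) + min 1 ((V n j \<omega> - Y j \<omega>)\<^sup>2) \<le> D n \<omega>" for n
        unfolding D_def using j J
        by (intro member_le_sum[of j J "\<lambda>j. min 1 ((U n j \<omega> - X j \<omega>)\<^sup>2) + min 1 ((V n j \<omega> - Y j \<omega>)\<^sup>2)"]) auto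
      have leU: "min 1 ((U n j \<omega> - X j \<omega>)\<^sup>2) \<le> D n \<omega>"
        and leV: "min 1 ((V n j \<omega> - Y j \<omega>)\<^sup>2) \<le> D n \<omega>" for n
        using le[of n] nonneg[of "U n j \<omega> - X j \<omega>"] nonneg[of "V n j \<omega> - Y j \<omega>"]
        by linarith+
      have "(\<lambda>n. min 1 ((U (r n) j \<omega> - X j \<omega>)\<^sup>2)) \<longlonglongrightarrow> 0"
        by (rule tendsto_sandwich[OF _ _ tendsto_const elim]) (rule always_eventually allI nonneg leU)+
      moreover have "(\<lambda>n. min 1 ((V (r n) j \<omega> - Y j \<omega>)\<^sup>2)) \<longlonglongrightarrow> 0"
        by (rule tendsto_sandwich[OF _ _ tendsto_const elim]) (rule always_eventually allI nonneg leV)+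
      ultimately show "(\<lambda>n. U (r n) j \<omega>) \<longlonglongrightarrow> X j \<omega> \<and> (\<lambda>n. V (r n) j \<omega>) \<longlonglongrightarrow> Y j \<omega>"
        by (rule conjI[OF sq sq])
    qed
  qed
  \<comment> \<open>For \<open>m > 0\<close> this is 1 on the negative half-line, 0 beyond
    \<open>1 / m\<close> and linear in between; it decreases to the indicator of
    \<open>{..0}\<close>.\<close>
  define \<phi> where "\<phi> m x = max 0 (min 1 (1 - real m * x))" for m x
  define \<Psi> where "\<Psi> m z = (\<Prod>j\<in>J. \<phi> m (z j - a j))" for m z
  have \<phi>01: "0 \<le> \<phi> m x" "\<phi> m x \<le> 1" for m x by (auto simp: \<phi>_def)
  have \<Psi>01: "norm (\<Psi> m z) \<le> 1" for m z
    unfolding \<Psi>_def by (simp add: abs_prod) (intro prod_le_1, auto simp: \<phi>01)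
  have \<phi>_cont: "continuous_on UNIV (\<phi> m)" for m
    unfolding \<phi>_def by (intro continuous_intros)
  have \<phi>_meas[measurable]: "\<phi> m \<in> borel_measurable borel" for m
    by (rule borel_measurable_continuous_onI[OF \<phi>_cont])
  have [measurable]: "\<Psi> m \<in> borel_measurable (\<Pi>\<^sub>M j\<in>J. borel)" for m
    unfolding \<Psi>_def by measurable
  have first: "(\<lambda>n. \<integral>\<omega>. \<Psi> m (\<lambda>j\<in>J. U' (r n) j \<omega>) \<partial>M) \<longlonglongrightarrow> (\<integral>\<omega>. \<Psi> m (\<lambda>j\<in>J. X' j \<omega>) \<partial>M)"
    if [measurable]: "\<And>j n. j \<in> J \<Longrightarrow> U' n j \<in> borel_measurable M" "\<And>j. j \<in> J \<Longrightarrow> X' j \<in> borel_measurable M"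
      and lim': "AE \<omega> in M. \<forall>j\<in>J. (\<lambda>n. U' (r n) j \<omega>) \<longlonglongrightarrow> X' j \<omega>" for U' X' m
  proof (rule integral_dominated_convergence[where w = "\<lambda>_. 1"])
    show "AE \<omega> in M. (\<lambda>n. \<Psi> m (\<lambda>j\<in>J. U' (r n) j \<omega>)) \<longlonglongrightarrow> \<Psi> m (\<lambda>j\<in>J. X' j \<omega>)"
      using lim'
    proof eventually_elim
      case (elim \<omega>)
      have "(\<lambda>n. \<phi> m (U' (r n) j \<omega> - a j)) \<longlonglongrightarrow> \<phi> m (X' j \<omega> - a j)" if "j \<in> J" for j
        using elim that unfolding \<phi>_def by (intro tendsto_intros) blast
      then show ?case unfolding \<Psi>_def by (intro tendsto_prod) simp
    qed
  qed (use \<Psi>01 in auto)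
  have EUV: "(\<integral>\<omega>. \<Psi> m (\<lambda>j\<in>J. U n j \<omega>) \<partial>M) = (\<integral>\<omega>. \<Psi> m (\<lambda>j\<in>J. V n j \<omega>) \<partial>M)" for n m
  proof -
    have mU: "(\<lambda>\<omega>. \<lambda>j\<in>J. U n j \<omega>) \<in> M \<rightarrow>\<^sub>M (\<Pi>\<^sub>M j\<in>J. borel)"
      and mV: "(\<lambda>\<omega>. \<lambda>j\<in>J. V n j \<omega>) \<in> M \<rightarrow>\<^sub>M (\<Pi>\<^sub>M j\<in>J. borel)"
      by (intro measurable_restrict U V; assumption)+
    have "(\<integral>\<omega>. \<Psi> m (\<lambda>j\<in>J. U n j \<omega>) \<partial>M) = (\<integral>z. \<Psi> m z \<partial>distr M (\<Pi>\<^sub>M j\<in>J. borel) (\<lambda>\<omega>. \<lambda>j\<in>J. U n j \<omega>))"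
      by (rule integral_distr[OF mU, symmetric]) measurable
    also have "\<dots> = (\<integral>\<omega>. \<Psi> m (\<lambda>j\<in>J. V n j \<omega>) \<partial>M)"
      unfolding eq by (rule integral_distr[OF mV]) measurable
    finally show ?thesis .
  qed
  have \<Psi>_eq: "(\<integral>\<omega>. \<Psi> m (\<lambda>j\<in>J. X j \<omega>) \<partial>M) = (\<integral>\<omega>. \<Psi> m (\<lambda>j\<in>J. Y j \<omega>) \<partial>M)" for m
  proof (rule LIMSEQ_unique)
    show "(\<lambda>n. \<integral>\<omega>. \<Psi> m (\<lambda>j\<in>J. U (r n) j \<omega>) \<partial>M) \<longlonglongrightarrow> (\<integral>\<omega>. \<Psi> m (\<lambda>j\<in>J. X j \<omega>) \<partial>M)"
      using lim by (intro first) (auto elim!: eventually_mono)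
    have "(\<lambda>n. \<integral>\<omega>. \<Psi> m (\<lambda>j\<in>J. V (r n) j \<omega>) \<partial>M) \<longlonglongrightarrow> (\<integral>\<omega>. \<Psi> m (\<lambda>j\<in>J. Y j \<omega>) \<partial>M)"
      using lim by (intro first) (auto elim!: eventually_mono)
    then show "(\<lambda>n. \<integral>\<omega>. \<Psi> m (\<lambda>j\<in>J. U (r n) j \<omega>) \<partial>M) \<longlonglongrightarrow> (\<integral>\<omega>. \<Psi> m (\<lambda>j\<in>J. Y j \<omega>) \<partial>M)"
      by (simp only: EUV)
  qed
  have second: "(\<lambda>m. \<integral>\<omega>. \<Psi> m (\<lambda>j\<in>J. Z j \<omega>) \<partial>M) \<longlonglongrightarrow> measure M {\<omega> \<in> space M. \<forall>j\<in>J. Z j \<omega> \<le> a j}"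
    if [measurable]: "\<And>j. j \<in> J \<Longrightarrow> Z j \<in> borel_measurable M" for Z
  proof -
    have S[measurable]: "{\<omega> \<in> space M. \<forall>j\<in>J. Z j \<omega> \<le> a j} \<in> sets M"
      using J by measurable
    have \<phi>_lim: "(\<lambda>m. \<phi> m x) \<longlonglongrightarrow> (if x \<le> 0 then 1 else 0)" for x
    proof (cases "x \<le> 0")
      case True
      then have "\<phi> m x = 1" for m by (simp add: \<phi>_def mult_nonneg_nonpos)
      then show ?thesis using True by simp
    next
      case False
      then obtain N where N: "1 / x \<le> real N" using real_arch_simple by blast
      have "\<phi> m x = 0" if "m \<ge> N" for m
      proof -
        have "1 / x \<le> real m" using N that by linarith
        then have "1 \<le> real m * x" using False by (simp add: field_simps)
        then show ?thesis by (simp add: \<phi>_def)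
      qed
      then have "\<forall>\<^sub>F m in sequentially. \<phi> m x = 0" unfolding eventually_sequentially by blast
      then show ?thesis using False by (simp add: tendsto_eventually)
    qed
    have "(\<lambda>m. \<integral>\<omega>. \<Psi> m (\<lambda>j\<in>J. Z j \<omega>) \<partial>M) \<longlonglongrightarrow> (\<integral>\<omega>. indicator {\<omega> \<in> space M. \<forall>j\<in>J. Z j \<omega> \<le> a j} \<omega> \<partial>M)"
    proof (rule integral_dominated_convergence[where w = "\<lambda>_. 1"])
      show "AE \<omega> in M. (\<lambda>m. \<Psi> m (\<lambda>j\<in>J. Z j \<omega>)) \<longlonglongrightarrow> indicator {\<omega> \<in> space M. \<forall>j\<in>J. Z j \<omega> \<le> a j} \<omega>"
      proof (rule AE_I2)
        fix \<omega> assume \<omega>: "\<omega> \<in> space M"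
        have "(\<lambda>m. \<Psi> m (\<lambda>j\<in>J. Z j \<omega>)) \<longlonglongrightarrow> (\<Prod>j\<in>J. if Z j \<omega> - a j \<le> 0 then 1 else 0)"
          unfolding \<Psi>_def by (intro tendsto_prod) (simp only: restrict_apply if_True \<phi>_lim)
        also have "(\<Prod>j\<in>J. if Z j \<omega> - a j \<le> 0 then 1 else 0 :: real) = indicator {\<omega> \<in> space M. \<forall>j\<in>J. Z j \<omega> \<le> a j} \<omega>"
        proof (cases "\<forall>j\<in>J. Z j \<omega> \<le> a j")
          case True
          then show ?thesis using \<omega> by simp
        next
          case False
          then have "(\<Prod>j\<in>J. if Z j \<omega> - a j \<le> 0 then 1 else 0 :: real) = 0"
            using J by (auto intro!: prod_zero)
          then show ?thesis using False by simp
        qed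
        finally show "(\<lambda>m. \<Psi> m (\<lambda>j\<in>J. Z j \<omega>)) \<longlonglongrightarrow> indicator {\<omega> \<in> space M. \<forall>j\<in>J. Z j \<omega> \<le> a j} \<omega>" .
      qed
    qed (use \<Psi>01 in auto)
    then show ?thesis by simp
  qed
  show "measure M {\<omega> \<in> space M. \<forall>j\<in>J. X j \<omega> \<le> a j} = measure M {\<omega> \<in> space M. \<forall>j\<in>J. Y j \<omega> \<le> a j}"
    using LIMSEQ_unique[OF second[OF X]] second[OF Y] by (simp only: \<Psi>_eq)
qed

end

section \<open>Stable stochastic integrals\<close>

lemma integral_measure_preserving:
  fixes f :: "'a \<Rightarrow> 'b::{banach, second_countable_topology}"
  assumes \<sigma>: "\<sigma> \<in> \<mu> \<rightarrow>\<^sub>M \<mu>" and inv: "distr \<mu> \<mu> \<sigma> = \<mu>" and f: "f \<in> borel_measurable \<mu>"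
  shows "(\<integral>x. f (\<sigma> x) \<partial>\<mu>) = (\<integral>x. f x \<partial>\<mu>)"
  using integral_distr[OF \<sigma> f] by (simp add: inv)

lemma L_space_measure_preserving:
  assumes \<sigma>: "\<sigma> \<in> \<mu> \<rightarrow>\<^sub>M \<mu>" and inv: "distr \<mu> \<mu> \<sigma> = \<mu>" and f: "f \<in> L_space \<mu> \<alpha>"
  shows "f \<circ> \<sigma> \<in> L_space \<mu> \<alpha>"
proof -
  have "f \<in> borel_measurable \<mu>" "integrable (distr \<mu> \<mu> \<sigma>) (\<lambda>x. \<bar>f x\<bar> powr \<alpha>)"
    using f by (simp_all add: L_space_def inv)
  then show ?thesis
    using \<sigma> by (simp add: L_space_def integrable_distr_eq measurable_comp)
qed

lemma AE_measure_preserving: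
  assumes \<sigma>: "\<sigma> \<in> \<mu> \<rightarrow>\<^sub>M \<mu>" and inv: "distr \<mu> \<mu> \<sigma> = \<mu>" and P: "AE x in \<mu>. P x"
  shows "AE x in \<mu>. P (\<sigma> x)"
proof -
  obtain N where N: "{x \<in> space \<mu>. \<not> P x} \<subseteq> N" "emeasure \<mu> N = 0" "N \<in> sets \<mu>"
    using P by (rule AE_E)
  have "AE x in \<mu>. \<sigma> x \<notin> N"
  proof (rule AE_I)
    show "emeasure \<mu> (\<sigma> -` N \<inter> space \<mu>) = 0"
      using N emeasure_distr[OF \<sigma> N(3)] by (simp add: inv)
    show "\<sigma> -` N \<inter> space \<mu> \<in> sets \<mu>" using \<sigma> N(3) by (rule measurable_sets)
  qed auto
  then show ?thesis
    using N(1) measurable_space[OF \<sigma>] by (auto elim!: AE_mp)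
qed

lemma measure_measure_preserving:
  assumes \<sigma>: "\<sigma> \<in> \<mu> \<rightarrow>\<^sub>M \<mu>" and inv: "distr \<mu> \<mu> \<sigma> = \<mu>" and A: "A \<in> sets \<mu>"
  shows "measure \<mu> (\<sigma> -` A \<inter> space \<mu>) = measure \<mu> A"
  using measure_distr[OF \<sigma> A] by (simp add: inv)

locale stable_space = P: prob_space P + M: prob_space \<mu>
  for P :: "'w measure" and \<mu> :: "'a measure" +
  fixes \<alpha> :: real and W :: "'a set \<Rightarrow> 'w \<Rightarrow> real"
  assumes stable: "stable_random_measure P \<mu> \<alpha> W" and \<alpha>: "0 < \<alpha>" "\<alpha> \<le> 2"
begin

abbreviation "S \<equiv> simple_stable_integral \<mu> W"
abbreviation "SI \<equiv> stable_integral P \<mu> \<alpha> W"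

abbreviation "Lp_dist u f \<equiv> (\<integral>x. \<bar>u x - f x\<bar> powr \<alpha> \<partial>\<mu>)"

lemma W_measurable[measurable]: "A \<in> sets \<mu> \<Longrightarrow> W A \<in> borel_measurable P"
  and W_char: "A \<in> sets \<mu> \<Longrightarrow> char (distr P borel (W A)) u = complex_of_real (exp (- (\<bar>u\<bar> powr \<alpha> * measure \<mu> A)))"
  using stable by (auto simp: stable_random_measure_def)

lemma W_sums:
  fixes A :: "nat \<Rightarrow> 'a set"
  assumes "range A \<subseteq> sets \<mu>" "disjoint_family A"
  shows "AE \<omega> in P. (\<lambda>n. W (A n) \<omega>) sums W (\<Union>n. A n) \<omega>"
    and "P.indep_vars (\<lambda>_. borel) (\<lambda>n. W (A n)) UNIV"
  using stable assms by (auto simp: stable_random_measure_def)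

text \<open>Additivity along a sequence of empty sets gives a convergent series with constant terms,
  which must vanish.\<close>

lemma W_empty: "AE \<omega> in P. W {} \<omega> = 0"
proof -
  have "AE \<omega> in P. (\<lambda>n::nat. W {} \<omega>) sums W (\<Union>n::nat. {}) \<omega>"
    by (rule W_sums) (auto simp: disjoint_family_on_def)
  then show ?thesis
    by eventually_elim (auto dest: sums_summable simp: summable_const_iff)
qed

text \<open>Padding by empty sets turns a finite family into a sequence, the form in which
  additivity and independence are given.\<close>

lemma W_finite_Union:
  fixes B :: "nat \<Rightarrow> 'a set"
  assumes N: "finite N" and B: "\<And>n. n \<in> N \<Longrightarrow> B n \<in> sets \<mu>" and disj: "disjoint_family_on B N"
  shows "AE \<omega> in P. W (\<Union>n\<in>N. B n) \<omega> = (\<Sum>n\<in>N. W (B n) \<omega>)"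
    and "P.indep_vars (\<lambda>_. borel) (\<lambda>n. W (B n)) N"
proof -
  define A where "A n = (if n \<in> N then B n else {})" for n
  have A: "range A \<subseteq> sets \<mu>" "disjoint_family A"
    using B disj by (auto simp: A_def disjoint_family_on_def)
  have Un: "(\<Union>n. A n) = (\<Union>n\<in>N. B n)" by (auto simp: A_def)
  show "AE \<omega> in P. W (\<Union>n\<in>N. B n) \<omega> = (\<Sum>n\<in>N. W (B n) \<omega>)"
    using W_sums(1)[OF A] W_empty
  proof eventually_elim
    case (elim \<omega>)
    have "(\<lambda>n. W (A n) \<omega>) sums (\<Sum>n\<in>N. W (A n) \<omega>)"
      using elim(2) N by (intro sums_finite) (auto simp: A_def)
    then have "W (\<Union>n\<in>N. B n) \<omega> = (\<Sum>n\<in>N. W (A n) \<omega>)"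
      using elim(1) sums_unique2 unfolding Un by blast
    then show ?case by (simp add: A_def)
  qed
  have "P.indep_vars (\<lambda>_. borel) (\<lambda>n. W (A n)) N"
    by (rule P.indep_vars_subset[OF W_sums(2)[OF A]]) simp
  then show "P.indep_vars (\<lambda>_. borel) (\<lambda>n. W (B n)) N"
    by (rule P.indep_vars_cong[THEN iffD1, rotated 3]) (auto simp: A_def)
qed

section \<open>Integrals of simple functions\<close>

lemma S_measurable[measurable]:
  assumes "simple_function \<mu> u"
  shows "S u \<in> borel_measurable P"
  unfolding simple_stable_integral_def using assms
  by (intro borel_measurable_sum borel_measurable_times W_measurable) (auto dest: simple_functionD(2))

text \<open>The partition into level sets of a common refinement \<open>h\<close> is enumerated by \<open>{..<k}\<close>, because
  independence is only assumed for sequences of sets.\<close>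

lemma S_compose:
  assumes h: "simple_function \<mu> h" and e: "bij_betw e {..<k::nat} (h ` space \<mu>)"
  shows "AE \<omega> in P. S (\<lambda>x. g (h x)) \<omega> = (\<Sum>n<k. g (e n) * W (h -` {e n} \<inter> space \<mu>) \<omega>)"
proof -
  define B where "B n = h -` {e n} \<inter> space \<mu>" for n
  \<comment> \<open>\<open>g\<close> may take one value on several pieces; \<open>N c\<close> groups
    the pieces on which the value is \<open>c\<close>.\<close>
  define N where "N c = {n \<in> {..<k}. g (e n) = c}" for c
  have range: "e ` {..<k} = h ` space \<mu>" and inj: "inj_on e {..<k}"
    using e by (auto simp: bij_betw_def)
  have B: "B n \<in> sets \<mu>" for n
    unfolding B_def using h by (rule simple_functionD(2))
  have disj: "disjoint_family_on B (N c)" for c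
    using inj by (auto simp: disjoint_family_on_def B_def N_def inj_on_def)
  have Un: "(\<lambda>x. g (h x)) -` {c} \<inter> space \<mu> = (\<Union>n\<in>N c. B n)" for c
  proof (intro set_eqI iffI)
    fix x assume x: "x \<in> (\<lambda>x. g (h x)) -` {c} \<inter> space \<mu>"
    then have "h x \<in> e ` {..<k}" unfolding range by blast
    then obtain n where "n < k" "h x = e n" by blast
    then show "x \<in> (\<Union>n\<in>N c. B n)" using x by (auto simp: N_def B_def)
  qed (auto simp: N_def B_def)
  have fin: "finite ((\<lambda>x. g (h x)) ` space \<mu>)"
    using finite_imageI[OF simple_functionD(1)[OF h], of g] by (simp add: image_image)
  have "AE \<omega> in P. W (\<Union>n\<in>N c. B n) \<omega> = (\<Sum>n\<in>N c. W (B n) \<omega>)" for c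
    by (rule W_finite_Union(1)) (use B disj in \<open>auto simp: N_def\<close>)
  then have "AE \<omega> in P. \<forall>c\<in>(\<lambda>x. g (h x)) ` space \<mu>. W (\<Union>n\<in>N c. B n) \<omega> = (\<Sum>n\<in>N c. W (B n) \<omega>)"
    using fin by (intro AE_finite_allI)
  then show ?thesis
  proof eventually_elim
    case (elim \<omega>)
    have "S (\<lambda>x. g (h x)) \<omega> = (\<Sum>c\<in>(\<lambda>x. g (h x)) ` space \<mu>. c * W (\<Union>n\<in>N c. B n) \<omega>)"
      unfolding simple_stable_integral_def Un ..
    also have "\<dots> = (\<Sum>c\<in>(\<lambda>x. g (h x)) ` space \<mu>. \<Sum>n\<in>N c. g (e n) * W (B n) \<omega>)"
    proof (rule sum.cong[OF refl])
      fix c assume "c \<in> (\<lambda>x. g (h x)) ` space \<mu>"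
      from bspec[OF elim this] have "c * W (\<Union>n\<in>N c. B n) \<omega> = (\<Sum>n\<in>N c. c * W (B n) \<omega>)"
        by (simp only: sum_distrib_left)
      also have "\<dots> = (\<Sum>n\<in>N c. g (e n) * W (B n) \<omega>)"
        by (rule sum.cong) (auto simp: N_def)
      finally show "c * W (\<Union>n\<in>N c. B n) \<omega> = (\<Sum>n\<in>N c. g (e n) * W (B n) \<omega>)" .
    qed
    also have "\<dots> = (\<Sum>n<k. g (e n) * W (B n) \<omega>)"
      unfolding N_def
    proof (rule sum.group)
      show "(\<lambda>n. g (e n)) ` {..<k} \<subseteq> (\<lambda>x. g (h x)) ` space \<mu>"
      proof
        fix c assume "c \<in> (\<lambda>n. g (e n)) ` {..<k}"
        then obtain n where "n < k" "c = g (e n)" by blast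
        moreover from this have "e n \<in> h ` space \<mu>" unfolding range[symmetric] by blast
        ultimately show "c \<in> (\<lambda>x. g (h x)) ` space \<mu>" by auto
      qed
    qed (use fin in auto)
    finally show ?case by (simp add: B_def)
  qed
qed

lemma simple_enumeration:
  assumes "simple_function \<mu> h"
  obtains e and k :: nat where "bij_betw e {..<k} (h ` space \<mu>)"
  using ex_bij_betw_nat_finite[OF simple_functionD(1)[OF assms]] by (auto simp: atLeast0LessThan)

lemma simple_level_sets:
  assumes h: "simple_function \<mu> h" and e: "bij_betw e {..<k::nat} (h ` space \<mu>)"
  shows "disjoint_family_on (\<lambda>n. h -` {e n} \<inter> space \<mu>) {..<k}"
    and "h -` {e n} \<inter> space \<mu> \<in> sets \<mu>"
  using e simple_functionD(2)[OF h] by (auto simp: disjoint_family_on_def bij_betw_def inj_on_def)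

text \<open>The level sets of the pair \<open>(u, v)\<close> refine those of all three functions.
  The equality is only almost sure because \<open>W\<close> is additive only almost surely.\<close>

lemma S_diff:
  assumes u: "simple_function \<mu> u" and v: "simple_function \<mu> v"
  shows "AE \<omega> in P. S (\<lambda>x. u x - v x) \<omega> = S u \<omega> - S v \<omega>"
proof -
  let ?h = "\<lambda>x. (u x, v x)"
  have h: "simple_function \<mu> ?h" using u v by (rule simple_function_Pair)
  obtain e k where e: "bij_betw e {..<k::nat} (?h ` space \<mu>)" by (rule simple_enumeration[OF h])
  show ?thesis
    using S_compose[OF h e, of "\<lambda>p. fst p - snd p"] S_compose[OF h e, of fst] S_compose[OF h e, of snd]
    by eventually_elim (simp add: sum_subtractf left_diff_distrib)
qed

text \<open>On the level sets the integral is almost surely a sum of independent stable variables,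
  so the exponents of their characteristic functions add up to an integral.\<close>

lemma S_char:
  assumes u: "simple_function \<mu> u"
  shows "char (distr P borel (S u)) t = complex_of_real (exp (- (\<bar>t\<bar> powr \<alpha> * (\<integral>x. \<bar>u x\<bar> powr \<alpha> \<partial>\<mu>))))"
proof -
  obtain e k where e: "bij_betw e {..<k::nat} (u ` space \<mu>)" by (rule simple_enumeration[OF u])
  define B where "B n = u -` {e n} \<inter> space \<mu>" for n
  have B[measurable]: "B n \<in> sets \<mu>" and disj: "disjoint_family_on B {..<k}" for n
    unfolding B_def using simple_level_sets[OF u e] by auto
  have "AE \<omega> in P. S u \<omega> = (\<Sum>n<k. e n * W (B n) \<omega>)"
    using S_compose[OF u e, of "\<lambda>c. c"] by (simp add: B_def)
  then have "distr P borel (S u) = distr P borel (\<lambda>\<omega>. \<Sum>n<k. e n * W (B n) \<omega>)"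
    using u by (intro distr_cong_AE) auto
  moreover have "P.indep_vars (\<lambda>_. borel) (\<lambda>n. W (B n)) {..<k}"
    by (rule W_finite_Union(2)) (use B disj in auto)
  then have "P.indep_vars (\<lambda>_. borel) (\<lambda>n \<omega>. e n * W (B n) \<omega>) {..<k}"
    by (rule P.indep_vars_compose2) measurable
  ultimately have "char (distr P borel (S u)) t = (\<Prod>n<k. char (distr P borel (\<lambda>\<omega>. e n * W (B n) \<omega>)) t)"
    by (simp only: P.char_distr_sum)
  also have "\<dots> = (\<Prod>n<k. char (distr P borel (W (B n))) (t * e n))"
    by (intro prod.cong refl) (simp add: P.char_distr_eq mult.assoc)
  also have "\<dots> = complex_of_real (exp (\<Sum>n<k. - (\<bar>t * e n\<bar> powr \<alpha> * measure \<mu> (B n))))"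
    by (simp add: W_char exp_sum)
  also have "(\<Sum>n<k. - (\<bar>t * e n\<bar> powr \<alpha> * measure \<mu> (B n))) = - (\<bar>t\<bar> powr \<alpha> * (\<Sum>n<k. \<bar>e n\<bar> powr \<alpha> * measure \<mu> (B n)))"
    by (simp add: sum_distrib_left sum_negf abs_mult powr_mult mult.assoc)
  also have "(\<Sum>n<k. \<bar>e n\<bar> powr \<alpha> * measure \<mu> (B n)) = (\<integral>x. \<bar>u x\<bar> powr \<alpha> \<partial>\<mu>)"
  proof -
    have "(\<integral>x. \<bar>u x\<bar> powr \<alpha> \<partial>\<mu>) = (\<integral>x. (\<Sum>n<k. \<bar>e n\<bar> powr \<alpha> * indicator (B n) x) \<partial>\<mu>)"
    proof (rule Bochner_Integration.integral_cong[OF refl])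
      fix x assume x: "x \<in> space \<mu>"
      then have "u x \<in> e ` {..<k}" using bij_betw_imp_surj_on[OF e] by simp
      then obtain m where m: "m < k" "u x = e m" by blast
      have "indicator (B n) x = (if n = m then 1 else 0 :: real)" if "n < k" for n
        using m x e that by (auto simp: B_def indicator_def bij_betw_def inj_on_def)
      then have "(\<Sum>n<k. \<bar>e n\<bar> powr \<alpha> * indicator (B n) x) = (\<Sum>n<k. if n = m then \<bar>e n\<bar> powr \<alpha> else 0)"
        by (intro sum.cong) auto
      also have "\<dots> = \<bar>u x\<bar> powr \<alpha>" using m by simp
      finally show "\<bar>u x\<bar> powr \<alpha> = (\<Sum>n<k. \<bar>e n\<bar> powr \<alpha> * indicator (B n) x)" ..
    qed
    also have "\<dots> = (\<Sum>n<k. \<bar>e n\<bar> powr \<alpha> * measure \<mu> (B n))"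
      by (subst Bochner_Integration.integral_sum) (auto intro!: integrable_mult_right integrable_real_indicator simp: less_top[symmetric])
    finally show ?thesis ..
  qed
  finally show ?thesis .
qed

text \<open>The continuity estimate by which the integral extends from simple functions to
  L^\<alpha>.\<close>

lemma trunc_moment_S_diff:
  assumes u: "simple_function \<mu> u" and v: "simple_function \<mu> v"
  shows "P.trunc_moment (\<lambda>\<omega>. S u \<omega> - S v \<omega>) \<le> 8 * (Lp_dist u v)"
proof -
  have d: "simple_function \<mu> (\<lambda>x. u x - v x)" using u v by (rule simple_function_diff)
  have "P.trunc_moment (\<lambda>\<omega>. S u \<omega> - S v \<omega>) = P.trunc_moment (S (\<lambda>x. u x - v x))"
    using S_diff[OF u v] u v d by (intro P.trunc_moment_cong_AE) auto
  also have "\<dots> \<le> 8 * (Lp_dist u v)"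
    by (rule P.trunc_moment_le_scale[OF S_measurable[OF d] \<alpha> _ S_char[OF d]]) simp
  finally show ?thesis .
qed

section \<open>Extension of the integral from simple functions to L^\<alpha>\<close>

lemma powr_add_le: "\<bar>a + b\<bar> powr \<alpha> \<le> 4 * (\<bar>a\<bar> powr \<alpha> + \<bar>b\<bar> powr \<alpha>)" for a b :: real
proof -
  have "\<bar>a + b\<bar> powr \<alpha> \<le> (2 * max \<bar>a\<bar> \<bar>b\<bar>) powr \<alpha>"
    using \<alpha> by (intro powr_mono2) auto
  also have "\<dots> = 2 powr \<alpha> * max \<bar>a\<bar> \<bar>b\<bar> powr \<alpha>"
    by (simp add: powr_mult)
  \<comment> \<open>The constant 4 bounds \<open>2 powr \<alpha>\<close> on the whole range of
    \<alpha>, below and above 1.\<close>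
  also have "\<dots> \<le> 2 powr 2 * (\<bar>a\<bar> powr \<alpha> + \<bar>b\<bar> powr \<alpha>)"
    using \<alpha> by (intro mult_mono powr_mono) (auto simp: max_def)
  finally show ?thesis by simp
qed

lemma L_space_simple: "simple_function \<mu> u \<Longrightarrow> u \<in> L_space \<mu> \<alpha>"
proof -
  assume u: "simple_function \<mu> u"
  then have [measurable]: "u \<in> borel_measurable \<mu>" by (rule borel_measurable_simple_function)
  have "finite ((\<lambda>x. \<bar>u x\<bar> powr \<alpha>) ` space \<mu>)"
    using finite_imageI[OF simple_functionD(1)[OF u], of "\<lambda>c. \<bar>c\<bar> powr \<alpha>"] by (simp add: image_image)
  then have "\<bar>u x\<bar> powr \<alpha> \<le> Max ((\<lambda>x. \<bar>u x\<bar> powr \<alpha>) ` space \<mu>)" if "x \<in> space \<mu>" for x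
    using that by simp
  then have "integrable \<mu> (\<lambda>x. \<bar>u x\<bar> powr \<alpha>)"
    by (intro M.integrable_const_bound[of _ "Max ((\<lambda>x. \<bar>u x\<bar> powr \<alpha>) ` space \<mu>)"]) auto
  then show ?thesis by (simp add: L_space_def)
qed

lemma L_space_diff:
  assumes f: "f \<in> L_space \<mu> \<alpha>" and g: "g \<in> L_space \<mu> \<alpha>"
  shows "(\<lambda>x. f x - g x) \<in> L_space \<mu> \<alpha>"
    and "(Lp_dist f g) \<le> 4 * (\<integral>x. \<bar>f x\<bar> powr \<alpha> \<partial>\<mu>) + 4 * (\<integral>x. \<bar>g x\<bar> powr \<alpha> \<partial>\<mu>)"
proof -
  have [measurable]: "f \<in> borel_measurable \<mu>" "g \<in> borel_measurable \<mu>"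
    and int: "integrable \<mu> (\<lambda>x. \<bar>f x\<bar> powr \<alpha>)" "integrable \<mu> (\<lambda>x. \<bar>g x\<bar> powr \<alpha>)"
    using f g by (auto simp: L_space_def)
  have le: "\<bar>f x - g x\<bar> powr \<alpha> \<le> 4 * (\<bar>f x\<bar> powr \<alpha> + \<bar>g x\<bar> powr \<alpha>)" for x
    using powr_add_le[of "f x" "- g x"] by simp
  have "integrable \<mu> (\<lambda>x. \<bar>f x - g x\<bar> powr \<alpha>)"
    by (rule Bochner_Integration.integrable_bound[where f = "\<lambda>x. 4 * (\<bar>f x\<bar> powr \<alpha> + \<bar>g x\<bar> powr \<alpha>)"])
       (use int le in auto)
  then show "(\<lambda>x. f x - g x) \<in> L_space \<mu> \<alpha>" by (simp add: L_space_def)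
  have "(Lp_dist f g) \<le> (\<integral>x. 4 * (\<bar>f x\<bar> powr \<alpha> + \<bar>g x\<bar> powr \<alpha>) \<partial>\<mu>)"
    by (rule integral_mono) (use int le \<open>integrable \<mu> (\<lambda>x. \<bar>f x - g x\<bar> powr \<alpha>)\<close> in auto)
  then show "(Lp_dist f g) \<le> 4 * (\<integral>x. \<bar>f x\<bar> powr \<alpha> \<partial>\<mu>) + 4 * (\<integral>x. \<bar>g x\<bar> powr \<alpha> \<partial>\<mu>)"
    using int by (simp add: distrib_left)
qed

lemma simple_approximation:
  assumes f: "f \<in> L_space \<mu> \<alpha>"
  shows "\<exists>u. (\<forall>n. simple_function \<mu> (u n)) \<and> (\<lambda>n. Lp_dist (u n) f) \<longlonglongrightarrow> 0"
proof -
  have [measurable]: "f \<in> borel_measurable \<mu>" and int: "integrable \<mu> (\<lambda>x. \<bar>f x\<bar> powr \<alpha>)"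
    using f by (auto simp: L_space_def)
  from borel_measurable_implies_sequence_metric[OF this(1), of 0]
  obtain u where u: "\<And>n. simple_function \<mu> (u n)" "\<And>x. x \<in> space \<mu> \<Longrightarrow> (\<lambda>n. u n x) \<longlonglongrightarrow> f x"
    "\<And>n x. x \<in> space \<mu> \<Longrightarrow> dist (u n x) 0 \<le> 2 * dist (f x) 0" by blast
  have [measurable]: "u n \<in> borel_measurable \<mu>" for n using u(1) by (rule borel_measurable_simple_function)
  have "(\<lambda>n. Lp_dist (u n) f) \<longlonglongrightarrow> (\<integral>x. 0 \<partial>\<mu>)"
  \<comment> \<open>The approximants satisfy \<open>|u n x| \<le> 2 * |f x|\<close>, hence
    \<open>|u n x - f x| \<le> 3 * |f x|\<close>.\<close>
  proof (rule integral_dominated_convergence[where w = "\<lambda>x. 3 powr \<alpha> * \<bar>f x\<bar> powr \<alpha>"])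
    show "integrable \<mu> (\<lambda>x. 3 powr \<alpha> * \<bar>f x\<bar> powr \<alpha>)" using int by simp
    show "AE x in \<mu>. (\<lambda>n. \<bar>u n x - f x\<bar> powr \<alpha>) \<longlonglongrightarrow> 0"
    proof (rule AE_I2)
      fix x assume "x \<in> space \<mu>"
      then have "(\<lambda>n. \<bar>u n x - f x\<bar>) \<longlonglongrightarrow> 0"
        using u(2) by (simp add: tendsto_rabs_zero_iff LIM_zero_iff)
      then show "(\<lambda>n. \<bar>u n x - f x\<bar> powr \<alpha>) \<longlonglongrightarrow> 0"
        using tendsto_zero_powrI[of "\<lambda>n. \<bar>u n x - f x\<bar>" sequentially "\<lambda>_. \<alpha>" \<alpha>] \<alpha> by simp
    qed
    show "AE x in \<mu>. norm (\<bar>u n x - f x\<bar> powr \<alpha>) \<le> 3 powr \<alpha> * \<bar>f x\<bar> powr \<alpha>" for n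
    proof (rule AE_I2)
      fix x assume "x \<in> space \<mu>"
      then have "\<bar>u n x - f x\<bar> \<le> 3 * \<bar>f x\<bar>" using u(3)[of x n] by simp
      then have "\<bar>u n x - f x\<bar> powr \<alpha> \<le> (3 * \<bar>f x\<bar>) powr \<alpha>" using \<alpha> by (intro powr_mono2) auto
      then show "norm (\<bar>u n x - f x\<bar> powr \<alpha>) \<le> 3 powr \<alpha> * \<bar>f x\<bar> powr \<alpha>" by (simp add: powr_mult)
    qed
  qed auto
  then show ?thesis using u(1) by auto
qed

text \<open>The constant 32 is the 8 of the continuity estimate times the 4 of the quasi-triangle
  inequality.\<close>

lemma trunc_moment_S_diff_le:
  assumes u: "simple_function \<mu> u" and v: "simple_function \<mu> v" and f: "f \<in> L_space \<mu> \<alpha>"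
  shows "P.trunc_moment (\<lambda>\<omega>. S u \<omega> - S v \<omega>) \<le>
    32 * (Lp_dist u f) + 32 * (Lp_dist v f)"
proof -
  have "(\<integral>x. \<bar>(u x - f x) - (v x - f x)\<bar> powr \<alpha> \<partial>\<mu>) \<le>
      4 * (Lp_dist u f) + 4 * (Lp_dist v f)"
    by (intro L_space_diff L_space_simple u v f)
  then show ?thesis using trunc_moment_S_diff[OF u v] by simp
qed

text \<open>Justifies the choice in \<open>stable_integral\<close>: a fast approximating sequence
  has integrals that are Cauchy in probability.\<close>

lemma stable_integral_exists:
  assumes f: "f \<in> L_space \<mu> \<alpha>"
  shows "\<exists>Y. Y \<in> borel_measurable P \<and>
          (\<exists>u. (\<forall>n. simple_function \<mu> (u n)) \<and>
             (\<lambda>n. Lp_dist (u n) f) \<longlonglongrightarrow> 0 \<and>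
             (\<forall>e>0. (\<lambda>n. measure P {\<omega> \<in> space P. \<bar>S (u n) \<omega> - Y \<omega>\<bar> > e}) \<longlonglongrightarrow> 0))"
proof -
  obtain v where v: "\<And>n. simple_function \<mu> (v n)" "(\<lambda>n. Lp_dist (v n) f) \<longlonglongrightarrow> 0"
    using simple_approximation[OF f] by blast
  \<comment> \<open>Two consecutive errors enter with a factor 32 each, so \<open>1 / 64\<close>
    keeps the increments below \<open>(1 / 8) ^ n\<close>.\<close>
  have "\<exists>m. (Lp_dist (v m) f) \<le> (1 / 64) * (1 / 8) ^ n" for n
    using LIMSEQ_D[OF v(2), of "(1 / 64) * (1 / 8) ^ n"] by (auto intro: less_imp_le)
  then obtain m where m: "\<And>n. (\<integral>x. \<bar>v (m n) x - f x\<bar> powr \<alpha> \<partial>\<mu>) \<le> (1 / 64) * (1 / 8) ^ n"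
    by metis
  define u where "u n = v (m n)" for n
  have u: "simple_function \<mu> (u n)" for n by (simp add: u_def v)
  have nonneg: "0 \<le> (Lp_dist (u n) f)" for n by simp
  have "(\<lambda>n. (1 / 8 :: real) ^ n) \<longlonglongrightarrow> 0" by (rule LIMSEQ_power_zero) simp
  then have "(\<lambda>n. (1 / 64) * (1 / 8 :: real) ^ n) \<longlonglongrightarrow> 0"
    by (rule tendsto_mult_right_zero)
  from tendsto_sandwich[OF _ _ tendsto_const this]
  have lim: "(\<lambda>n. Lp_dist (u n) f) \<longlonglongrightarrow> 0"
    using m by (simp add: u_def)
  have "P.trunc_moment (\<lambda>\<omega>. S (u (Suc n)) \<omega> - S (u n) \<omega>) \<le> (1 / 8) ^ n" for n
  proof -
    have "(1 / 8 :: real) ^ Suc n \<le> (1 / 8) ^ n" by simp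
    then show ?thesis
      using trunc_moment_S_diff_le[OF u u f, of "Suc n" n] m[of n] m[of "Suc n"]
      unfolding u_def by linarith
  qed
  from P.trunc_moment_complete[OF S_measurable[OF u] this]
  obtain Y where Y[measurable]: "Y \<in> borel_measurable P" and "(\<lambda>n. P.trunc_moment (\<lambda>\<omega>. S (u n) \<omega> - Y \<omega>)) \<longlonglongrightarrow> 0"
    by blast
  moreover have "(\<lambda>\<omega>. S (u n) \<omega> - Y \<omega>) \<in> borel_measurable P" for n
    using S_measurable[OF u] Y by (rule borel_measurable_diff)
  ultimately have prob: "\<forall>e>0. (\<lambda>n. measure P {\<omega> \<in> space P. \<bar>S (u n) \<omega> - Y \<omega>\<bar> > e}) \<longlonglongrightarrow> 0"
    by (subst P.tendsto_measure_iff_trunc_moment)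
  show ?thesis
    by (intro exI[of _ Y] conjI exI[of _ u] Y lim prob) (simp add: u)
qed

lemma SI_measurable[measurable]: "SI f \<in> borel_measurable P"
proof (cases "f \<in> L_space \<mu> \<alpha>")
  case True
  show ?thesis
    unfolding stable_integral_def if_P[OF True]
    by (rule someI_ex[OF stable_integral_exists[OF True], THEN conjunct1])
qed (simp add: stable_integral_def)

text \<open>The choice supplies a single approximating sequence. Comparison with it extends the
  convergence to every approximating sequence, in particular to a reflected one.\<close>

lemma S_tendsto_SI:
  assumes f: "f \<in> L_space \<mu> \<alpha>" and u: "\<And>n. simple_function \<mu> (u n)"
    and lim: "(\<lambda>n. Lp_dist (u n) f) \<longlonglongrightarrow> 0"
  shows "(\<lambda>n. P.trunc_moment (\<lambda>\<omega>. S (u n) \<omega> - SI f \<omega>)) \<longlonglongrightarrow> 0"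
proof -
  have "\<exists>v. (\<forall>n. simple_function \<mu> (v n)) \<and> (\<lambda>n. Lp_dist (v n) f) \<longlonglongrightarrow> 0 \<and>
      (\<forall>e>0. (\<lambda>n. measure P {\<omega> \<in> space P. \<bar>S (v n) \<omega> - SI f \<omega>\<bar> > e}) \<longlonglongrightarrow> 0)"
    unfolding stable_integral_def if_P[OF f]
    by (rule someI_ex[OF stable_integral_exists[OF f], THEN conjunct2])
  then obtain v where v_all: "(\<forall>n. simple_function \<mu> (v n)) \<and> (\<lambda>n. Lp_dist (v n) f) \<longlonglongrightarrow> 0 \<and>
      (\<forall>e>0. (\<lambda>n. measure P {\<omega> \<in> space P. \<bar>S (v n) \<omega> - SI f \<omega>\<bar> > e}) \<longlonglongrightarrow> 0)" ..
  have v: "\<And>n. simple_function \<mu> (v n)" "(\<lambda>n. Lp_dist (v n) f) \<longlonglongrightarrow> 0"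
    and prob: "\<forall>e>0. (\<lambda>n. measure P {\<omega> \<in> space P. \<bar>S (v n) \<omega> - SI f \<omega>\<bar> > e}) \<longlonglongrightarrow> 0"
    using v_all by simp_all
  have "(\<lambda>\<omega>. S (v n) \<omega> - SI f \<omega>) \<in> borel_measurable P" for n
    using S_measurable[OF v(1)] SI_measurable by (rule borel_measurable_diff)
  from P.tendsto_measure_iff_trunc_moment[of "\<lambda>n \<omega>. S (v n) \<omega> - SI f \<omega>", OF this] prob
  have v_lim: "(\<lambda>n. P.trunc_moment (\<lambda>\<omega>. S (v n) \<omega> - SI f \<omega>)) \<longlonglongrightarrow> 0" by blast
  define b where "b n = 2 * (32 * (Lp_dist (u n) f) + 32 * (Lp_dist (v n) f)) +
      2 * P.trunc_moment (\<lambda>\<omega>. S (v n) \<omega> - SI f \<omega>)" for n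
  have "b \<longlonglongrightarrow> 2 * (32 * 0 + 32 * 0) + 2 * 0"
    unfolding b_def by (intro tendsto_add tendsto_mult tendsto_const lim v(2) v_lim)
  then have b: "b \<longlonglongrightarrow> 0" by simp
  have "P.trunc_moment (\<lambda>\<omega>. S (u n) \<omega> - SI f \<omega>) \<le> b n" for n
    unfolding b_def
    by (rule order_trans[OF P.trunc_moment_triangle[OF S_measurable[OF u[of n]] S_measurable[OF v(1)[of n]] SI_measurable[of f]]])
       (intro add_right_mono mult_left_mono trunc_moment_S_diff_le u v(1) f, simp)
  then show ?thesis
    by (intro tendsto_sandwich[OF _ _ tendsto_const b]) (simp_all add: P.trunc_moment_nonneg)
qed

text \<open>The integrals are equal as functions, not just almost surely: integrands that agree
  almost everywhere give the same predicate, and the choice depends on nothing else.\<close>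

lemma SI_cong_AE:
  assumes f: "f \<in> L_space \<mu> \<alpha>" and g: "g \<in> L_space \<mu> \<alpha>" and eq: "AE x in \<mu>. f x = g x"
  shows "SI f = SI g"
proof -
  have [measurable]: "f \<in> borel_measurable \<mu>" "g \<in> borel_measurable \<mu>"
    using f g by (auto simp: L_space_def)
  have "(Lp_dist u f) = (Lp_dist u g)" if "simple_function \<mu> u" for u
    using eq borel_measurable_simple_function[OF that] by (intro integral_cong_AE) auto
  then have "((\<forall>n. simple_function \<mu> (u n)) \<and> (\<lambda>n. Lp_dist (u n) f) \<longlonglongrightarrow> 0 \<and> Q) \<longleftrightarrow>
      ((\<forall>n. simple_function \<mu> (u n)) \<and> (\<lambda>n. Lp_dist (u n) g) \<longlonglongrightarrow> 0 \<and> Q)" for u Q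
    by auto
  then show ?thesis
    unfolding stable_integral_def using f g by simp
qed

text \<open>Agreement on the space also settles integrands outside \<open>L_space\<close>, where
  both integrals are 0 by default.\<close>

lemma SI_cong:
  assumes eq: "\<And>x. x \<in> space \<mu> \<Longrightarrow> f x = g x"
  shows "SI f = SI g"
proof -
  have iff: "f \<in> L_space \<mu> \<alpha> \<longleftrightarrow> g \<in> L_space \<mu> \<alpha>"
    unfolding L_space_def using eq by (simp cong: measurable_cong Bochner_Integration.integrable_cong)
  show ?thesis
  proof (cases "f \<in> L_space \<mu> \<alpha>")
    case True
    then show ?thesis using iff eq by (intro SI_cong_AE) auto
  next
    case False
    then show ?thesis using iff by (simp add: stable_integral_def)
  qed
qed

end

lemma L_space_cong:
  assumes "\<And>x. x \<in> space \<mu> \<Longrightarrow> f x = g x"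
  shows "f \<in> L_space \<mu> \<alpha> \<longleftrightarrow> g \<in> L_space \<mu> \<alpha>"
  unfolding L_space_def using assms by (simp cong: measurable_cong Bochner_Integration.integrable_cong)

section \<open>Joint laws under a measure preserving involution\<close>

context stable_space
begin

context
  fixes \<sigma> :: "'a \<Rightarrow> 'a"
  assumes \<sigma>: "\<sigma> \<in> \<mu> \<rightarrow>\<^sub>M \<mu>" and inv: "distr \<mu> \<mu> \<sigma> = \<mu>" and invol: "\<And>x. x \<in> space \<mu> \<Longrightarrow> \<sigma> (\<sigma> x) = x"
begin

lemma preserving_surj: "\<sigma> ` space \<mu> = space \<mu>"
  using measurable_space[OF \<sigma>] invol by (metis (no_types) image_eqI image_subsetI subsetI subset_antisym)

lemma L_space_preserved_iff: "f \<circ> \<sigma> \<in> L_space \<mu> \<beta> \<longleftrightarrow> f \<in> L_space \<mu> \<beta>"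
proof
  assume "f \<circ> \<sigma> \<in> L_space \<mu> \<beta>"
  then have "f \<circ> \<sigma> \<circ> \<sigma> \<in> L_space \<mu> \<beta>" by (rule L_space_measure_preserving[OF \<sigma> inv])
  then show "f \<in> L_space \<mu> \<beta>"
    using L_space_cong[of \<mu> "f \<circ> \<sigma> \<circ> \<sigma>" f] invol by simp
qed (rule L_space_measure_preserving[OF \<sigma> inv])

lemma distr_W_preserved:
  assumes A: "A \<in> sets \<mu>"
  shows "distr P borel (W (\<sigma> -` A \<inter> space \<mu>)) = distr P borel (W A)"
proof (rule Levy_uniqueness)
  have A': "\<sigma> -` A \<inter> space \<mu> \<in> sets \<mu>" using \<sigma> A by (rule measurable_sets)
  show "real_distribution (distr P borel (W (\<sigma> -` A \<inter> space \<mu>)))" "real_distribution (distr P borel (W A))"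
    using A A' by (auto intro!: P.real_distribution_distr)
  show "char (distr P borel (W (\<sigma> -` A \<inter> space \<mu>))) = char (distr P borel (W A))"
    using W_char[OF A] W_char[OF A'] by (simp add: measure_measure_preserving[OF \<sigma> inv A] fun_eq_iff)
qed

lemma simple_function_preserved: "simple_function \<mu> u \<Longrightarrow> simple_function \<mu> (u \<circ> \<sigma>)"
proof -
  assume u: "simple_function \<mu> u"
  have "(u \<circ> \<sigma>) ` space \<mu> = u ` space \<mu>" by (simp only: image_comp[symmetric] preserving_surj)
  moreover have "(u \<circ> \<sigma>) -` A \<inter> space \<mu> = \<sigma> -` (u -` A \<inter> space \<mu>) \<inter> space \<mu>" for A
    using measurable_space[OF \<sigma>] by auto
  ultimately show "simple_function \<mu> (u \<circ> \<sigma>)"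
    using simple_functionD(1)[OF u] measurable_sets[OF \<sigma> simple_functionD(2)[OF u]]
    by (simp only: simple_function_def) simp
qed

text \<open>All the integrals are one linear image of the vector of values of \<open>W\<close> on a
  common partition. For the original and the reflected partition these vectors have independent
  components with the same marginals, hence the same law.\<close>

lemma joint_law_simple:
  assumes J: "finite J" and u: "\<And>j. j \<in> J \<Longrightarrow> simple_function \<mu> (u j)"
  shows "distr P (\<Pi>\<^sub>M j\<in>J. borel) (\<lambda>\<omega>. \<lambda>j\<in>J. S (u j \<circ> \<sigma>) \<omega>) =
    distr P (\<Pi>\<^sub>M j\<in>J. borel) (\<lambda>\<omega>. \<lambda>j\<in>J. S (u j) \<omega>)"
proof -
  \<comment> \<open>The level sets of the tuple of all integrands refine those of each of
    them.\<close>
  define h where "h x = (\<lambda>j\<in>J. u j x)" for x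
  have h: "simple_function \<mu> h"
    unfolding simple_function_def
  proof
    have "h ` space \<mu> \<subseteq> Pi\<^sub>E J (\<lambda>j. u j ` space \<mu>)" by (auto simp: h_def)
    moreover have "finite (Pi\<^sub>E J (\<lambda>j. u j ` space \<mu>))"
      using J u by (intro finite_PiE) (auto dest: simple_functionD(1))
    ultimately show "finite (h ` space \<mu>)" by (rule finite_subset)
    show "\<forall>y\<in>h ` space \<mu>. h -` {y} \<inter> space \<mu> \<in> sets \<mu>"
    proof
      fix y assume "y \<in> h ` space \<mu>"
      then have y: "y \<in> extensional J" by (auto simp: h_def)
      have [measurable]: "u j \<in> borel_measurable \<mu>" if "j \<in> J" for j
        using u[OF that] by (rule borel_measurable_simple_function)
      have "h -` {y} \<inter> space \<mu> = {x \<in> space \<mu>. \<forall>j\<in>J. u j x = y j}"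
        using y by (auto simp: h_def fun_eq_iff restrict_def extensional_def)
      also have "\<dots> \<in> sets \<mu>" using J by measurable
      finally show "h -` {y} \<inter> space \<mu> \<in> sets \<mu>" .
    qed
  qed
  obtain e k where e: "bij_betw e {..<k::nat} (h ` space \<mu>)" by (rule simple_enumeration[OF h])
  \<comment> \<open>Composing with the surjection \<sigma> does not change the set of values, so one
    enumeration serves both partitions.\<close>
  have e': "bij_betw e {..<k} ((h \<circ> \<sigma>) ` space \<mu>)"
    using e by (simp only: image_comp[symmetric] preserving_surj)
  define B where "B n = h -` {e n} \<inter> space \<mu>" for n
  define B' where "B' n = (h \<circ> \<sigma>) -` {e n} \<inter> space \<mu>" for n
  note h' = simple_function_preserved[OF h]
  have B[measurable]: "B n \<in> sets \<mu>" and B'[measurable]: "B' n \<in> sets \<mu>" for n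
    unfolding B_def B'_def using simple_level_sets(2)[OF h e] simple_level_sets(2)[OF h' e'] by simp_all
  have disj: "disjoint_family_on B {..<k}" "disjoint_family_on B' {..<k}"
    using simple_level_sets(1)[OF h e] simple_level_sets(1)[OF h' e'] by (simp_all add: B_def[abs_def] B'_def[abs_def])
  have B'_eq: "B' n = \<sigma> -` B n \<inter> space \<mu>" for n
    using measurable_space[OF \<sigma>] by (auto simp: B_def B'_def)
  have ne: "{..<k} \<noteq> {}"
    using e M.not_empty by (auto simp: bij_betw_def)
  have law: "distr P (\<Pi>\<^sub>M n\<in>{..<k}. borel) (\<lambda>\<omega>. \<lambda>n\<in>{..<k}. W (C n) \<omega>) = (\<Pi>\<^sub>M n\<in>{..<k}. distr P borel (W (C n)))"
    if C: "\<And>n. C n \<in> sets \<mu>" and disj: "disjoint_family_on C {..<k}" for C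
  proof -
    have "P.indep_vars (\<lambda>_. borel) (\<lambda>n. W (C n)) {..<k}"
      by (rule W_finite_Union(2)) (use C disj in auto)
    then show ?thesis
      using P.indep_vars_iff_distr_eq_PiM'[OF ne, where M' = "\<lambda>_. borel" and X = "\<lambda>n. W (C n)"] W_measurable[OF C]
      by simp
  qed
  have same: "distr P (\<Pi>\<^sub>M n\<in>{..<k}. borel) (\<lambda>\<omega>. \<lambda>n\<in>{..<k}. W (B' n) \<omega>) =
      distr P (\<Pi>\<^sub>M n\<in>{..<k}. borel) (\<lambda>\<omega>. \<lambda>n\<in>{..<k}. W (B n) \<omega>)"
    unfolding law[OF B disj(1)] law[OF B' disj(2)] unfolding B'_eq by (simp only: distr_W_preserved[OF B])
  \<comment> \<open>The linear map from the values of \<open>W\<close> on the pieces to all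
    integrals at once.\<close>
  define \<Theta> where "\<Theta> z = (\<lambda>j\<in>J. \<Sum>n<k. e n j * z n)" for z :: "nat \<Rightarrow> real"
  have \<Theta>[measurable]: "\<Theta> \<in> (\<Pi>\<^sub>M n\<in>{..<k}. borel) \<rightarrow>\<^sub>M (\<Pi>\<^sub>M j\<in>J. borel)"
    unfolding \<Theta>_def by measurable
  have vec: "(\<lambda>\<omega>. \<lambda>n\<in>{..<k}. W (C n) \<omega>) \<in> P \<rightarrow>\<^sub>M (\<Pi>\<^sub>M n\<in>{..<k}. borel)" if C: "\<And>n. C n \<in> sets \<mu>" for C
    using W_measurable[OF C] by (intro measurable_restrict)
  have push: "distr P (\<Pi>\<^sub>M j\<in>J. borel) (\<lambda>\<omega>. \<lambda>j\<in>J. S (v j) \<omega>) =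
      distr (distr P (\<Pi>\<^sub>M n\<in>{..<k}. borel) (\<lambda>\<omega>. \<lambda>n\<in>{..<k}. W (C n) \<omega>)) (\<Pi>\<^sub>M j\<in>J. borel) \<Theta>"
    if C: "\<And>n. C n \<in> sets \<mu>" and v: "\<And>j. j \<in> J \<Longrightarrow> simple_function \<mu> (v j)"
      and rep: "\<And>j. j \<in> J \<Longrightarrow> AE \<omega> in P. S (v j) \<omega> = (\<Sum>n<k. e n j * W (C n) \<omega>)" for C v
  proof -
    have "distr (distr P (\<Pi>\<^sub>M n\<in>{..<k}. borel) (\<lambda>\<omega>. \<lambda>n\<in>{..<k}. W (C n) \<omega>)) (\<Pi>\<^sub>M j\<in>J. borel) \<Theta> =
        distr P (\<Pi>\<^sub>M j\<in>J. borel) (\<Theta> \<circ> (\<lambda>\<omega>. \<lambda>n\<in>{..<k}. W (C n) \<omega>))"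
      by (rule distr_distr[OF \<Theta> vec[OF C]])
    also have "\<dots> = distr P (\<Pi>\<^sub>M j\<in>J. borel) (\<lambda>\<omega>. \<lambda>j\<in>J. S (v j) \<omega>)"
    proof (rule distr_cong_AE)
      have "AE \<omega> in P. \<forall>j\<in>J. S (v j) \<omega> = (\<Sum>n<k. e n j * W (C n) \<omega>)"
        using J rep by (rule AE_finite_allI)
      then show "AE \<omega> in P. (\<Theta> \<circ> (\<lambda>\<omega>. \<lambda>n\<in>{..<k}. W (C n) \<omega>)) \<omega> = (\<lambda>j\<in>J. S (v j) \<omega>)"
        by eventually_elim (auto simp: \<Theta>_def fun_eq_iff)
      show "(\<Theta> \<circ> (\<lambda>\<omega>. \<lambda>n\<in>{..<k}. W (C n) \<omega>)) \<in> P \<rightarrow>\<^sub>M (\<Pi>\<^sub>M j\<in>J. borel)"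
        by (rule measurable_comp[OF vec[OF C] \<Theta>])
      show "(\<lambda>\<omega>. \<lambda>j\<in>J. S (v j) \<omega>) \<in> P \<rightarrow>\<^sub>M (\<Pi>\<^sub>M j\<in>J. borel)"
        using S_measurable[OF v] by (rule measurable_restrict)
    qed simp_all
    finally show ?thesis ..
  qed
  have rep: "AE \<omega> in P. S (u j) \<omega> = (\<Sum>n<k. e n j * W (B n) \<omega>)" if j: "j \<in> J" for j
    using S_compose[OF h e, of "\<lambda>z. z j"] j unfolding B_def h_def by simp
  have rep': "AE \<omega> in P. S (u j \<circ> \<sigma>) \<omega> = (\<Sum>n<k. e n j * W (B' n) \<omega>)" if j: "j \<in> J" for j
  proof -
    have "(\<lambda>x. (h \<circ> \<sigma>) x j) = u j \<circ> \<sigma>" using j by (auto simp: h_def)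
    then show ?thesis
      using S_compose[OF h' e', of "\<lambda>z. z j"] unfolding B'_def by simp
  qed
  show ?thesis
    using push[of B u, OF B u rep] push[of B' "\<lambda>j. u j \<circ> \<sigma>", OF B' simple_function_preserved[OF u] rep'] same
    by simp
qed

text \<open>Since \<mu> is invariant, simple functions that approximate \<open>f j\<close>
  approximate its reflection equally well after being reflected. The simple case then passes to the
  limit.\<close>

lemma joint_law_SI:
  assumes J: "finite J"
  shows "distr P (\<Pi>\<^sub>M j\<in>J. borel) (\<lambda>\<omega>. \<lambda>j\<in>J. SI (f j \<circ> \<sigma>) \<omega>) =
    distr P (\<Pi>\<^sub>M j\<in>J. borel) (\<lambda>\<omega>. \<lambda>j\<in>J. SI (f j) \<omega>)"
proof -
  let ?Q = "\<lambda>g u. (\<forall>n::nat. simple_function \<mu> (u n)) \<and>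
      (\<lambda>n. P.trunc_moment (\<lambda>\<omega>. S (u n) \<omega> - SI g \<omega>)) \<longlonglongrightarrow> 0 \<and>
      (\<lambda>n. P.trunc_moment (\<lambda>\<omega>. S (u n \<circ> \<sigma>) \<omega> - SI (g \<circ> \<sigma>) \<omega>)) \<longlonglongrightarrow> 0"
  have ex: "\<exists>u. ?Q g u"
    if g: "g \<in> L_space \<mu> \<alpha>" for g
  proof -
    obtain u where u: "\<And>n. simple_function \<mu> (u n)" and lim: "(\<lambda>n. Lp_dist (u n) g) \<longlonglongrightarrow> 0"
      using simple_approximation[OF g] by blast
    have [measurable]: "u n \<in> borel_measurable \<mu>" "g \<in> borel_measurable \<mu>" for n
      using borel_measurable_simple_function[OF u] g by (auto simp: L_space_def)
    have "(\<integral>x. \<bar>(u n \<circ> \<sigma>) x - (g \<circ> \<sigma>) x\<bar> powr \<alpha> \<partial>\<mu>) = (Lp_dist (u n) g)" for n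
      using integral_measure_preserving[OF \<sigma> inv, of "\<lambda>x. \<bar>u n x - g x\<bar> powr \<alpha>"] by simp
    then have "(\<lambda>n. \<integral>x. \<bar>(u n \<circ> \<sigma>) x - (g \<circ> \<sigma>) x\<bar> powr \<alpha> \<partial>\<mu>) \<longlonglongrightarrow> 0"
      using lim by simp
    from S_tendsto_SI[OF L_space_measure_preserving[OF \<sigma> inv g] simple_function_preserved[OF u] this]
    show ?thesis
      using S_tendsto_SI[OF g u lim] u by blast
  qed
  have "\<exists>u. ?Q g u" for g
  proof (cases "g \<in> L_space \<mu> \<alpha>")
    \<comment> \<open>Membership in \<open>L_space\<close> is invariant, so both integrals take the
      default value 0, and zero functions approximate them.\<close>
    case False
    then have "SI g = (\<lambda>_. 0)" "SI (g \<circ> \<sigma>) = (\<lambda>_. 0)"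
      by (simp_all add: stable_integral_def L_space_preserved_iff)
    moreover have "S (\<lambda>_. 0) \<omega> = 0" for \<omega>
      by (simp add: simple_stable_integral_def image_constant_conv)
    ultimately show ?thesis
      by (intro exI[of _ "\<lambda>_ _. 0"]) (simp add: comp_def P.trunc_moment_def)
  qed (rule ex)
  then have "\<exists>u. \<forall>g. ?Q g (u g)"
    by (rule choice[OF allI])
  then obtain u where u: "\<forall>g. ?Q g (u g)" ..
  have simple: "simple_function \<mu> (u g n)" for g n using u by simp
  show ?thesis
  proof (rule P.distr_PiM_eq_limit[OF J, where U = "\<lambda>n j. S (u (f j) n \<circ> \<sigma>)" and V = "\<lambda>n j. S (u (f j) n)"])
    show "distr P (\<Pi>\<^sub>M j\<in>J. borel) (\<lambda>\<omega>. \<lambda>j\<in>J. S (u (f j) n \<circ> \<sigma>) \<omega>) =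
        distr P (\<Pi>\<^sub>M j\<in>J. borel) (\<lambda>\<omega>. \<lambda>j\<in>J. S (u (f j) n) \<omega>)" for n
      by (rule joint_law_simple[OF J simple])
  qed (simp_all add: u S_measurable simple simple_function_preserved SI_measurable)
qed

end

end

section \<open>Semigroups and the heat kernel\<close>

context prob_space
begin

lemma L2_norm_le_add_AE:
  assumes f: "f \<in> L_space M 2" and g: "g \<in> L_space M 2" and h: "h \<in> L_space M 2"
    and eq: "AE x in M. f x = g x + h x"
  shows "L2_norm M f \<le> L2_norm M g + L2_norm M h"
  using L2_norm_cong_AE[OF L2_measurable[OF f] L2_measurable[OF L2_add[OF g h]] eq] L2_norm_triangle[OF g h] by simp

context
  fixes T :: "real \<Rightarrow> ('a \<Rightarrow> real) \<Rightarrow> 'a \<Rightarrow> real" and A :: "('a \<Rightarrow> real) \<Rightarrow> ('a \<Rightarrow> real) \<Rightarrow> bool"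
  assumes T: "L2_semigroup_with_generator M T A"
begin

lemma semigroup_L2: "t > 0 \<Longrightarrow> f \<in> L_space M 2 \<Longrightarrow> T t f \<in> L_space M 2"
  and semigroup_contraction: "t > 0 \<Longrightarrow> f \<in> L_space M 2 \<Longrightarrow> L2_norm M (T t f) \<le> L2_norm M f"
  and semigroup_lincomb: "t > 0 \<Longrightarrow> f \<in> L_space M 2 \<Longrightarrow> g \<in> L_space M 2 \<Longrightarrow>
    AE x in M. T t (\<lambda>y. c * f y + g y) x = c * T t f x + T t g x"
  and semigroup_add: "r > 0 \<Longrightarrow> t > 0 \<Longrightarrow> f \<in> L_space M 2 \<Longrightarrow> AE x in M. T r (T t f) x = T (r + t) f x"
  and semigroup_generator: "f \<in> L_space M 2 \<Longrightarrow> g \<in> L_space M 2 \<Longrightarrow> A f g \<Longrightarrow>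
    ((\<lambda>t. L2_norm M (\<lambda>x. (T t f x - f x) / t - g x)) \<longlongrightarrow> 0) (at_right 0)"
  using T by (simp_all add: L2_semigroup_with_generator_def)

lemma semigroup_contraction_diff:
  assumes t: "t > 0" and f: "f \<in> L_space M 2" and g: "g \<in> L_space M 2"
  shows "L2_dist (T t f) (T t g) \<le> L2_dist f g"
proof -
  have d: "(\<lambda>x. f x - g x) \<in> L_space M 2" by (rule L2_diff[OF f g])
  have "AE x in M. T t (\<lambda>x. f x - g x) x = T t f x - T t g x"
    using semigroup_lincomb[OF t g f, of "-1"] by simp
  then have "L2_dist (T t f) (T t g) = L2_norm M (T t (\<lambda>x. f x - g x))"
    by (intro L2_norm_cong_AE L2_measurable L2_diff semigroup_L2 t f g) auto
  then show ?thesis using semigroup_contraction[OF t d] by simp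
qed

text \<open>Telescoping: \<open>T\<^sub>t - exp (- \<lambda> t)\<close> is a sum of \<open>n\<close> terms, each bounded by the error
  of one step of length \<open>t / n\<close>, which is \<open>o(t / n)\<close>.\<close>

lemma semigroup_eigenfunction:
  assumes f: "f \<in> L_space M 2" and A: "A f (\<lambda>x. - lam * f x)" and lam: "lam \<ge> 0" and t: "t > 0"
  shows "AE x in M. T t f x = exp (- lam * t) * f x"
proof -
  define d where "d h = L2_norm M (\<lambda>x. T h f x - exp (- lam * h) * f x)" for h
  have L: "(\<lambda>x. T h f x - exp (- lam * s) * f x) \<in> L_space M 2" if "h > 0" for h s
    by (intro L2_diff semigroup_L2 L2_cmult f that)
  have steps: "L2_norm M (\<lambda>x. T (real (Suc n) * h) f x - exp (- lam * (real (Suc n) * h)) * f x) \<le> real (Suc n) * d h"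
    if h: "h > 0" for n h
  proof (induction n)
    case 0
    then show ?case by (simp add: d_def)
  next
    case (Suc n)
    define a where "a = exp (- lam * (real (Suc n) * h))"
    have a: "0 \<le> a" "a \<le> 1" using lam h by (auto simp: a_def)
    have nh: "real (Suc n) * h > 0" using h by simp
    have sum: "h + real (Suc n) * h = real (Suc (Suc n)) * h" by (simp add: algebra_simps)
    have ea: "a * exp (- lam * h) = exp (- lam * (real (Suc (Suc n)) * h))"
      by (simp add: a_def algebra_simps flip: exp_add)
    let ?g = "\<lambda>x. T (real (Suc n) * h) f x - a * f x"
    have g: "?g \<in> L_space M 2" unfolding a_def by (rule L[OF nh])
    have "AE x in M. T h ?g x = T h (T (real (Suc n) * h) f) x - a * T h f x"
      using semigroup_lincomb[OF h f semigroup_L2[OF nh f], of "-a"] by simp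
    \<comment> \<open>Inserting \<open>a * T h f\<close> splits the new error into the old one moved
      by a contraction and a further one-step error damped by \<open>a \<le> 1\<close>.\<close>
    then have "AE x in M. T (real (Suc (Suc n)) * h) f x - exp (- lam * (real (Suc (Suc n)) * h)) * f x =
        T h ?g x + a * (T h f x - exp (- lam * h) * f x)"
      using semigroup_add[OF h nh f] unfolding sum ea[symmetric]
      by eventually_elim (simp add: algebra_simps)
    then have "L2_norm M (\<lambda>x. T (real (Suc (Suc n)) * h) f x - exp (- lam * (real (Suc (Suc n)) * h)) * f x) \<le>
        L2_norm M (T h ?g) + L2_norm M (\<lambda>x. a * (T h f x - exp (- lam * h) * f x))"
      using h by (intro L2_norm_le_add_AE L semigroup_L2 g L2_cmult) auto
    also have "L2_norm M (\<lambda>x. a * (T h f x - exp (- lam * h) * f x)) \<le> d h"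
      unfolding L2_norm_cmult d_def using a by (simp add: mult_left_le_one_le L2_norm_nonneg)
    also have "L2_norm M (T h ?g) \<le> real (Suc n) * d h"
      using semigroup_contraction[OF h g] Suc unfolding a_def by linarith
    finally show ?case by (simp add: algebra_simps)
  qed
  \<comment> \<open>Both \<open>T h f\<close> and \<open>exp (- lam * h) * f\<close> have the
    first-order term \<open>- lam * f\<close> at 0, so they differ by \<open>o(h)\<close>.\<close>
  have "((\<lambda>h. d h / h) \<longlongrightarrow> 0) (at_right 0)"
  proof (rule tendsto_sandwich[OF _ _ tendsto_const])
    show "\<forall>\<^sub>F h in at_right 0. 0 \<le> d h / h"
      using eventually_at_right_less[of 0] by eventually_elim (simp add: d_def L2_norm_nonneg)
    show "\<forall>\<^sub>F h in at_right 0. d h / h \<le>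
        L2_norm M (\<lambda>x. (T h f x - f x) / h - (- lam * f x)) + \<bar>(1 - exp (- lam * h)) / h - lam\<bar> * L2_norm M f"
      using eventually_at_right_less[of 0]
    proof eventually_elim
      case (elim h)
      have "d h / h = L2_norm M (\<lambda>x. (1 / h) * (T h f x - exp (- lam * h) * f x))"
        using elim unfolding L2_norm_cmult d_def by simp
      also have "(\<lambda>x. (1 / h) * (T h f x - exp (- lam * h) * f x)) =
          (\<lambda>x. ((T h f x - f x) / h - (- lam * f x)) + ((1 - exp (- lam * h)) / h - lam) * f x)"
        using elim by (simp add: field_simps fun_eq_iff)
      also have "L2_norm M \<dots> \<le> L2_norm M (\<lambda>x. (T h f x - f x) / h - (- lam * f x)) +
          L2_norm M (\<lambda>x. ((1 - exp (- lam * h)) / h - lam) * f x)"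
      proof (rule L2_norm_triangle)
        have "(\<lambda>x. (1 / h) * (T h f x - f x) - (- lam) * f x) \<in> L_space M 2"
          using elim by (intro L2_diff L2_cmult semigroup_L2 f)
        then show "(\<lambda>x. (T h f x - f x) / h - (- lam * f x)) \<in> L_space M 2" by simp
      qed (rule L2_cmult[OF f])
      finally show ?case by (simp only: L2_norm_cmult)
    qed
    have "((\<lambda>h. exp (- lam * h)) has_real_derivative - lam * exp (- lam * 0)) (at 0)"
      by (auto intro!: derivative_eq_intros)
    then have "((\<lambda>h. (exp (- lam * h) - 1) / h) \<longlongrightarrow> - lam) (at 0)"
      by (simp add: has_field_derivative_iff)
    then have "((\<lambda>h. (exp (- lam * h) - 1) / h) \<longlongrightarrow> - lam) (at_right 0)"
      by (rule tendsto_within_subset) simp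
    from tendsto_minus[OF this] have "((\<lambda>h. (1 - exp (- lam * h)) / h) \<longlongrightarrow> lam) (at_right 0)"
      by (simp add: minus_divide_left)
    then have "((\<lambda>h. \<bar>(1 - exp (- lam * h)) / h - lam\<bar> * L2_norm M f) \<longlongrightarrow> 0) (at_right 0)"
      by (intro tendsto_mult_left_zero tendsto_rabs_zero LIM_zero)
    from tendsto_add[OF semigroup_generator[OF f L2_cmult[OF f] A] this]
    show "((\<lambda>h. L2_norm M (\<lambda>x. (T h f x - f x) / h - (- lam * f x)) +
        \<bar>(1 - exp (- lam * h)) / h - lam\<bar> * L2_norm M f) \<longlongrightarrow> 0) (at_right 0)" by simp
  qed
  moreover have "filterlim (\<lambda>n. t / real (Suc n)) (at_right 0) sequentially"
    by (rule tendsto_imp_filterlim_at_right[OF LIMSEQ_Suc[OF lim_const_over_n[of t]]]) (simp add: t)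
  ultimately have "(\<lambda>n. d (t / real (Suc n)) / (t / real (Suc n))) \<longlonglongrightarrow> 0"
    by (rule filterlim_compose)
  then have lim: "(\<lambda>n. t * (d (t / real (Suc n)) / (t / real (Suc n)))) \<longlonglongrightarrow> 0"
    by (rule tendsto_mult_right_zero)
  have "d t \<le> t * (d (t / real (Suc n)) / (t / real (Suc n)))" for n
  proof -
    have "real (Suc n) * (t / real (Suc n)) = t" by simp
    with steps[of "t / real (Suc n)" n] t have "d t \<le> real (Suc n) * d (t / real (Suc n))"
      by (simp only: d_def) simp
    then show ?thesis using t by (simp add: mult.commute)
  qed
  then have "d t \<le> 0"
    by (intro LIMSEQ_le_const[OF lim]) auto
  then have "d t = 0" by (simp add: d_def antisym L2_norm_nonneg)
  then show ?thesis
    using L2_norm_eq_0_iff[OF L[OF t]] by (simp add: d_def)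
qed

end

end

section \<open>Invariance of the energy and of the Laplacian\<close>

lemma gasket_energy_level_commute: "gasket_energy_level n f g = gasket_energy_level n g f"
  by (simp add: gasket_energy_level_def mult.commute)

text \<open>The reflection permutes the vertex sets of the cells of level \<open>n\<close>, so it
  only reorders the sum.\<close>

lemma gasket_energy_level_sym:
  assumes i: "i \<in> {0, 1, 2}"
  shows "gasket_energy_level n (f \<circ> gasket_sym i) (g \<circ> gasket_sym i) = gasket_energy_level n f g"
proof -
  let ?\<sigma> = "gasket_sym i"
  define C where "C w = word_map w ` gasket_vertex ` {0, 1, 2}" for w
  define G where "G w = (\<Sum>x\<in>C w. \<Sum>y\<in>C w. (f x - f y) * (g x - g y))" for w
  have inj: "inj_on ?\<sigma> B" for B
    by (rule inj_on_inverseI[of _ ?\<sigma>]) (rule gasket_sym_involution[OF i])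
  have vertices: "?\<sigma> ` gasket_vertex ` {0, 1, 2} = gasket_vertex ` {0, 1, 2}"
  proof -
    have "reflect_index i ` {0, 1, 2} = {0, 1, 2}"
      using i by (auto simp: reflect_index_def)
    moreover have "?\<sigma> ` gasket_vertex ` {0, 1, 2} = gasket_vertex ` reflect_index i ` {0, 1, 2}"
      unfolding image_image by (intro image_cong refl gasket_sym_vertex_index i)
    ultimately show ?thesis by simp
  qed
  have C: "C (map (reflect_index i) w) = ?\<sigma> ` C w" if w: "w \<in> gasket_words n" for w
  proof -
    have "?\<sigma> ` C w = word_map (map (reflect_index i) w) ` ?\<sigma> ` gasket_vertex ` {0, 1, 2}"
      unfolding C_def image_image gasket_sym_word_map[OF i gasket_words_set[OF w]] ..
    then show ?thesis by (simp only: vertices C_def)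
  qed
  have "(\<Sum>x\<in>C w. \<Sum>y\<in>C w. (f (?\<sigma> x) - f (?\<sigma> y)) * (g (?\<sigma> x) - g (?\<sigma> y))) = G (map (reflect_index i) w)"
    if w: "w \<in> gasket_words n" for w
    unfolding G_def C[OF w] by (simp add: sum.reindex[OF inj])
  then have "(\<Sum>w\<in>gasket_words n. \<Sum>x\<in>C w. \<Sum>y\<in>C w. (f (?\<sigma> x) - f (?\<sigma> y)) * (g (?\<sigma> x) - g (?\<sigma> y))) =
      (\<Sum>w\<in>gasket_words n. G (map (reflect_index i) w))"
    by (rule sum.cong[OF refl])
  also have "\<dots> = (\<Sum>w\<in>gasket_words n. G w)"
    by (rule sum.reindex_bij_betw[OF bij_betw_map_reflect_index[OF i]])
  finally show ?thesis
    by (simp add: gasket_energy_level_def G_def C_def)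
qed

lemma gasket_energy_sym:
  "i \<in> {0, 1, 2} \<Longrightarrow> gasket_energy (f \<circ> gasket_sym i) (g \<circ> gasket_sym i) = gasket_energy f g"
  unfolding gasket_energy_def by (simp only: gasket_energy_level_sym)

lemma gasket_energy_commute: "gasket_energy f g = gasket_energy g f"
  unfolding gasket_energy_def by (subst gasket_energy_level_commute) (rule refl)

context gasket_space
begin

lemma form_domain_measurable: "u \<in> gasket_form_domain K \<Longrightarrow> u \<in> borel_measurable \<mu>"
  by (auto simp: gasket_form_domain_def intro: measurable_continuous_on)

lemma neumann_laplacian_L2:
  "neumann_laplacian K \<mu> f g \<Longrightarrow> f \<in> L_space \<mu> 2" "neumann_laplacian K \<mu> f g \<Longrightarrow> g \<in> L_space \<mu> 2"
  by (auto simp: neumann_laplacian_def)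

text \<open>Treats constants, which the eigenbasis of the mean-zero functions omits, as
  eigenfunctions; the factor \<open>- 0\<close> gives them the common shape
  \<open>- lam * f\<close>.\<close>

lemma neumann_laplacian_const: "neumann_laplacian K \<mu> (\<lambda>_. c) (\<lambda>_. - 0 * c)"
proof -
  have "(\<lambda>_. c) \<in> gasket_form_domain K"
    by (simp add: gasket_form_domain_def gasket_energy_level_def convergent_const)
  moreover have "gasket_energy (\<lambda>_. c) v = - L2_inner \<mu> (\<lambda>_. 0) v" for v
    by (simp add: gasket_energy_def gasket_energy_level_def L2_inner_def)
  ultimately show ?thesis
    by (auto simp: neumann_laplacian_def L2_const)
qed

text \<open>Both sides are minus the energy of the two continuous representatives, which is
  symmetric.\<close>

lemma neumann_laplacian_symmetric:
  assumes "neumann_laplacian K \<mu> f g" "neumann_laplacian K \<mu> f' g'"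
  shows "L2_inner \<mu> g f' = L2_inner \<mu> f g'"
proof -
  obtain u where f: "f \<in> L_space \<mu> 2" "g \<in> L_space \<mu> 2" and u: "u \<in> gasket_form_domain K" "AE x in \<mu>. f x = u x"
    "\<And>v. v \<in> gasket_form_domain K \<Longrightarrow> gasket_energy u v = - L2_inner \<mu> g v"
    using assms(1) unfolding neumann_laplacian_def by blast
  obtain u' where f': "f' \<in> L_space \<mu> 2" "g' \<in> L_space \<mu> 2" and u': "u' \<in> gasket_form_domain K" "AE x in \<mu>. f' x = u' x"
    "\<And>v. v \<in> gasket_form_domain K \<Longrightarrow> gasket_energy u' v = - L2_inner \<mu> g' v"
    using assms(2) unfolding neumann_laplacian_def by blast
  have "L2_inner \<mu> g f' = L2_inner \<mu> g u'"
    using f f' u' by (intro L2_inner_cong_AE L2_measurable form_domain_measurable) auto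
  also have "\<dots> = L2_inner \<mu> g' u"
    using u(3)[OF u'(1)] u'(3)[OF u(1)] gasket_energy_commute[of u u'] by simp
  also have "\<dots> = L2_inner \<mu> g' f"
    using f f' u by (intro L2_inner_cong_AE L2_measurable form_domain_measurable) auto
  finally show ?thesis by (simp only: L2_inner_commute)
qed

end

context gasket_reflection
begin

lemma sym_L2: "f \<in> L_space \<mu> 2 \<Longrightarrow> f \<circ> \<sigma> \<in> L_space \<mu> 2"
  by (rule L_space_measure_preserving[OF measurable_sym distr_sym])

lemma sym_integral: "f \<in> borel_measurable \<mu> \<Longrightarrow> (\<integral>x. f (\<sigma> x) \<partial>\<mu>) = (\<integral>x. f x \<partial>\<mu>)" for f :: "complex \<Rightarrow> real"
  by (rule integral_measure_preserving[OF measurable_sym distr_sym])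

lemma sym_AE: "AE x in \<mu>. Q x \<Longrightarrow> AE x in \<mu>. Q (\<sigma> x)"
  by (rule AE_measure_preserving[OF measurable_sym distr_sym])

lemma sym_comp: "f \<circ> \<sigma> \<circ> \<sigma> = f"
  by (simp add: fun_eq_iff sym_sym)

lemma sym_inner:
  assumes [measurable]: "f \<in> borel_measurable \<mu>" "g \<in> borel_measurable \<mu>"
  shows "L2_inner \<mu> (f \<circ> \<sigma>) (g \<circ> \<sigma>) = L2_inner \<mu> f g"
  unfolding L2_inner_def using sym_integral[of "\<lambda>x. f x * g x"] by simp

text \<open>Composition with a measure preserving involution is a self-adjoint operator.\<close>

lemma sym_inner_swap:
  assumes "f \<in> borel_measurable \<mu>" "g \<in> borel_measurable \<mu>"
  shows "L2_inner \<mu> f (g \<circ> \<sigma>) = L2_inner \<mu> (f \<circ> \<sigma>) g"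
  using sym_inner[OF measurable_comp[OF measurable_sym assms(1)] assms(2)] by (simp add: sym_comp)

lemma sym_norm: "f \<in> borel_measurable \<mu> \<Longrightarrow> L2_norm \<mu> (f \<circ> \<sigma>) = L2_norm \<mu> f"
  by (simp add: L2_norm_def sym_inner)

lemma sym_L2_zero: "f \<in> L2_zero \<mu> \<Longrightarrow> f \<circ> \<sigma> \<in> L2_zero \<mu>"
proof -
  assume f: "f \<in> L2_zero \<mu>"
  then have "(\<integral>x. (f \<circ> \<sigma>) x \<partial>\<mu>) = 0"
    using sym_integral[of f] by (simp add: L2_zero_def L2_measurable comp_def)
  with f show "f \<circ> \<sigma> \<in> L2_zero \<mu>"
    by (simp add: L2_zero_def sym_L2) (simp add: comp_def)
qed

lemma sym_form_domain: "u \<in> gasket_form_domain K \<Longrightarrow> u \<circ> \<sigma> \<in> gasket_form_domain K"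
  using continuous_on_compose[OF continuous_on_gasket_sym[OF i], of K u]
  by (simp only: gasket_form_domain_def mem_Collect_eq gasket_energy_level_sym[OF i] sym_image)

text \<open>Testing the reflected function against \<open>v\<close> amounts to testing the original
  one against \<open>v \<circ> \<sigma>\<close>, because energy, form domain and inner product are
  invariant.\<close>

lemma sym_neumann_laplacian:
  assumes "neumann_laplacian K \<mu> f g"
  shows "neumann_laplacian K \<mu> (f \<circ> \<sigma>) (g \<circ> \<sigma>)"
proof -
  obtain u where f: "f \<in> L_space \<mu> 2" "g \<in> L_space \<mu> 2" and u: "u \<in> gasket_form_domain K" "AE x in \<mu>. f x = u x"
    "\<And>v. v \<in> gasket_form_domain K \<Longrightarrow> gasket_energy u v = - L2_inner \<mu> g v"
    using assms unfolding neumann_laplacian_def by blast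
  have "gasket_energy (u \<circ> \<sigma>) v = - L2_inner \<mu> (g \<circ> \<sigma>) v" if v: "v \<in> gasket_form_domain K" for v
  proof -
    have "gasket_energy (u \<circ> \<sigma>) v = gasket_energy (u \<circ> \<sigma>) ((v \<circ> \<sigma>) \<circ> \<sigma>)" by (simp only: sym_comp)
    also have "\<dots> = - L2_inner \<mu> g (v \<circ> \<sigma>)"
      by (simp only: gasket_energy_sym[OF i] u(3)[OF sym_form_domain[OF v]])
    finally show ?thesis
      by (simp only: sym_inner_swap[OF L2_measurable[OF f(2)] form_domain_measurable[OF v]])
  qed
  moreover have "AE x in \<mu>. (f \<circ> \<sigma>) x = (u \<circ> \<sigma>) x"
    using sym_AE[OF u(2)] by simp
  ultimately show ?thesis
    unfolding neumann_laplacian_def using sym_L2[OF f(1)] sym_L2[OF f(2)] sym_form_domain[OF u(1)] by blast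
qed

end

locale gasket_laplacian = gasket_reflection +
  fixes eigval :: "nat \<Rightarrow> real" and \<Phi> :: "nat \<Rightarrow> complex \<Rightarrow> real"
  assumes eigenbasis: "laplacian_eigenbasis K \<mu> eigval \<Phi>"
begin

lemma eigval_pos: "eigval j \<ge> eigval 0" "0 < eigval 0" "0 < eigval j"
proof -
  show "0 < eigval 0" and *: "eigval j \<ge> eigval 0"
    using eigenbasis by (auto simp: laplacian_eigenbasis_def monoD)
  then show "0 < eigval j" by linarith
qed

lemma \<Phi>_L2_zero: "\<Phi> j \<in> L2_zero \<mu>"
  and \<Phi>_laplacian: "neumann_laplacian K \<mu> (\<Phi> j) (\<lambda>x. - eigval j * \<Phi> j x)"
  and \<Phi>_orthonormal: "L2_inner \<mu> (\<Phi> j) (\<Phi> k) = (if j = k then 1 else 0)"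
  and \<Phi>_expansion: "f \<in> L2_zero \<mu> \<Longrightarrow>
    (\<lambda>n. L2_norm \<mu> (\<lambda>x. f x - (\<Sum>j<n. L2_inner \<mu> (\<Phi> j) f * \<Phi> j x))) \<longlonglongrightarrow> 0"
  using eigenbasis by (auto simp: laplacian_eigenbasis_def)

lemma \<Phi>_L2: "\<Phi> j \<in> L_space \<mu> 2"
  by (rule L2_zero_L2[OF \<Phi>_L2_zero])

lemma \<Phi>_sym_laplacian: "neumann_laplacian K \<mu> (\<Phi> j \<circ> \<sigma>) (\<lambda>x. - eigval j * (\<Phi> j \<circ> \<sigma>) x)"
  using sym_neumann_laplacian[OF \<Phi>_laplacian[of j]] by (simp add: comp_def)

text \<open>A reflected eigenfunction keeps its eigenvalue, and a symmetric operator has orthogonal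
  eigenspaces. An eigenvalue may be multiple, so \<open>\<Phi> j \<circ> \<sigma>\<close> need not
  be a multiple of \<open>\<Phi> j\<close>; this orthogonality replaces such a relation.\<close>

lemma \<Phi>_sym_orthogonal:
  assumes "eigval j \<noteq> eigval k"
  shows "L2_inner \<mu> (\<Phi> j \<circ> \<sigma>) (\<Phi> k) = 0"
proof -
  have "L2_inner \<mu> (\<lambda>x. - eigval j * (\<Phi> j \<circ> \<sigma>) x) (\<Phi> k) = L2_inner \<mu> (\<Phi> j \<circ> \<sigma>) (\<lambda>x. - eigval k * \<Phi> k x)"
    by (rule neumann_laplacian_symmetric[OF \<Phi>_sym_laplacian \<Phi>_laplacian])
  moreover have "L2_inner \<mu> (\<Phi> j \<circ> \<sigma>) (\<lambda>x. - eigval k * \<Phi> k x) = - eigval k * L2_inner \<mu> (\<Phi> j \<circ> \<sigma>) (\<Phi> k)"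
    by (rule L2_inner_cmult[OF \<Phi>_L2 sym_L2[OF \<Phi>_L2]])
  moreover have "L2_inner \<mu> (\<lambda>x. - eigval j * (\<Phi> j \<circ> \<sigma>) x) (\<Phi> k) = - eigval j * L2_inner \<mu> (\<Phi> j \<circ> \<sigma>) (\<Phi> k)"
    using L2_inner_cmult[OF sym_L2[OF \<Phi>_L2[of j]] \<Phi>_L2[of k], of "- eigval j"] by (simp only: L2_inner_commute)
  ultimately show ?thesis using assms by simp
qed

end

section \<open>Invariance of the heat kernel and of the Riesz kernel\<close>

locale gasket_kernel = gasket_laplacian +
  fixes p :: "real \<Rightarrow> complex \<Rightarrow> complex \<Rightarrow> real"
  assumes kernel: "gasket_heat_kernel K \<mu> p"
begin

definition T :: "real \<Rightarrow> (complex \<Rightarrow> real) \<Rightarrow> complex \<Rightarrow> real" where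
  "T t f x = (\<integral>y. p t x y * f y \<partial>\<mu>)"

lemma semigroup: "L2_semigroup_with_generator \<mu> T (neumann_laplacian K \<mu>)"
  using kernel by (simp add: gasket_heat_kernel_def T_def[abs_def])

lemma kernel_continuous: "continuous_on ({0<..} \<times> K \<times> K) (\<lambda>(t, x, y). p t x y)"
  using kernel by (simp add: gasket_heat_kernel_def)

text \<open>On an eigenfunction and on its reflection the semigroup acts by the same factor.
  Combinations of eigenfunctions and constants are dense in L2, and contractivity carries the
  identity to the limit.\<close>

lemma T_sym:
  assumes t: "t > 0" and f: "f \<in> L_space \<mu> 2"
  shows "AE x in \<mu>. T t (f \<circ> \<sigma>) x = T t f (\<sigma> x)"
proof -
  note T_L2 = semigroup_L2[OF semigroup t]
  define Q where "Q g \<longleftrightarrow> g \<in> L_space \<mu> 2 \<and> (AE x in \<mu>. T t (g \<circ> \<sigma>) x = T t g (\<sigma> x))" for g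
  have Q_lincomb: "Q (\<lambda>x. c * g x + h x)" if g: "Q g" and h: "Q h" for g h c
  proof -
    have L: "g \<in> L_space \<mu> 2" "h \<in> L_space \<mu> 2" using g h by (auto simp: Q_def)
    have "AE x in \<mu>. T t ((\<lambda>x. c * g x + h x) \<circ> \<sigma>) x = c * T t (g \<circ> \<sigma>) x + T t (h \<circ> \<sigma>) x"
      using semigroup_lincomb[OF semigroup t sym_L2[OF L(1)] sym_L2[OF L(2)], of c] by (simp add: comp_def)
    moreover have "AE x in \<mu>. T t (\<lambda>x. c * g x + h x) (\<sigma> x) = c * T t g (\<sigma> x) + T t h (\<sigma> x)"
      by (rule sym_AE[OF semigroup_lincomb[OF semigroup t L, of c]])
    ultimately have "AE x in \<mu>. T t ((\<lambda>x. c * g x + h x) \<circ> \<sigma>) x = T t (\<lambda>x. c * g x + h x) (\<sigma> x)"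
      using g h unfolding Q_def by auto
    then show ?thesis using L2_lincomb[OF L, of c] by (simp add: Q_def)
  qed
  have Q_eigen: "Q g" if g: "neumann_laplacian K \<mu> g (\<lambda>x. - lam * g x)" and lam: "lam \<ge> 0" for g lam
  proof -
    have L: "g \<in> L_space \<mu> 2" by (rule neumann_laplacian_L2(1)[OF g])
    have g': "neumann_laplacian K \<mu> (g \<circ> \<sigma>) (\<lambda>x. - lam * (g \<circ> \<sigma>) x)"
      using sym_neumann_laplacian[OF g] by (simp add: comp_def)
    have "AE x in \<mu>. T t g x = exp (- lam * t) * g x"
      by (rule semigroup_eigenfunction[OF semigroup L g lam t])
    from sym_AE[OF this] semigroup_eigenfunction[OF semigroup sym_L2[OF L] g' lam t]
    have "AE x in \<mu>. T t (g \<circ> \<sigma>) x = T t g (\<sigma> x)"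
      by eventually_elim (simp add: comp_def)
    then show ?thesis using L by (simp add: Q_def)
  qed
  \<comment> \<open>The eigenbasis spans only the functions of mean zero, so the mean is split off
    and treated as a constant.\<close>
  define m where "m = (\<integral>x. f x \<partial>\<mu>)"
  define f0 where "f0 x = f x - m" for x
  have f0: "f0 \<in> L2_zero \<mu>"
    unfolding L2_zero_def f0_def using f L2_integrable[OF f] by (simp add: m_def prob_space L2_diff L2_const)
  define s where "s n x = (\<Sum>j<n. L2_inner \<mu> (\<Phi> j) f0 * \<Phi> j x) + m" for n x
  have Qs: "Q (s n)" for n
  proof (induction n)
    case 0
    have "Q (\<lambda>_. m)" by (rule Q_eigen[OF neumann_laplacian_const]) simp
    then show ?case by (simp add: s_def[abs_def])
  next
    case (Suc n)
    have "Q (\<Phi> n)" using \<Phi>_laplacian[of n] eigval_pos(3)[of n] by (intro Q_eigen) auto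
    from Q_lincomb[OF this Suc, of "L2_inner \<mu> (\<Phi> n) f0"] show ?case
      by (simp add: s_def[abs_def] add_ac)
  qed
  have s: "s n \<in> L_space \<mu> 2" for n using Qs by (simp add: Q_def)
  have "f0 x - (\<Sum>j<n. L2_inner \<mu> (\<Phi> j) f0 * \<Phi> j x) = f x - s n x" for n x
    by (simp add: f0_def s_def)
  with \<Phi>_expansion[OF f0] have "(\<lambda>n. L2_dist f (s n)) \<longlonglongrightarrow> 0" by simp
  then have lim: "(\<lambda>n. L2_dist (s n) f) \<longlonglongrightarrow> 0"
    by (simp add: L2_norm_minus_commute[of f])
  show ?thesis
  \<comment> \<open>Both sides are L2 limits of \<open>T t (s n \<circ> \<sigma>)\<close>.\<close>
  proof (rule L2_eq_AE_of_tendsto)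
    show "T t (f \<circ> \<sigma>) \<in> L_space \<mu> 2" by (rule T_L2[OF sym_L2[OF f]])
    show "(\<lambda>x. T t f (\<sigma> x)) \<in> L_space \<mu> 2" using sym_L2[OF T_L2[OF f]] by (simp add: comp_def)
    show "T t (s n \<circ> \<sigma>) \<in> L_space \<mu> 2" for n by (rule T_L2[OF sym_L2[OF s]])
    show "(\<lambda>n. L2_dist (T t (s n \<circ> \<sigma>)) (T t (f \<circ> \<sigma>))) \<longlonglongrightarrow> 0"
    proof (rule tendsto_sandwich[OF _ _ tendsto_const lim])
      have "L2_dist (T t (s n \<circ> \<sigma>)) (T t (f \<circ> \<sigma>)) \<le> L2_norm \<mu> ((\<lambda>x. s n x - f x) \<circ> \<sigma>)" for n
        using semigroup_contraction_diff[OF semigroup t sym_L2[OF s] sym_L2[OF f], of n] by (simp add: comp_def)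
      also have "L2_norm \<mu> ((\<lambda>x. s n x - f x) \<circ> \<sigma>) = L2_dist (s n) f" for n
        by (rule sym_norm[OF L2_measurable[OF L2_diff[OF s f]]])
      finally show "\<forall>\<^sub>F n in sequentially. L2_dist (T t (s n \<circ> \<sigma>)) (T t (f \<circ> \<sigma>)) \<le> L2_dist (s n) f"
        by simp
    qed (simp add: L2_norm_nonneg)
    show "(\<lambda>n. L2_norm \<mu> (\<lambda>x. T t (s n \<circ> \<sigma>) x - T t f (\<sigma> x))) \<longlonglongrightarrow> 0"
    proof (rule tendsto_sandwich[OF _ _ tendsto_const lim])
      have "L2_norm \<mu> (\<lambda>x. T t (s n \<circ> \<sigma>) x - T t f (\<sigma> x)) = L2_norm \<mu> ((\<lambda>x. T t (s n) x - T t f x) \<circ> \<sigma>)" for n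
      proof (rule L2_norm_cong_AE)
        show "(\<lambda>x. T t (s n \<circ> \<sigma>) x - T t f (\<sigma> x)) \<in> borel_measurable \<mu>"
          using L2_diff[OF T_L2[OF sym_L2[OF s[of n]]] sym_L2[OF T_L2[OF f]]] by (simp add: comp_def L2_measurable)
        show "(\<lambda>x. T t (s n) x - T t f x) \<circ> \<sigma> \<in> borel_measurable \<mu>"
          by (intro L2_measurable sym_L2 L2_diff T_L2 s f)
        show "AE x in \<mu>. T t (s n \<circ> \<sigma>) x - T t f (\<sigma> x) = ((\<lambda>x. T t (s n) x - T t f x) \<circ> \<sigma>) x"
          using Qs[of n] by (auto simp: Q_def)
      qed
      also have "L2_norm \<mu> ((\<lambda>x. T t (s n) x - T t f x) \<circ> \<sigma>) = L2_dist (T t (s n)) (T t f)" for n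
        by (intro sym_norm L2_measurable L2_diff T_L2 s f)
      also have "L2_dist (T t (s n)) (T t f) \<le> L2_dist (s n) f" for n
        by (rule semigroup_contraction_diff[OF semigroup t s f])
      finally show "\<forall>\<^sub>F n in sequentially. L2_norm \<mu> (\<lambda>x. T t (s n \<circ> \<sigma>) x - T t f (\<sigma> x)) \<le> L2_dist (s n) f"
        by simp
    qed (simp add: L2_norm_nonneg)
  qed
qed

text \<open>Commutation with the semigroup holds almost everywhere, the claim at every point. A
  failure at \<open>(x0, y0)\<close> would by continuity give the difference a constant sign on a
  product of neighbourhoods. Testing the semigroup on the indicator of the second one then violates
  the commutation at every point of the first, a set of positive mass.\<close>

lemma kernel_sym:
  assumes t: "t > 0" and x0: "x0 \<in> K" and y0: "y0 \<in> K"
  shows "p t x0 (\<sigma> y0) = p t (\<sigma> x0) y0"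
proof (rule ccontr)
  assume neq: "p t x0 (\<sigma> y0) \<noteq> p t (\<sigma> x0) y0"
  define q where "q x y = p t x (\<sigma> y) - p t (\<sigma> x) y" for x y
  have p_cont: "continuous_on (K \<times> K) (\<lambda>z. p t (a (fst z)) (b (snd z)))"
    if a: "continuous_on K a" "a ` K \<subseteq> K" and b: "continuous_on K b" "b ` K \<subseteq> K" for a b
  proof -
    have "continuous_on (K \<times> K) (\<lambda>z. (t, a (fst z), b (snd z)))"
      by (intro continuous_intros continuous_on_compose2[OF a(1)] continuous_on_compose2[OF b(1)]) auto
    moreover have "(\<lambda>z. (t, a (fst z), b (snd z))) ` (K \<times> K) \<subseteq> {0<..} \<times> K \<times> K"
      using t a(2) b(2) by (auto simp: image_subset_iff)
    ultimately show ?thesis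
      using continuous_on_compose2[OF kernel_continuous] by fastforce
  qed
  have \<sigma>_cont: "continuous_on K \<sigma>" "\<sigma> ` K \<subseteq> K"
    using continuous_on_gasket_sym[OF i] sym_image by auto
  have id_cont: "continuous_on K (\<lambda>x. x)" "(\<lambda>x. x) ` K \<subseteq> K" by auto
  have q_cont: "continuous_on (K \<times> K) (\<lambda>z. q (fst z) (snd z))"
    unfolding q_def by (intro continuous_on_diff p_cont \<sigma>_cont id_cont)
  \<comment> \<open>Multiplying by \<open>c\<close> makes the difference positive near the point
    whichever sign it has.\<close>
  define c where "c = q x0 y0"
  have c: "c \<noteq> 0" using neq by (simp add: c_def q_def)
  have "continuous_on (K \<times> K) (\<lambda>z. c * q (fst z) (snd z))"
    by (intro continuous_intros q_cont)
  moreover have "c * q (fst (x0, y0)) (snd (x0, y0)) \<in> {0<..}"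
    using c by (auto simp: c_def zero_less_mult_iff)
  moreover have "(x0, y0) \<in> K \<times> K" using x0 y0 by simp
  ultimately obtain G where G: "open G" "(x0, y0) \<in> G" "\<And>z. z \<in> K \<times> K \<Longrightarrow> z \<in> G \<Longrightarrow> c * q (fst z) (snd z) \<in> {0<..}"
    unfolding continuous_on_topological using open_greaterThan by metis
  obtain U V where UV: "open U" "open V" "x0 \<in> U" "y0 \<in> V" "U \<times> V \<subseteq> G"
    using open_prod_elim[OF G(1,2)] by (metis mem_Sigma_iff)
  have pos: "c * q x y > 0" if "x \<in> U \<inter> K" "y \<in> V \<inter> K" for x y
    using G(3)[of "(x, y)"] UV(5) that by auto
  have VK: "V \<inter> K \<in> sets \<mu>" and UK: "U \<inter> K \<in> sets \<mu>"
    using UV by (auto simp: sets_eq sets_restrict_space)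
  define f :: "complex \<Rightarrow> real" where "f = indicator (V \<inter> K)"
  have f_meas[measurable]: "f \<in> borel_measurable \<mu>" unfolding f_def using VK by measurable
  have f: "f \<in> L_space \<mu> 2"
  proof -
    have "(\<lambda>x. (f x)\<^sup>2) \<in> borel_measurable \<mu>" by measurable
    then have "integrable \<mu> (\<lambda>x. (f x)\<^sup>2)"
      by (rule integrable_const_bound[of _ 1, rotated]) (simp add: f_def indicator_def)
    then show ?thesis using f_meas by (simp add: L2_iff)
  qed
  have section_int: "integrable \<mu> (\<lambda>y. k y * f y)" if k: "continuous_on K k" for k :: "complex \<Rightarrow> real"
  proof -
    obtain B where B: "\<And>y. y \<in> K \<Longrightarrow> \<bar>k y\<bar> \<le> B"
      using compact_imp_bounded[OF compact_continuous_image[OF k compact_K]] by (auto simp: bounded_iff)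
    have [measurable]: "k \<in> borel_measurable \<mu>" by (rule measurable_continuous_on[OF k])
    show ?thesis
    proof (rule integrable_const_bound[of _ B])
      have "norm (k y * f y) \<le> \<bar>k y\<bar>" for y by (simp add: f_def indicator_def)
      then show "AE y in \<mu>. norm (k y * f y) \<le> B"
        using B by (intro AE_I2) (auto simp: space_eq intro: order_trans)
    qed measurable
  qed
  have section_cont: "continuous_on K (\<lambda>y. p t x (\<sigma> y))" "continuous_on K (\<lambda>y. p t (\<sigma> x) y)" if x: "x \<in> K" for x
  proof -
    have "continuous_on K (\<lambda>y. (x, y))" "(\<lambda>y. (x, y)) ` K \<subseteq> K \<times> K" using x by (auto intro!: continuous_intros)
    from continuous_on_compose2[OF p_cont[OF id_cont \<sigma>_cont] this] continuous_on_compose2[OF p_cont[OF \<sigma>_cont id_cont] this]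
    show "continuous_on K (\<lambda>y. p t x (\<sigma> y))" "continuous_on K (\<lambda>y. p t (\<sigma> x) y)" by simp_all
  qed
  have zero: "AE y in \<mu>. y \<notin> V \<inter> K" if x: "x \<in> U \<inter> K" and eq: "T t (f \<circ> \<sigma>) x = T t f (\<sigma> x)" for x
  proof -
    have cont: "continuous_on K (\<lambda>y. p t x (\<sigma> y))" "continuous_on K (\<lambda>y. p t (\<sigma> x) y)"
      using section_cont x by auto
    have [measurable]: "(\<lambda>y. p t x (\<sigma> y)) \<in> borel_measurable \<mu>"
      by (rule measurable_continuous_on[OF cont(1)])
    \<comment> \<open>The invariance of \<mu> moves the reflection from the function to the
      kernel.\<close>
    have "T t (f \<circ> \<sigma>) x = (\<integral>y. p t x (\<sigma> (\<sigma> y)) * f (\<sigma> y) \<partial>\<mu>)"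
      by (simp add: T_def sym_sym)
    also have "\<dots> = (\<integral>y. p t x (\<sigma> y) * f y \<partial>\<mu>)"
      by (rule sym_integral[of "\<lambda>y. p t x (\<sigma> y) * f y"]) measurable
    finally have "(\<integral>y. p t x (\<sigma> y) * f y \<partial>\<mu>) - (\<integral>y. p t (\<sigma> x) y * f y \<partial>\<mu>) = 0"
      using eq by (simp add: T_def)
    moreover note ints = section_int[OF cont(1)] section_int[OF cont(2)]
    moreover have "(\<lambda>y. c * (q x y * f y)) = (\<lambda>y. c * (p t x (\<sigma> y) * f y - p t (\<sigma> x) y * f y))"
      by (simp add: q_def algebra_simps)
    ultimately have z: "(\<integral>y. c * (q x y * f y) \<partial>\<mu>) = 0" and int: "integrable \<mu> (\<lambda>y. c * (q x y * f y))"
      by simp_all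
    have nonneg: "c * (q x y * f y) \<ge> 0" for y
      using pos[OF x, of y] by (auto simp: f_def indicator_def)
    have "AE y in \<mu>. c * (q x y * f y) = 0"
      by (rule iffD1[OF integral_nonneg_eq_0_iff_AE[OF int AE_I2[OF nonneg]] z])
    then show ?thesis
    proof eventually_elim
      case (elim y)
      then show ?case using pos[OF x, of y] by (auto simp: f_def)
    qed
  qed
  have "measure \<mu> (V \<inter> K) > 0" "measure \<mu> (U \<inter> K) > 0"
    by (rule full_support[OF UV(2,4) y0], rule full_support[OF UV(1,3) x0])
  then have V_ne: "\<not> (AE y in \<mu>. y \<notin> V \<inter> K)" and U_ne: "\<not> (AE x in \<mu>. x \<notin> U \<inter> K)"
    unfolding prob_eq_0[OF VK, symmetric] prob_eq_0[OF UK, symmetric] by linarith+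
  have "AE x in \<mu>. x \<notin> U \<inter> K"
    using T_sym[OF t f] by eventually_elim (use zero V_ne in blast)
  then show False using U_ne by blast
qed

text \<open>The integrands agree for each \<open>t > 0\<close>, so the integrals agree, including
  their default value 0.\<close>

lemma riesz_kernel_sym:
  assumes "x \<in> K" "z \<in> K"
  shows "riesz_kernel p s (\<sigma> x) z = riesz_kernel p s x (\<sigma> z)"
  unfolding riesz_kernel_def using kernel_sym assms
  by (intro arg_cong2[of _ _ _ _ "(*)"] refl set_lebesgue_integral_cong) auto

end

section \<open>Negative powers of the Laplacian\<close>

context gasket_laplacian
begin

lemma inner_\<Phi>_sum:
  assumes "finite J"
  shows "L2_inner \<mu> (\<Phi> k) (\<lambda>x. \<Sum>j\<in>J. b j * \<Phi> j x) = (if k \<in> J then b k else 0)"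
proof -
  have "L2_inner \<mu> (\<Phi> k) (\<lambda>x. \<Sum>j\<in>J. b j * \<Phi> j x) = (\<Sum>j\<in>J. L2_inner \<mu> (\<Phi> k) (\<lambda>x. b j * \<Phi> j x))"
    by (intro L2_inner_sum L2_cmult \<Phi>_L2)
  also have "\<dots> = (\<Sum>j\<in>J. if k = j then b j else 0)"
    by (intro sum.cong refl) (simp add: L2_inner_cmult[OF \<Phi>_L2 \<Phi>_L2] \<Phi>_orthonormal)
  finally show ?thesis using assms by simp
qed

lemma norm_\<Phi>_sum:
  assumes "finite J"
  shows "(L2_norm \<mu> (\<lambda>x. \<Sum>j\<in>J. b j * \<Phi> j x))\<^sup>2 = (\<Sum>j\<in>J. (b j)\<^sup>2)"
proof -
  let ?S = "\<lambda>x. \<Sum>j\<in>J. b j * \<Phi> j x"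
  have S: "?S \<in> L_space \<mu> 2" by (intro L2_sum L2_cmult \<Phi>_L2)
  have "L2_inner \<mu> ?S ?S = (\<Sum>j\<in>J. L2_inner \<mu> ?S (\<lambda>x. b j * \<Phi> j x))"
    by (intro L2_inner_sum L2_cmult \<Phi>_L2 S)
  also have "\<dots> = (\<Sum>j\<in>J. b j * L2_inner \<mu> (\<Phi> j) ?S)"
    by (simp add: L2_inner_cmult[OF \<Phi>_L2 S] L2_inner_commute[of ?S])
  also have "\<dots> = (\<Sum>j\<in>J. (b j)\<^sup>2)"
    by (simp add: inner_\<Phi>_sum[OF assms] power2_eq_square)
  finally show ?thesis by (simp add: L2_norm_square)
qed

lemma coefficients_eq_AE:
  assumes f: "f \<in> L2_zero \<mu>" and g: "g \<in> L2_zero \<mu>"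
    and eq: "\<And>k. L2_inner \<mu> (\<Phi> k) f = L2_inner \<mu> (\<Phi> k) g"
  shows "AE x in \<mu>. f x = g x"
proof (rule L2_eq_AE_of_tendsto[OF L2_zero_L2[OF f] L2_zero_L2[OF g]])
  let ?u = "\<lambda>n x. \<Sum>j<n. L2_inner \<mu> (\<Phi> j) f * \<Phi> j x"
  show "?u n \<in> L_space \<mu> 2" for n by (intro L2_sum L2_cmult \<Phi>_L2)
  show "(\<lambda>n. L2_norm \<mu> (\<lambda>x. ?u n x - f x)) \<longlonglongrightarrow> 0"
    using \<Phi>_expansion[OF f] by (simp only: L2_norm_minus_commute[of f])
  show "(\<lambda>n. L2_norm \<mu> (\<lambda>x. ?u n x - g x)) \<longlonglongrightarrow> 0"
    using \<Phi>_expansion[OF g] by (simp only: L2_norm_minus_commute[of g] eq)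
qed

context
  fixes s :: real
  assumes s: "0 < s"
begin

abbreviation "N \<equiv> laplacian_neg_power \<mu> eigval \<Phi> s"

definition partial :: "(complex \<Rightarrow> real) \<Rightarrow> nat \<Rightarrow> complex \<Rightarrow> real" where
  "partial f n x = (\<Sum>j<n. eigval j powr (- s) * L2_inner \<mu> (\<Phi> j) f * \<Phi> j x)"

lemma partial_L2_zero: "partial f n \<in> L2_zero \<mu>"
  unfolding partial_def[abs_def] by (intro L2_zero_sum \<Phi>_L2_zero)

text \<open>For \<open>s > 0\<close> no weight \<open>eigval j powr (- s)\<close> exceeds that of
  the lowest eigenvalue. By orthonormality the weighted partial sums are then Cauchy because those
  of the plain expansion are.\<close>

lemma partial_norm_le:
  assumes f: "f \<in> L2_zero \<mu>" and le: "n \<le> m"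
  shows "L2_dist (partial f m) (partial f n) \<le> eigval 0 powr (- s) *
    L2_norm \<mu> (\<lambda>x. (\<Sum>j<m. L2_inner \<mu> (\<Phi> j) f * \<Phi> j x) - (\<Sum>j<n. L2_inner \<mu> (\<Phi> j) f * \<Phi> j x))"
proof -
  have diff: "(\<Sum>j<m. h j) - (\<Sum>j<n. h j) = (\<Sum>j\<in>{n..<m}. h j)" for h :: "nat \<Rightarrow> real"
    using sum_diff[of "{..<m}" "{..<n}" h] le by simp
  have mono: "eigval j powr (- s) \<le> eigval 0 powr (- s)" for j
    using eigval_pos(1)[of j] eigval_pos(2) s by (intro powr_mono2') auto
  have "(eigval j powr (- s) * c)\<^sup>2 \<le> (eigval 0 powr (- s))\<^sup>2 * c\<^sup>2" for j c
    unfolding power_mult_distrib by (intro mult_right_mono power_mono mono) auto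
  then have "(\<Sum>j\<in>{n..<m}. (eigval j powr (- s) * L2_inner \<mu> (\<Phi> j) f)\<^sup>2) \<le>
      (eigval 0 powr (- s))\<^sup>2 * (\<Sum>j\<in>{n..<m}. (L2_inner \<mu> (\<Phi> j) f)\<^sup>2)"
    unfolding sum_distrib_left by (intro sum_mono)
  then have "(L2_norm \<mu> (\<lambda>x. \<Sum>j\<in>{n..<m}. eigval j powr (- s) * L2_inner \<mu> (\<Phi> j) f * \<Phi> j x))\<^sup>2 \<le>
      (eigval 0 powr (- s) * L2_norm \<mu> (\<lambda>x. \<Sum>j\<in>{n..<m}. L2_inner \<mu> (\<Phi> j) f * \<Phi> j x))\<^sup>2"
    by (simp add: norm_\<Phi>_sum power_mult_distrib)
  then show ?thesis
    unfolding partial_def diff by (rule power2_le_imp_le) (simp add: L2_norm_nonneg)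
qed

text \<open>Justifies the choice in \<open>laplacian_neg_power\<close>.\<close>

lemma neg_power_exists:
  assumes f: "f \<in> L2_zero \<mu>"
  shows "\<exists>g. g \<in> L2_zero \<mu> \<and> (\<lambda>n. L2_dist g (partial f n)) \<longlonglongrightarrow> 0"
proof -
  define E where "E n x = (\<Sum>j<n. L2_inner \<mu> (\<Phi> j) f * \<Phi> j x)" for n x
  define C where "C = eigval 0 powr (- s)"
  have C: "C > 0" using eigval_pos(2) by (simp add: C_def)
  have E: "E n \<in> L_space \<mu> 2" for n unfolding E_def[abs_def] by (intro L2_sum L2_cmult \<Phi>_L2)
  have fL: "f \<in> L_space \<mu> 2" by (rule L2_zero_L2[OF f])
  have lim: "(\<lambda>n. L2_dist f (E n)) \<longlonglongrightarrow> 0"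
    using \<Phi>_expansion[OF f] by (simp add: E_def)
  have bound: "L2_dist (partial f m) (partial f n) \<le> C * L2_dist (E m) (E n)" for m n
  proof (cases "n \<le> m")
    case True
    then show ?thesis using partial_norm_le[OF f] by (simp add: C_def E_def)
  next
    case False
    then have "L2_dist (partial f n) (partial f m) \<le> C * L2_dist (E n) (E m)"
      using partial_norm_le[OF f, of m n] by (simp add: C_def E_def)
    then show ?thesis
      by (simp add: L2_norm_minus_commute[of "partial f n"] L2_norm_minus_commute[of "E n"])
  qed
  have "\<exists>g\<in>L_space \<mu> 2. (\<lambda>n. L2_dist (partial f n) g) \<longlonglongrightarrow> 0"
  proof (rule L2_complete)
    show "partial f n \<in> L_space \<mu> 2" for n by (rule L2_zero_L2[OF partial_L2_zero])
    fix e :: real assume e: "e > 0"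
    then have "e / (2 * C) > 0" using C by simp
    from LIMSEQ_D[OF lim this] obtain M where M: "\<And>n. n \<ge> M \<Longrightarrow> L2_dist f (E n) < e / (2 * C)"
      by (auto simp: L2_norm_nonneg)
    have "L2_dist (partial f m) (partial f n) < e" if "m \<ge> M" "n \<ge> M" for m n
    proof -
      have "L2_dist (E m) (E n) \<le> L2_dist f (E m) + L2_dist f (E n)"
        using L2_norm_diff_triangle[OF E fL E, of m n] L2_norm_minus_commute[of f "E m"] by simp
      also have "\<dots> < e / C" using M[OF that(1)] M[OF that(2)] by simp
      finally have "C * L2_dist (E m) (E n) < e"
        using C by (simp add: pos_less_divide_eq mult.commute)
      then show ?thesis using bound[of m n] by linarith
    qed
    then show "\<exists>M. \<forall>m\<ge>M. \<forall>n\<ge>M. L2_dist (partial f m) (partial f n) < e" by blast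
  qed
  then obtain g where g: "g \<in> L_space \<mu> 2" "(\<lambda>n. L2_dist (partial f n) g) \<longlonglongrightarrow> 0" by blast
  then show ?thesis
    using L2_zero_closed[OF partial_L2_zero g] by (auto simp: L2_norm_minus_commute[of g])
qed

lemma neg_power_L2_zero: "f \<in> L2_zero \<mu> \<Longrightarrow> N f \<in> L2_zero \<mu>"
  and neg_power_tendsto: "f \<in> L2_zero \<mu> \<Longrightarrow> (\<lambda>n. L2_norm \<mu> (\<lambda>x. partial f n x - N f x)) \<longlonglongrightarrow> 0"
proof -
  assume f: "f \<in> L2_zero \<mu>"
  have "N f \<in> L2_zero \<mu> \<and> (\<lambda>n. L2_norm \<mu> (\<lambda>x. N f x - partial f n x)) \<longlonglongrightarrow> 0"
    using someI_ex[OF neg_power_exists[OF f]] unfolding laplacian_neg_power_def partial_def .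
  then show "N f \<in> L2_zero \<mu>" "(\<lambda>n. L2_norm \<mu> (\<lambda>x. partial f n x - N f x)) \<longlonglongrightarrow> 0"
    by (auto simp: L2_norm_minus_commute[of "N f"])
qed

lemma neg_power_L2: "f \<in> L2_zero \<mu> \<Longrightarrow> N f \<in> L_space \<mu> 2"
  by (rule L2_zero_L2[OF neg_power_L2_zero])

lemma inner_neg_power_tendsto:
  assumes f: "f \<in> L2_zero \<mu>" and h: "h \<in> L_space \<mu> 2"
  shows "(\<lambda>n. \<Sum>j<n. eigval j powr (- s) * L2_inner \<mu> (\<Phi> j) f * L2_inner \<mu> h (\<Phi> j)) \<longlonglongrightarrow> L2_inner \<mu> h (N f)"
proof -
  have "L2_inner \<mu> h (partial f n) = (\<Sum>j<n. eigval j powr (- s) * L2_inner \<mu> (\<Phi> j) f * L2_inner \<mu> h (\<Phi> j))" for n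
    unfolding partial_def[abs_def]
    by (subst L2_inner_sum) (auto intro!: L2_cmult \<Phi>_L2 h simp: L2_inner_cmult[OF \<Phi>_L2 h])
  then show ?thesis
    using L2_inner_tendsto[OF h neg_power_L2[OF f] L2_zero_L2[OF partial_L2_zero] neg_power_tendsto[OF f]] by simp
qed

lemma inner_tendsto_expansion:
  assumes f: "f \<in> L2_zero \<mu>" and h: "h \<in> L_space \<mu> 2"
  shows "(\<lambda>n. \<Sum>j<n. L2_inner \<mu> (\<Phi> j) f * L2_inner \<mu> h (\<Phi> j)) \<longlonglongrightarrow> L2_inner \<mu> h f"
proof -
  define E where "E n x = (\<Sum>j<n. L2_inner \<mu> (\<Phi> j) f * \<Phi> j x)" for n x
  have E: "E n \<in> L_space \<mu> 2" for n unfolding E_def[abs_def] by (intro L2_sum L2_cmult \<Phi>_L2)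
  have "(\<lambda>n. L2_dist (E n) f) \<longlonglongrightarrow> 0"
    using \<Phi>_expansion[OF f] unfolding E_def by (simp only: L2_norm_minus_commute[of f])
  from L2_inner_tendsto[OF h L2_zero_L2[OF f] E this]
  have "(\<lambda>n. L2_inner \<mu> h (E n)) \<longlonglongrightarrow> L2_inner \<mu> h f" .
  moreover have "L2_inner \<mu> h (E n) = (\<Sum>j<n. L2_inner \<mu> (\<Phi> j) f * L2_inner \<mu> h (\<Phi> j))" for n
    unfolding E_def[abs_def]
    by (subst L2_inner_sum) (auto intro!: L2_cmult \<Phi>_L2 h simp: L2_inner_cmult[OF \<Phi>_L2 h])
  ultimately show ?thesis by simp
qed

text \<open>Only terms with \<open>eigval j = lam\<close> survive in the expansion, and their
  weights coincide. The general \<open>h\<close> allows both \<open>\<Phi> k\<close> and its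
  reflection.\<close>

lemma inner_neg_power_eigen:
  assumes f: "f \<in> L2_zero \<mu>" and h: "h \<in> L_space \<mu> 2"
    and orth: "\<And>j. eigval j \<noteq> lam \<Longrightarrow> L2_inner \<mu> h (\<Phi> j) = 0"
  shows "L2_inner \<mu> h (N f) = lam powr (- s) * L2_inner \<mu> h f"
proof (rule LIMSEQ_unique[OF inner_neg_power_tendsto[OF f h]])
  have "eigval j powr (- s) * L2_inner \<mu> (\<Phi> j) f * L2_inner \<mu> h (\<Phi> j) =
      lam powr (- s) * (L2_inner \<mu> (\<Phi> j) f * L2_inner \<mu> h (\<Phi> j))" for j
    using orth[of j] by (cases "eigval j = lam") auto
  then show "(\<lambda>n. \<Sum>j<n. eigval j powr (- s) * L2_inner \<mu> (\<Phi> j) f * L2_inner \<mu> h (\<Phi> j)) \<longlonglongrightarrow>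
      lam powr (- s) * L2_inner \<mu> h f"
    using tendsto_mult_left[OF inner_tendsto_expansion[OF f h], of "lam powr (- s)"] by (simp only: sum_distrib_left)
qed

lemma neg_power_coefficient:
  "f \<in> L2_zero \<mu> \<Longrightarrow> L2_inner \<mu> (\<Phi> k) (N f) = eigval k powr (- s) * L2_inner \<mu> (\<Phi> k) f"
  by (intro inner_neg_power_eigen \<Phi>_L2) (auto simp: \<Phi>_orthonormal)

text \<open>Coefficients determine a mean-zero function almost everywhere. In each coefficient the
  reflection is moved onto \<open>\<Phi> k\<close>, which keeps its eigenvalue and so picks up the
  same weight.\<close>

lemma neg_power_sym:
  assumes f: "f \<in> L2_zero \<mu>"
  shows "AE x in \<mu>. N (f \<circ> \<sigma>) x = (N f \<circ> \<sigma>) x"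
proof (rule coefficients_eq_AE)
  show "N (f \<circ> \<sigma>) \<in> L2_zero \<mu>" "N f \<circ> \<sigma> \<in> L2_zero \<mu>"
    by (intro neg_power_L2_zero sym_L2_zero f)+
  fix k
  have "L2_inner \<mu> (\<Phi> k) (N (f \<circ> \<sigma>)) = eigval k powr (- s) * L2_inner \<mu> (\<Phi> k) (f \<circ> \<sigma>)"
    by (rule neg_power_coefficient[OF sym_L2_zero[OF f]])
  also have "\<dots> = eigval k powr (- s) * L2_inner \<mu> (\<Phi> k \<circ> \<sigma>) f"
    by (simp only: sym_inner_swap[OF L2_measurable[OF \<Phi>_L2] L2_measurable[OF L2_zero_L2[OF f]]])
  also have "\<dots> = L2_inner \<mu> (\<Phi> k \<circ> \<sigma>) (N f)"
    by (rule inner_neg_power_eigen[symmetric, OF f sym_L2[OF \<Phi>_L2]]) (rule \<Phi>_sym_orthogonal, simp)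
  also have "\<dots> = L2_inner \<mu> (\<Phi> k) (N f \<circ> \<sigma>)"
    by (simp only: sym_inner_swap[OF L2_measurable[OF \<Phi>_L2] L2_measurable[OF neg_power_L2[OF f]]])
  finally show "L2_inner \<mu> (\<Phi> k) (N (f \<circ> \<sigma>)) = L2_inner \<mu> (\<Phi> k) (N f \<circ> \<sigma>)" .
qed

text \<open>\<open>N f\<close> is chosen separately for each \<open>f\<close>, so linearity has to
  be recovered from the coefficients and holds almost everywhere.\<close>

lemma neg_power_diff:
  assumes f: "f \<in> L2_zero \<mu>" and g: "g \<in> L2_zero \<mu>"
  shows "AE x in \<mu>. N (\<lambda>x. f x - g x) x = N f x - N g x"
proof (rule coefficients_eq_AE)
  have d: "(\<lambda>x. f x - g x) \<in> L2_zero \<mu>" by (rule L2_zero_diff[OF f g])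
  show "N (\<lambda>x. f x - g x) \<in> L2_zero \<mu>" "(\<lambda>x. N f x - N g x) \<in> L2_zero \<mu>"
    by (intro neg_power_L2_zero L2_zero_diff f g)+
  show "L2_inner \<mu> (\<Phi> k) (N (\<lambda>x. f x - g x)) = L2_inner \<mu> (\<Phi> k) (\<lambda>x. N f x - N g x)" for k
    by (simp add: neg_power_coefficient[OF d] neg_power_coefficient[OF f] neg_power_coefficient[OF g]
        L2_inner_diff neg_power_L2 f g L2_zero_L2 \<Phi>_L2 right_diff_distrib)
qed

section \<open>The completion and the extended negative power\<close>

context
  fixes \<iota> :: "(complex \<Rightarrow> real) \<Rightarrow> 'h::banach"
  assumes \<iota>: "sobolev_completion \<mu> eigval \<Phi> s \<iota>"
begin

lemma \<iota>_dist:
  assumes f: "f \<in> L2_zero \<mu>" and g: "g \<in> L2_zero \<mu>"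
  shows "norm (\<iota> f - \<iota> g) = L2_dist (N f) (N g)"
proof -
  have add: "\<And>f g. f \<in> L2_zero \<mu> \<Longrightarrow> g \<in> L2_zero \<mu> \<Longrightarrow> \<iota> (\<lambda>x. f x + g x) = \<iota> f + \<iota> g"
    and cmult: "\<And>f c. f \<in> L2_zero \<mu> \<Longrightarrow> \<iota> (\<lambda>x. c * f x) = c *\<^sub>R \<iota> f"
    and norm: "\<And>f. f \<in> L2_zero \<mu> \<Longrightarrow> norm (\<iota> f) = L2_norm \<mu> (N f)"
    using \<iota> unfolding sobolev_completion_def by blast+
  have zero: "(\<lambda>_. 0) \<in> L2_zero \<mu>" by (simp add: L2_zero_def L2_const)
  have "(\<lambda>x. - 1 * g x) \<in> L2_zero \<mu>" using L2_zero_lincomb[OF g zero, of "-1"] by simp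
  from add[OF f this] cmult[OF g, of "-1"] have "\<iota> (\<lambda>x. f x - g x) = \<iota> f - \<iota> g" by simp
  with norm[OF L2_zero_diff[OF f g]] have "norm (\<iota> f - \<iota> g) = L2_norm \<mu> (N (\<lambda>x. f x - g x))" by simp
  also have "\<dots> = L2_dist (N f) (N g)"
    by (intro L2_norm_cong_AE neg_power_diff f g L2_measurable L2_diff neg_power_L2 L2_zero_diff)
  finally show ?thesis .
qed

lemma \<iota>_dense: "closure (\<iota> ` L2_zero \<mu>) = UNIV"
  using \<iota> by (simp add: sobolev_completion_def)

lemma \<iota>_sym_dist:
  assumes f: "f \<in> L2_zero \<mu>" and g: "g \<in> L2_zero \<mu>"
  shows "norm (\<iota> (f \<circ> \<sigma>) - \<iota> (g \<circ> \<sigma>)) = norm (\<iota> f - \<iota> g)"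
proof -
  have "norm (\<iota> (f \<circ> \<sigma>) - \<iota> (g \<circ> \<sigma>)) = L2_dist (N (f \<circ> \<sigma>)) (N (g \<circ> \<sigma>))"
    by (rule \<iota>_dist[OF sym_L2_zero[OF f] sym_L2_zero[OF g]])
  also have "\<dots> = L2_norm \<mu> ((\<lambda>x. N f x - N g x) \<circ> \<sigma>)"
    using neg_power_sym[OF f] neg_power_sym[OF g]
    by (intro L2_norm_cong_AE L2_measurable L2_diff sym_L2 neg_power_L2 sym_L2_zero f g) auto
  also have "\<dots> = norm (\<iota> f - \<iota> g)"
    unfolding \<iota>_dist[OF f g] by (intro sym_norm L2_measurable L2_diff neg_power_L2 f g)
  finally show ?thesis .
qed

abbreviation "\<tau> \<equiv> sobolev_compose \<mu> \<iota> \<sigma>"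

text \<open>Justifies the definite description in \<open>sobolev_compose\<close>. Reflection is an
  isometry on the dense image of \<open>\<iota>\<close>, hence extends to the whole space, and
  continuous maps that agree on a dense set coincide.\<close>

lemma sobolev_compose_continuous: "continuous_on UNIV \<tau>"
  and sobolev_compose_\<iota>: "f \<in> L2_zero \<mu> \<Longrightarrow> \<tau> (\<iota> f) = \<iota> (f \<circ> \<sigma>)"
proof -
  let ?D = "\<iota> ` L2_zero \<mu>"
  \<comment> \<open>\<open>\<iota>\<close> identifies functions that agree almost everywhere, so the
    map is defined through representatives; the isometry shows that they do not matter.\<close>
  define r where "r h = (SOME f. f \<in> L2_zero \<mu> \<and> \<iota> f = h)" for h
  have r: "r h \<in> L2_zero \<mu>" "\<iota> (r h) = h" if "h \<in> ?D" for h
  proof -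
    have "\<exists>f. f \<in> L2_zero \<mu> \<and> \<iota> f = h" using that by blast
    from someI_ex[OF this] show "r h \<in> L2_zero \<mu>" "\<iota> (r h) = h" by (simp_all add: r_def)
  qed
  define \<tau>0 where "\<tau>0 h = \<iota> (r h \<circ> \<sigma>)" for h
  have iso: "dist (\<tau>0 h) (\<tau>0 k) = dist h k" if "h \<in> ?D" "k \<in> ?D" for h k
    using \<iota>_sym_dist[OF r(1)[OF that(1)] r(1)[OF that(2)]] r(2)[OF that(1)] r(2)[OF that(2)]
    by (simp add: \<tau>0_def dist_norm)
  have \<tau>0_\<iota>: "\<tau>0 (\<iota> f) = \<iota> (f \<circ> \<sigma>)" if f: "f \<in> L2_zero \<mu>" for f
  proof -
    have D: "\<iota> f \<in> ?D" using f by blast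
    have "norm (\<tau>0 (\<iota> f) - \<iota> (f \<circ> \<sigma>)) = 0"
      unfolding \<tau>0_def \<iota>_sym_dist[OF r(1)[OF D] f] r(2)[OF D] by simp
    then show ?thesis by simp
  qed
  have uc: "uniformly_continuous_on ?D \<tau>0"
    unfolding uniformly_continuous_on_def by (auto simp: iso)
  obtain g where g: "uniformly_continuous_on (closure ?D) g" "\<And>x. x \<in> ?D \<Longrightarrow> \<tau>0 x = g x"
    by (rule uniformly_continuous_on_extension_on_closure[OF uc]) (rule that)
  have spec: "continuous_on UNIV g \<and> (\<forall>f\<in>L2_zero \<mu>. g (\<iota> f) = \<iota> (f \<circ> \<sigma>))"
    using uniformly_continuous_imp_continuous[OF g(1)] g(2) \<tau>0_\<iota> \<iota>_dense by auto
  have unique: "g' = g" if g': "continuous_on UNIV g' \<and> (\<forall>f\<in>L2_zero \<mu>. g' (\<iota> f) = \<iota> (f \<circ> \<sigma>))" for g'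
  proof -
    have "closed {x. g' x = g x}" using g' spec by (intro closed_Collect_eq) auto
    moreover have "?D \<subseteq> {x. g' x = g x}" using g' spec by auto
    ultimately have "closure ?D \<subseteq> {x. g' x = g x}" by (rule closure_minimal[rotated])
    then show ?thesis by (auto simp: \<iota>_dense)
  qed
  have "\<tau> = g"
    unfolding sobolev_compose_def using spec unique by (rule the_equality)
  then show "continuous_on UNIV \<tau>" "f \<in> L2_zero \<mu> \<Longrightarrow> \<tau> (\<iota> f) = \<iota> (f \<circ> \<sigma>)"
    using spec by auto
qed

text \<open>The predicate under the choice in \<open>sobolev_neg_power\<close>, named so that its
  existence, uniqueness and behaviour under reflection can be stated.\<close>

definition neg_power_limit :: "'h \<Rightarrow> (complex \<Rightarrow> real) \<Rightarrow> bool" where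
  "neg_power_limit h g \<longleftrightarrow> g \<in> L2_zero \<mu> \<and>
     (\<exists>u. (\<forall>n. u n \<in> L2_zero \<mu>) \<and> (\<lambda>n. \<iota> (u n)) \<longlonglongrightarrow> h \<and>
        (\<lambda>n. L2_dist (N (u n)) g) \<longlonglongrightarrow> 0)"

lemma neg_power_limit_exists: "\<exists>g. neg_power_limit h g"
proof -
  have "h \<in> closure (\<iota> ` L2_zero \<mu>)" by (simp add: \<iota>_dense)
  then obtain y where y: "\<And>n. y n \<in> \<iota> ` L2_zero \<mu>" "y \<longlonglongrightarrow> h"
    unfolding closure_sequential by blast
  then obtain u where u: "\<And>n. u n \<in> L2_zero \<mu>" "\<And>n. y n = \<iota> (u n)"
    unfolding image_iff by metis
  have "\<exists>g\<in>L_space \<mu> 2. (\<lambda>n. L2_dist (N (u n)) g) \<longlonglongrightarrow> 0"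
  proof (rule L2_complete)
    show "N (u n) \<in> L_space \<mu> 2" for n by (rule neg_power_L2[OF u(1)])
    fix e :: real assume "e > 0"
    then show "\<exists>M. \<forall>m\<ge>M. \<forall>n\<ge>M. L2_dist (N (u m)) (N (u n)) < e"
      using LIMSEQ_imp_Cauchy[OF y(2)] unfolding Cauchy_def
      by (simp only: \<iota>_dist[OF u(1) u(1), symmetric] u(2) dist_norm)
  qed
  then obtain g where g: "g \<in> L_space \<mu> 2" "(\<lambda>n. L2_dist (N (u n)) g) \<longlonglongrightarrow> 0" by blast
  have "(\<lambda>n. \<iota> (u n)) \<longlonglongrightarrow> h" using y(2) by (simp add: u(2)[symmetric])
  then have "neg_power_limit h g"
    unfolding neg_power_limit_def using L2_zero_closed[OF neg_power_L2_zero[OF u(1)] g] g(2) u(1) by blast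
  then show ?thesis by (intro exI[of _ g])
qed

lemma neg_power_limit_sobolev: "neg_power_limit h (sobolev_neg_power \<mu> eigval \<Phi> s \<iota> h)"
  using someI_ex[OF neg_power_limit_exists[of h]] unfolding sobolev_neg_power_def neg_power_limit_def .

text \<open>Two sequences with the same limit in the completion have negative powers whose L2
  distance tends to 0.\<close>

lemma neg_power_limit_unique:
  assumes "neg_power_limit h g" "neg_power_limit h g'"
  shows "AE x in \<mu>. g x = g' x"
proof -
  obtain u where g: "g \<in> L2_zero \<mu>" and u: "\<And>n. u n \<in> L2_zero \<mu>" "(\<lambda>n. \<iota> (u n)) \<longlonglongrightarrow> h"
    "(\<lambda>n. L2_dist (N (u n)) g) \<longlonglongrightarrow> 0"
    using assms(1) unfolding neg_power_limit_def by blast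
  obtain v where g': "g' \<in> L2_zero \<mu>" and v: "\<And>n. v n \<in> L2_zero \<mu>" "(\<lambda>n. \<iota> (v n)) \<longlonglongrightarrow> h"
    "(\<lambda>n. L2_dist (N (v n)) g') \<longlonglongrightarrow> 0"
    using assms(2) unfolding neg_power_limit_def by blast
  have "(\<lambda>n. norm (\<iota> (u n) - \<iota> (v n))) \<longlonglongrightarrow> norm (h - h)"
    by (intro tendsto_norm tendsto_diff u(2) v(2))
  then have "(\<lambda>n. L2_dist (N (u n)) (N (v n))) \<longlonglongrightarrow> 0"
    by (simp add: \<iota>_dist[OF u(1) v(1)])
  from tendsto_add[OF this v(3)]
  have lim: "(\<lambda>n. L2_dist (N (u n)) (N (v n)) + L2_dist (N (v n)) g') \<longlonglongrightarrow> 0" by simp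
  have "(\<lambda>n. L2_dist (N (u n)) g') \<longlonglongrightarrow> 0"
  proof (rule tendsto_sandwich[OF _ _ tendsto_const lim])
    show "\<forall>\<^sub>F n in sequentially. L2_dist (N (u n)) g' \<le>
        L2_dist (N (u n)) (N (v n)) + L2_dist (N (v n)) g'"
      by (intro always_eventually allI L2_norm_diff_triangle neg_power_L2 u(1) v(1) L2_zero_L2[OF g'])
  qed (simp add: L2_norm_nonneg)
  from L2_eq_AE_of_tendsto[OF L2_zero_L2[OF g] L2_zero_L2[OF g'] neg_power_L2[OF u(1)] u(3) this]
  show ?thesis .
qed

text \<open>Reflecting an approximating sequence of \<open>h\<close> gives one of
  \<open>\<tau> h\<close>, and its negative powers are reflected with it.\<close>

lemma neg_power_limit_compose:
  assumes "neg_power_limit h g"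
  shows "neg_power_limit (\<tau> h) (g \<circ> \<sigma>)"
proof -
  obtain u where g: "g \<in> L2_zero \<mu>" and u: "\<And>n. u n \<in> L2_zero \<mu>" "(\<lambda>n. \<iota> (u n)) \<longlonglongrightarrow> h"
    "(\<lambda>n. L2_dist (N (u n)) g) \<longlonglongrightarrow> 0"
    using assms unfolding neg_power_limit_def by blast
  have "(\<lambda>n. \<tau> (\<iota> (u n))) \<longlonglongrightarrow> \<tau> h"
    using continuous_on_tendsto_compose[OF sobolev_compose_continuous u(2)] by simp
  then have lim_\<iota>: "(\<lambda>n. \<iota> (u n \<circ> \<sigma>)) \<longlonglongrightarrow> \<tau> h"
    by (simp only: sobolev_compose_\<iota>[OF u(1)])
  have "L2_dist (N (u n \<circ> \<sigma>)) (g \<circ> \<sigma>) = L2_dist (N (u n)) g" for n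
  proof -
    have "L2_dist (N (u n \<circ> \<sigma>)) (g \<circ> \<sigma>) = L2_norm \<mu> ((\<lambda>x. N (u n) x - g x) \<circ> \<sigma>)"
      using neg_power_sym[OF u(1)]
      by (intro L2_norm_cong_AE L2_measurable L2_diff sym_L2 neg_power_L2 sym_L2_zero u(1) L2_zero_L2[OF g]) auto
    also have "\<dots> = L2_dist (N (u n)) g"
      by (intro sym_norm L2_measurable L2_diff neg_power_L2 u(1) L2_zero_L2[OF g])
    finally show ?thesis .
  qed
  then have "(\<lambda>n. L2_dist (N (u n \<circ> \<sigma>)) (g \<circ> \<sigma>)) \<longlonglongrightarrow> 0"
    using u(3) by (simp only:)
  then show ?thesis
    unfolding neg_power_limit_def
    by (intro conjI exI[of _ "\<lambda>n. u n \<circ> \<sigma>"] allI sym_L2_zero g u(1) lim_\<iota>)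
qed

lemma sobolev_neg_power_sym:
  "AE x in \<mu>. sobolev_neg_power \<mu> eigval \<Phi> s \<iota> (\<tau> h) x = (sobolev_neg_power \<mu> eigval \<Phi> s \<iota> h \<circ> \<sigma>) x"
  by (rule neg_power_limit_unique[OF neg_power_limit_sobolev neg_power_limit_compose[OF neg_power_limit_sobolev]])

lemma sobolev_neg_power_L2_zero: "sobolev_neg_power \<mu> eigval \<Phi> s \<iota> h \<in> L2_zero \<mu>"
  using neg_power_limit_sobolev[of h] by (simp add: neg_power_limit_def)

end

end

end

section \<open>Invariance of the fields\<close>

context stable_space
begin

lemma same_fdd_SI:
  assumes \<sigma>: "\<sigma> \<in> \<mu> \<rightarrow>\<^sub>M \<mu>" and inv: "distr \<mu> \<mu> \<sigma> = \<mu>" and invol: "\<And>x. x \<in> space \<mu> \<Longrightarrow> \<sigma> (\<sigma> x) = x"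
  assumes X: "\<And>j. j \<in> I \<Longrightarrow> X j = SI (f j \<circ> \<sigma>)" and Y: "\<And>j. j \<in> I \<Longrightarrow> Y j = SI (f j)"
  shows "same_fdd P I X Y"
  unfolding same_fdd_def
proof (intro conjI ballI allI impI)
  fix J assume J: "J \<subseteq> I" "finite J"
  have "(\<lambda>\<omega>. \<lambda>j\<in>J. X j \<omega>) = (\<lambda>\<omega>. \<lambda>j\<in>J. SI (f j \<circ> \<sigma>) \<omega>)" "(\<lambda>\<omega>. \<lambda>j\<in>J. Y j \<omega>) = (\<lambda>\<omega>. \<lambda>j\<in>J. SI (f j) \<omega>)"
    using X Y J(1) by (auto simp: fun_eq_iff restrict_def)
  then show "distr P (\<Pi>\<^sub>M i\<in>J. borel) (\<lambda>\<omega>. \<lambda>i\<in>J. X i \<omega>) = distr P (\<Pi>\<^sub>M i\<in>J. borel) (\<lambda>\<omega>. \<lambda>i\<in>J. Y i \<omega>)"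
    using joint_law_SI[OF \<sigma> inv invol J(2), of f] by simp
qed (simp_all add: X Y SI_measurable)

text \<open>A single law is the coordinate of a joint law over a one-element index set.\<close>

lemma distr_SI_preserved:
  assumes \<sigma>: "\<sigma> \<in> \<mu> \<rightarrow>\<^sub>M \<mu>" and inv: "distr \<mu> \<mu> \<sigma> = \<mu>" and invol: "\<And>x. x \<in> space \<mu> \<Longrightarrow> \<sigma> (\<sigma> x) = x"
  shows "distr P borel (SI (f \<circ> \<sigma>)) = distr P borel (SI f)"
proof -
  have component: "distr (distr P (\<Pi>\<^sub>M j\<in>{0::nat}. borel) (\<lambda>\<omega>. \<lambda>j\<in>{0}. SI g \<omega>)) borel (\<lambda>z. z 0) = distr P borel (SI g)" for g
  proof -
    have proj: "(\<lambda>z. z 0) \<in> (\<Pi>\<^sub>M j\<in>{0::nat}. borel :: real measure) \<rightarrow>\<^sub>M borel"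
      by (rule measurable_component_singleton) simp
    have vec: "(\<lambda>\<omega>. \<lambda>j\<in>{0::nat}. SI g \<omega>) \<in> P \<rightarrow>\<^sub>M (\<Pi>\<^sub>M j\<in>{0::nat}. borel)"
      by (rule measurable_restrict) (rule SI_measurable)
    show ?thesis
      by (subst distr_distr[OF proj vec]) (simp add: comp_def)
  qed
  show ?thesis
    using joint_law_SI[OF \<sigma> inv invol, of "{0::nat}" "\<lambda>_. f"] component[of "f \<circ> \<sigma>"] component[of f] by simp
qed

end

theorem proposition3p16:
  fixes K :: "complex set" and \<mu> :: "complex measure"
    and eigval :: "nat \<Rightarrow> real" and \<Phi> :: "nat \<Rightarrow> complex \<Rightarrow> real"
    and p :: "real \<Rightarrow> complex \<Rightarrow> complex \<Rightarrow> real"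
    and P :: "'w measure" and W :: "complex set \<Rightarrow> 'w \<Rightarrow> real"
    and \<alpha> s :: real
  assumes "sierpinski_gasket K"
    and "gasket_measure K \<mu>"
    and "laplacian_eigenbasis K \<mu> eigval \<Phi>"
    and "gasket_heat_kernel K \<mu> p"
    and "0 < \<alpha>" and "\<alpha> \<le> 2" and "0 < s"
    and "stable_random_measure P \<mu> \<alpha> W"
  shows "(\<forall>f\<in>L_space \<mu> \<alpha>. \<forall>i\<in>{0, 1, 2}.
            f \<circ> gasket_sym i \<in> L_space \<mu> \<alpha> \<and>
            distr P borel (stable_integral P \<mu> \<alpha> W (f \<circ> gasket_sym i)) =
            distr P borel (stable_integral P \<mu> \<alpha> W f))
       \<and> (\<forall>\<iota> :: (complex \<Rightarrow> real) \<Rightarrow> 'h::banach. sobolev_completion \<mu> eigval \<Phi> s \<iota> \<longrightarrow>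
            (\<forall>i\<in>{0, 1, 2}. same_fdd P UNIV
               (\<lambda>h. fractional_stable_field P \<mu> eigval \<Phi> s \<alpha> W \<iota>
                      (sobolev_compose \<mu> \<iota> (gasket_sym i) h))
               (\<lambda>h. fractional_stable_field P \<mu> eigval \<Phi> s \<alpha> W \<iota> h)))
       \<and> (s > max ((\<alpha> - 1) * dim_h / (\<alpha> * dim_w)) 0 \<longrightarrow>
            (\<forall>i\<in>{0, 1, 2}. same_fdd P K
               (\<lambda>x. pointwise_stable_field P \<mu> p s \<alpha> W (gasket_sym i x))
               (\<lambda>x. pointwise_stable_field P \<mu> p s \<alpha> W x)))"
proof (intro conjI ballI allI impI)
  interpret G: gasket_space K \<mu>
    by (rule gasket_space.intro) (use assms in auto)
  interpret P: prob_space P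
    using assms(8) by (simp add: stable_random_measure_def)
  interpret stable_space P \<mu> \<alpha> W
    by unfold_locales (use assms in auto)
  have kernel: "gasket_kernel K \<mu> i eigval \<Phi> p" if "i \<in> {0, 1, 2}" for i
    by unfold_locales (use assms that in auto)
  {
    fix i :: nat and f assume i: "i \<in> {0, 1, 2}" and f: "f \<in> L_space \<mu> \<alpha>"
    interpret gasket_kernel K \<mu> i eigval \<Phi> p by (rule kernel[OF i])
    show "f \<circ> gasket_sym i \<in> L_space \<mu> \<alpha>"
      by (rule L_space_measure_preserving[OF measurable_sym distr_sym f])
    show "distr P borel (stable_integral P \<mu> \<alpha> W (f \<circ> gasket_sym i)) = distr P borel (stable_integral P \<mu> \<alpha> W f)"
      by (rule distr_SI_preserved[OF measurable_sym distr_sym sym_sym])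
  }
  {
    fix i :: nat and \<iota> :: "(complex \<Rightarrow> real) \<Rightarrow> 'h"
    assume i: "i \<in> {0, 1, 2}" and \<iota>: "sobolev_completion \<mu> eigval \<Phi> s \<iota>"
    interpret gasket_kernel K \<mu> i eigval \<Phi> p by (rule kernel[OF i])
    let ?R = "sobolev_neg_power \<mu> eigval \<Phi> s \<iota>"
    have R: "?R h \<in> L_space \<mu> 2" for h
      by (rule G.L2_zero_L2[OF sobolev_neg_power_L2_zero[OF \<open>0 < s\<close> \<iota>]])
    \<comment> \<open>The integrands agree only almost everywhere, yet the chosen integrals are
      equal.\<close>
    have "stable_integral P \<mu> \<alpha> W (?R (sobolev_compose \<mu> \<iota> (gasket_sym i) h)) =
        stable_integral P \<mu> \<alpha> W (?R h \<circ> gasket_sym i)" for h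
      by (rule SI_cong_AE[OF G.L2_subset_L_space[OF R \<alpha>] G.L2_subset_L_space[OF sym_L2[OF R] \<alpha>]
            sobolev_neg_power_sym[OF \<open>0 < s\<close> \<iota>]])
    then show "same_fdd P UNIV
        (\<lambda>h. fractional_stable_field P \<mu> eigval \<Phi> s \<alpha> W \<iota> (sobolev_compose \<mu> \<iota> (gasket_sym i) h))
        (\<lambda>h. fractional_stable_field P \<mu> eigval \<Phi> s \<alpha> W \<iota> h)"
      by (intro same_fdd_SI[OF measurable_sym distr_sym sym_sym, where f = ?R])
         (simp_all add: fractional_stable_field_def)
  }
  {
    fix i :: nat assume i: "i \<in> {0, 1, 2}"
    interpret gasket_kernel K \<mu> i eigval \<Phi> p by (rule kernel[OF i])
    show "same_fdd P K (\<lambda>x. pointwise_stable_field P \<mu> p s \<alpha> W (gasket_sym i x))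
        (\<lambda>x. pointwise_stable_field P \<mu> p s \<alpha> W x)"
    \<comment> \<open>The symmetry of the kernel transfers the reflection from the point
      \<open>x\<close> to the integration variable.\<close>
    proof (rule same_fdd_SI[OF measurable_sym distr_sym sym_sym, where f = "\<lambda>x. riesz_kernel p s x"])
      fix x assume "x \<in> K"
      then show "pointwise_stable_field P \<mu> p s \<alpha> W (gasket_sym i x) =
          stable_integral P \<mu> \<alpha> W (riesz_kernel p s x \<circ> gasket_sym i)"
        unfolding pointwise_stable_field_def
        by (intro SI_cong) (simp add: riesz_kernel_sym G.space_eq)
    qed (simp add: pointwise_stable_field_def)
  }
qed

end
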